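(* Let $(e^{tA})_{t\ge0}$ be a $C_0$-semigroup on a complex Banach lattice $E$ with $s(A)>-\infty$, and suppose that $(e^{t(A-s(A))})_{t\ge0}$ is bounded. Assume furthermore that $\sigma_{\mathrm{per}}(A)$ is non-empty, finite, and consists of poles of the resolvent. Then the following are equivalent: (i) $s(A)$ is a dominant spectral value of $A$ and the associated spectral projection $P$ is positive. (ii) The semigroup $(e^{tA})_{t\ge0}$ is individually asymptotically positive. (iii) The operators $e^{t(A-s(A))}$ converge strongly, as $t\to\infty$, to a positive operator $Q$. If (i)--(iii) hold, then $P=Q$. If in addition $(e^{t(A-s(A))})_{t\ge0}$ is uniformly exponentially stable on the spectral subspace associated with $\sigma(A)\setminus\sigma_{\mathrm{per}}(A)$, then (i)--(iii) are also equivalent to: (iv) The semigroup $(e^{tA})_{t\ge0}$ is uniformly asymptotically positive.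
   Context: $d_+(f):=\operatorname{dist}(f,E_+)$. $s(A)$ is the spectral bound, $\sigma_{\mathrm{per}}(A)=\sigma(A)\cap(s(A)+i\mathbb{R})$, and $s(A)$ is dominant if $\sigma_{\mathrm{per}}(A)=\{s(A)\}$. For a $C_0$-semigroup with $s(A)>-\infty$ and $(e^{t(A-s(A))})$ bounded: it is individually asymptotically positive if $d_+(e^{t(A-s(A))}f)\to0$ as $t\to\infty$ for every $f\in E_+$; uniformly asymptotically positive if for every $\varepsilon>0$ there is $t_0\ge0$ with $d_+(e^{t(A-s(A))}f)\le\varepsilon\|f\|$ for all $t\ge t_0$, $f\in E_+$. *)

theory Defs
  imports "HOL-Analysis.Analysis"
begin

class banach_lattice = banach + ordered_real_vector + lattice +
  assumes lattice_norm: "sup x (- x) \<le> sup y (- y) \<Longrightarrow> norm x \<le> norm y"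

text \<open>The complex Banach lattice E = E_R + i E_R is modelled as pairs (x, y) = x + i y.
  Addition is the componentwise one of the product type.\<close>
type_synonym 'r cplx = "'r \<times> 'r"

definition cscale :: "complex \<Rightarrow> 'r::banach_lattice cplx \<Rightarrow> 'r cplx" where
  "cscale c f = (Re c *\<^sub>R fst f - Im c *\<^sub>R snd f, Im c *\<^sub>R fst f + Re c *\<^sub>R snd f)"

definition lat_modulus :: "'r::banach_lattice cplx \<Rightarrow> 'r" where
  "lat_modulus f = (THE m. (\<forall>\<theta>. cos \<theta> *\<^sub>R fst f + sin \<theta> *\<^sub>R snd f \<le> m) \<and>
      (\<forall>u. (\<forall>\<theta>. cos \<theta> *\<^sub>R fst f + sin \<theta> *\<^sub>R snd f \<le> u) \<longrightarrow> m \<le> u))"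

definition cnorm :: "'r::banach_lattice cplx \<Rightarrow> real" where
  "cnorm f = norm (lat_modulus f)"

definition pos_cone :: "'r::banach_lattice cplx set" where
  "pos_cone = {(x, 0) | x. 0 \<le> x}"

definition dist_pos :: "'r::banach_lattice cplx \<Rightarrow> real" where
  "dist_pos f = Inf {cnorm (f - g) | g. g \<in> pos_cone}"

definition clinear_op :: "('r::banach_lattice cplx \<Rightarrow> 'r cplx) \<Rightarrow> bool" where
  "clinear_op T \<longleftrightarrow> (\<forall>f g. T (f + g) = T f + T g) \<and> (\<forall>c f. T (cscale c f) = cscale c (T f))"

definition bounded_op :: "('r::banach_lattice cplx \<Rightarrow> 'r cplx) \<Rightarrow> bool" where
  "bounded_op T \<longleftrightarrow> clinear_op T \<and> (\<exists>K. \<forall>f. cnorm (T f) \<le> K * cnorm f)"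

definition opnorm :: "('r::banach_lattice cplx \<Rightarrow> 'r cplx) \<Rightarrow> real" where
  "opnorm T = Sup {cnorm (T f) | f. cnorm f \<le> 1}"

definition positive_op :: "('r::banach_lattice cplx \<Rightarrow> 'r cplx) \<Rightarrow> bool" where
  "positive_op T \<longleftrightarrow> bounded_op T \<and> T ` pos_cone \<subseteq> pos_cone"

definition C0_semigroup :: "(real \<Rightarrow> 'r::banach_lattice cplx \<Rightarrow> 'r cplx) \<Rightarrow> bool" where
  "C0_semigroup T \<longleftrightarrow>
     (\<forall>t\<ge>0. bounded_op (T t)) \<and> T 0 = id \<and>
     (\<forall>s t. 0 \<le> s \<longrightarrow> 0 \<le> t \<longrightarrow> T (s + t) = T s \<circ> T t) \<and>
     (\<forall>f t0. 0 \<le> t0 \<longrightarrow> ((\<lambda>t. cnorm (T t f - T t0 f)) \<longlongrightarrow> 0) (at t0 within {0..}))"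

definition gen_dom :: "(real \<Rightarrow> 'r::banach_lattice cplx \<Rightarrow> 'r cplx) \<Rightarrow> 'r cplx set" where
  "gen_dom T = {f. \<exists>g. ((\<lambda>h. cnorm (cscale (complex_of_real (1 / h)) (T h f - f) - g)) \<longlongrightarrow> 0) (at_right 0)}"

definition gen :: "(real \<Rightarrow> 'r::banach_lattice cplx \<Rightarrow> 'r cplx) \<Rightarrow> 'r cplx \<Rightarrow> 'r cplx" where
  "gen T f = (THE g. ((\<lambda>h. cnorm (cscale (complex_of_real (1 / h)) (T h f - f) - g)) \<longlongrightarrow> 0) (at_right 0))"

definition resolvent :: "(real \<Rightarrow> 'r::banach_lattice cplx \<Rightarrow> 'r cplx) \<Rightarrow> complex \<Rightarrow> 'r cplx \<Rightarrow> 'r cplx" where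
  "resolvent T z = inv_into (gen_dom T) (\<lambda>f. cscale z f - gen T f)"

definition resolvent_set :: "(real \<Rightarrow> 'r::banach_lattice cplx \<Rightarrow> 'r cplx) \<Rightarrow> complex set" where
  "resolvent_set T = {z. bij_betw (\<lambda>f. cscale z f - gen T f) (gen_dom T) UNIV \<and>
                         bounded_op (resolvent T z)}"

definition gen_spectrum :: "(real \<Rightarrow> 'r::banach_lattice cplx \<Rightarrow> 'r cplx) \<Rightarrow> complex set" where
  "gen_spectrum T = - resolvent_set T"

text \<open>Spectral bound s(A) (equal to -infinity if the spectrum is empty).\<close>
definition spectral_bound :: "(real \<Rightarrow> 'r::banach_lattice cplx \<Rightarrow> 'r cplx) \<Rightarrow> ereal" where
  "spectral_bound T = Sup ((\<lambda>z. ereal (Re z)) ` gen_spectrum T)"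

definition sb :: "(real \<Rightarrow> 'r::banach_lattice cplx \<Rightarrow> 'r cplx) \<Rightarrow> real" where
  "sb T = real_of_ereal (spectral_bound T)"

definition per_spectrum :: "(real \<Rightarrow> 'r::banach_lattice cplx \<Rightarrow> 'r cplx) \<Rightarrow> complex set" where
  "per_spectrum T = {z \<in> gen_spectrum T. ereal (Re z) = spectral_bound T}"

definition dominant :: "(real \<Rightarrow> 'r::banach_lattice cplx \<Rightarrow> 'r cplx) \<Rightarrow> bool" where
  "dominant T \<longleftrightarrow> per_spectrum T = {complex_of_real (sb T)}"

definition rescaled :: "(real \<Rightarrow> 'r::banach_lattice cplx \<Rightarrow> 'r cplx) \<Rightarrow> real \<Rightarrow> 'r cplx \<Rightarrow> 'r cplx" where
  "rescaled T t f = exp (- (t * sb T)) *\<^sub>R T t f"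

definition rescaled_bounded :: "(real \<Rightarrow> 'r::banach_lattice cplx \<Rightarrow> 'r cplx) \<Rightarrow> bool" where
  "rescaled_bounded T \<longleftrightarrow> (\<exists>M. \<forall>t\<ge>0. \<forall>f. cnorm (rescaled T t f) \<le> M * cnorm f)"

definition op_holomorphic_on :: "(complex \<Rightarrow> 'r::banach_lattice cplx \<Rightarrow> 'r cplx) \<Rightarrow> complex set \<Rightarrow> bool" where
  "op_holomorphic_on g S \<longleftrightarrow> (\<forall>z\<in>S. bounded_op (g z) \<and>
      (\<exists>D. bounded_op D \<and>
        ((\<lambda>w. opnorm (\<lambda>f. cscale (1 / (w - z)) (g w f - g z f) - D f)) \<longlongrightarrow> 0) (at z within S)))"

definition pole_of_resolvent :: "(real \<Rightarrow> 'r::banach_lattice cplx \<Rightarrow> 'r cplx) \<Rightarrow> complex \<Rightarrow> bool" where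
  "pole_of_resolvent T z0 \<longleftrightarrow> z0 \<in> gen_spectrum T \<and>
     (\<exists>r m g. r > 0 \<and> ball z0 r - {z0} \<subseteq> resolvent_set T \<and> op_holomorphic_on g (ball z0 r) \<and>
        (\<forall>z \<in> ball z0 r - {z0}. \<forall>f. resolvent T z f = cscale (1 / (z - z0) ^ m) (g z f)))"

text \<open>Riesz spectral projection of an isolated spectral point z0:
  P = (1 / (2 pi i)) times the contour integral of R(z, A) over a small circle around z0.\<close>
definition riesz_proj :: "(real \<Rightarrow> 'r::banach_lattice cplx \<Rightarrow> 'r cplx) \<Rightarrow> complex \<Rightarrow> 'r cplx \<Rightarrow> 'r cplx" where
  "riesz_proj T z0 = (SOME P. \<exists>r>0. cball z0 r \<inter> gen_spectrum T = {z0} \<and>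
      P = (\<lambda>f. integral {0..2 * pi}
             (\<lambda>\<theta>. cscale (complex_of_real r * cis \<theta> / complex_of_real (2 * pi))
                        (resolvent T (z0 + complex_of_real r * cis \<theta>) f))))"

definition riesz_proj_set :: "(real \<Rightarrow> 'r::banach_lattice cplx \<Rightarrow> 'r cplx) \<Rightarrow> complex set \<Rightarrow> 'r cplx \<Rightarrow> 'r cplx" where
  "riesz_proj_set T S f = (\<Sum>z\<in>S. riesz_proj T z f)"

text \<open>Uniform exponential stability of the rescaled semigroup on the spectral subspace
  of sigma(A) minus sigma_per(A), i.e. on the range of I - P_per.\<close>
definition stable_off_per :: "(real \<Rightarrow> 'r::banach_lattice cplx \<Rightarrow> 'r cplx) \<Rightarrow> bool" where
  "stable_off_per T \<longleftrightarrow> (\<exists>M \<epsilon>. \<epsilon> > 0 \<and> (\<forall>t\<ge>0. \<forall>f \<in> range (\<lambda>g. g - riesz_proj_set T (per_spectrum T) g).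
       cnorm (rescaled T t f) \<le> M * exp (- \<epsilon> * t) * cnorm f))"

definition indiv_asym_pos :: "(real \<Rightarrow> 'r::banach_lattice cplx \<Rightarrow> 'r cplx) \<Rightarrow> bool" where
  "indiv_asym_pos T \<longleftrightarrow> (\<forall>f\<in>pos_cone. ((\<lambda>t. dist_pos (rescaled T t f)) \<longlongrightarrow> 0) at_top)"

definition unif_asym_pos :: "(real \<Rightarrow> 'r::banach_lattice cplx \<Rightarrow> 'r cplx) \<Rightarrow> bool" where
  "unif_asym_pos T \<longleftrightarrow> (\<forall>\<epsilon>>0. \<exists>t0\<ge>0. \<forall>t\<ge>t0. \<forall>f\<in>pos_cone.
       dist_pos (rescaled T t f) \<le> \<epsilon> * cnorm f)"

definition strong_limit :: "(real \<Rightarrow> 'r::banach_lattice cplx \<Rightarrow> 'r cplx) \<Rightarrow> ('r cplx \<Rightarrow> 'r cplx) \<Rightarrow> bool" where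
  "strong_limit T Q \<longleftrightarrow> (\<forall>f. ((\<lambda>t. cnorm (rescaled T t f - Q f)) \<longlongrightarrow> 0) at_top)"

end

theory Submission
  imports Defs "HOL-Library.Lattice_Algebras" "HOL-Complex_Analysis.Cauchy_Integral_Formula"
    "HOL-Real_Asymp.Real_Asymp"
begin

text \<open>After rescaling, the semigroup \<open>S\<close> is bounded and its peripheral spectrum is a finite set of
  poles on the imaginary axis. Boundedness excludes Jordan blocks, so the Riesz projections \<open>P\<^sub>z\<close> are
  projections onto eigenspaces. The resolvent applied to \<open>f - (\<Sum>z. P\<^sub>z f)\<close> extends continuously to
  the imaginary axis, and Ingham's Tauberian argument gives
  \<open>S t f - (\<Sum>z. exp (z * t) P\<^sub>z f) \<longlonglongrightarrow> 0\<close>.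

  If \<open>S\<close> is individually asymptotically positive, then by recurrence the group
  \<open>U t = (\<Sum>z. exp (z * t) P\<^sub>z)\<close> is positive for all real \<open>t\<close>. Since \<open>U t f\<close> is nonnegative for \<open>t\<close> of
  both signs, its generator \<open>D\<close> maps \<open>f\<close> into the band generated by \<open>f\<close>. If \<open>i b\<close> with \<open>b \<noteq> 0\<close> were an
  eigenvalue, then \<open>D\<^sup>2 x = - b\<^sup>2 x\<close> for some real \<open>x \<noteq> 0\<close>; by locality the same equation holds for the
  positive and negative parts of \<open>x\<close>, and \<open>U (pi / b)\<close> maps these to their negatives, contradicting
  positivity. Hence \<open>0\<close> is the only pole and \<open>P\<^sub>0 = U 0\<close> is positive.\<close>

section \<open>The complexification norm of a Banach lattice\<close>

text \<open>No spectral gap is assumed: the remaining spectrum may approach the imaginary axis at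
  infinity, so orbits off the poles need not decay exponentially. A Tauberian argument sees only the
  boundary values of the resolvent and yields strong convergence. Exponential stability enters only
  to make the positivity uniform.

  The obstacle in the order-theoretic step is that the range of the positive projection
  \<open>U 0\<close> need not be a sublattice: the modulus of a fixed vector need not be fixed.
  Computing modulo vectors whose modulus is killed by the projection replaces the passage to a
  quotient lattice.

  The spectral part is free of order. It is stated for a bounded action of the complex numbers on a
  real Banach space, because the product norm on pairs is equivalent to the lattice norm but need
  not be homogeneous for complex scalars. Equivalence suffices for limits, boundedness and
  poles.\<close>

instance banach_lattice \<subseteq> lattice_ab_group_add ..

section \<open>Order modulus and closedness of the positive cone of the real lattice\<close>

definition pabs :: "'r::banach_lattice \<Rightarrow> 'r" where
  "pabs x = sup x (- x)"

lemma pabs_ge: "x \<le> pabs x" "- x \<le> pabs x"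
  by (simp_all add: pabs_def)

lemma pabs_minus [simp]: "pabs (- x) = pabs x"
  by (simp add: pabs_def sup_commute)

lemma pabs_nonneg [simp]: "0 \<le> pabs x"
proof -
  have "x + (- x) \<le> pabs x + pabs x"
    by (intro add_mono pabs_ge)
  then show ?thesis by simp
qed

lemma pabs_leI: "x \<le> y \<Longrightarrow> - x \<le> y \<Longrightarrow> pabs x \<le> y"
  by (simp add: pabs_def)

lemma pabs_of_nonneg: "0 \<le> x \<Longrightarrow> pabs x = x"
  unfolding pabs_def by (rule sup_absorb1) (meson neg_le_0_iff_le order_trans)

lemma pabs_triangle: "pabs (x + y) \<le> pabs x + pabs y"
proof (rule pabs_leI)
  show "x + y \<le> pabs x + pabs y" by (intro add_mono pabs_ge)
  have "- x + - y \<le> pabs x + pabs y" by (intro add_mono pabs_ge)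
  then show "- (x + y) \<le> pabs x + pabs y" by (simp add: algebra_simps)
qed

lemma pabs_scaleR_le: "pabs (c *\<^sub>R x) \<le> \<bar>c\<bar> *\<^sub>R pabs x"
proof (rule pabs_leI)
  have *: "d *\<^sub>R x \<le> \<bar>d\<bar> *\<^sub>R pabs x" for d :: real
  proof (cases "0 \<le> d")
    case True
    then show ?thesis by (simp add: scaleR_left_mono pabs_ge)
  next
    case False
    have "(- d) *\<^sub>R (- x) \<le> (- d) *\<^sub>R pabs x"
      using False by (intro scaleR_left_mono pabs_ge) auto
    then show ?thesis using False by simp
  qed
  show "c *\<^sub>R x \<le> \<bar>c\<bar> *\<^sub>R pabs x" by (rule *)
  show "- (c *\<^sub>R x) \<le> \<bar>c\<bar> *\<^sub>R pabs x" using *[of "- c"] by simp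
qed

lemma norm_le_of_pabs_le: "pabs x \<le> y \<Longrightarrow> norm x \<le> norm y"
  by (rule lattice_norm) (metis pabs_def pabs_ge(1) order_trans)

lemma norm_pabs [simp]: "norm (pabs x) = norm (x :: 'r::banach_lattice)"
proof (rule antisym)
  show "norm (pabs x) \<le> norm x"
    by (rule lattice_norm) (metis pabs_def pabs_nonneg pabs_of_nonneg order_refl)
  show "norm x \<le> norm (pabs x)"
    by (rule norm_le_of_pabs_le) simp
qed

lemma norm_mono_nonneg: "0 \<le> x \<Longrightarrow> x \<le> y \<Longrightarrow> norm x \<le> norm (y :: 'r::banach_lattice)"
  by (rule norm_le_of_pabs_le) (simp add: pabs_of_nonneg)

text \<open>For every nonnegative \<open>y\<close> the negative part of \<open>x\<close> is
  dominated by \<open>pabs (y - x)\<close>, so its norm is arbitrarily small. This is the closedness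
  of the positive cone, in the form that also fits distances to the cone.\<close>

lemma nonneg_of_approx:
  fixes x :: "'r::banach_lattice"
  assumes "\<And>e. 0 < e \<Longrightarrow> \<exists>y\<ge>0. norm (y - x) < e"
  shows "0 \<le> x"
proof -
  have "norm (sup (- x) 0) \<le> 0"
  proof (rule field_le_epsilon)
    fix e :: real assume "0 < e"
    then obtain y where y: "0 \<le> y" "norm (y - x) < e" using assms by blast
    have "- x \<le> y - x" using y(1) by simp
    also have "\<dots> \<le> pabs (y - x)" by (rule pabs_ge)
    finally have "sup (- x) 0 \<le> pabs (y - x)" by simp
    then have "norm (sup (- x) 0) \<le> norm (pabs (y - x))"
      by (intro norm_mono_nonneg) auto
    then show "norm (sup (- x) 0) \<le> 0 + e" using y by simp
  qed
  then have "sup (- x) 0 = 0" by simp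
  then have "- x \<le> 0" by (metis sup_ge1)
  then show ?thesis by simp
qed

lemma nonneg_limit:
  fixes x :: "'r::banach_lattice"
  assumes "X \<longlonglongrightarrow> x" "\<And>n. 0 \<le> X n"
  shows "0 \<le> x"
proof (rule nonneg_of_approx)
  fix e :: real assume "0 < e"
  then obtain n where "dist (X n) x < e"
    using assms(1) by (metis lim_sequentially order_refl)
  then show "\<exists>y\<ge>0. norm (y - x) < e"
    using assms(2) by (auto simp: dist_norm)
qed

lemma le_limit:
  fixes x :: "'r::banach_lattice"
  assumes "X \<longlonglongrightarrow> x" "Y \<longlonglongrightarrow> y" "\<And>n. X n \<le> Y n"
  shows "x \<le> y"
  using nonneg_limit[OF tendsto_diff[OF assms(2,1)]] assms(3) by simp

text \<open>The suprema over finer and finer grids form a Cauchy sequence, so no order completeness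
  is needed.\<close>

lemma lipschitz_family_has_lub:
  fixes e :: "real \<Rightarrow> 'r::banach_lattice"
  assumes lip: "\<And>s t. e s \<le> e t + \<bar>s - t\<bar> *\<^sub>R w"
    and per: "\<And>t. \<exists>s\<in>{0..p}. e t = e s" and p: "0 < p"
  shows "\<exists>m. (\<forall>t. e t \<le> m) \<and> (\<forall>u. (\<forall>t. e t \<le> u) \<longrightarrow> m \<le> u)"
proof -
  \<comment> \<open>Going from 0 to 1 and back with the Lipschitz estimate costs
    \<open>w + w\<close>, which must therefore be nonnegative.\<close>
  have w0: "0 \<le> w"
  proof -
    have "0 \<le> (e 0 + \<bar>1 - 0\<bar> *\<^sub>R w - e 1) + (e 1 + \<bar>0 - 1\<bar> *\<^sub>R w - e 0)"
      using lip[of 1 0] lip[of 0 1] by (intro add_nonneg_nonneg) simp_all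
    then show ?thesis by (simp add: algebra_simps)
  qed
  define grid where "grid n = (\<lambda>k. p * real k / real (Suc n)) ` {..Suc n}" for n
  define m where "m n = Sup_fin (e ` grid n)" for n
  define c where "c n = p / real (Suc n)" for n
  have fin: "finite (e ` grid n)" "e ` grid n \<noteq> {}" for n
    by (auto simp: grid_def)
  have c_lim: "c \<longlonglongrightarrow> 0"
    unfolding c_def by (rule LIMSEQ_Suc[OF lim_const_over_n])
  have c0: "0 \<le> c n" for n using p by (simp add: c_def)
  \<comment> \<open>After reduction to one period, \<open>k\<close> is the index of the grid point
    just below \<open>s\<close>. It is at most one mesh width \<open>c n\<close> away, and the
    Lipschitz estimate turns this width into the order error \<open>c n *\<^sub>R w\<close>.\<close>
  have near: "e t \<le> m n + c n *\<^sub>R w" for t n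
  proof -
    obtain s where s: "0 \<le> s" "s \<le> p" "e t = e s" using per[of t] by auto
    define k where "k = nat \<lfloor>s * real (Suc n) / p\<rfloor>"
    have "0 \<le> s * real (Suc n) / p" using s p by simp
    then have k1: "real k \<le> s * real (Suc n) / p" "s * real (Suc n) / p < real k + 1"
      unfolding k_def by linarith+
    have "s * real (Suc n) \<le> p * real (Suc n)" using s by (intro mult_right_mono) auto
    then have "s * real (Suc n) / p \<le> real (Suc n)" using p by (simp add: field_simps)
    then have "k \<le> Suc n" using k1 by linarith
    then have "p * real k / real (Suc n) \<in> grid n" unfolding grid_def by blast
    then have "e (p * real k / real (Suc n)) \<le> m n"
      unfolding m_def using fin by (intro Sup_fin.coboundedI) auto
    moreover have "\<bar>s - p * real k / real (Suc n)\<bar> \<le> c n"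
    proof -
      have *: "s - p * b / N = (s * N / p - b) * (p / N)" if "0 < N" for b N :: real
        using p that by (simp add: field_simps)
      have "s - p * real k / real (Suc n) = (s * real (Suc n) / p - real k) * c n"
        unfolding c_def by (rule *) simp
      also have "\<bar>\<dots>\<bar> \<le> 1 * c n"
        unfolding abs_mult using k1 c0[of n] by (intro mult_mono) auto
      finally show ?thesis by simp
    qed
    then have "\<bar>s - p * real k / real (Suc n)\<bar> *\<^sub>R w \<le> c n *\<^sub>R w"
      using w0 by (rule scaleR_right_mono)
    ultimately have "e (p * real k / real (Suc n)) + \<bar>s - p * real k / real (Suc n)\<bar> *\<^sub>R w
        \<le> m n + c n *\<^sub>R w" by (rule add_mono)
    with lip[of s "p * real k / real (Suc n)"] show ?thesis using s(3) by simp
  qed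
  have m_le: "m n \<le> u" if "\<And>t. e t \<le> u" for n u
    unfolding m_def using fin that by (intro Sup_fin.boundedI) auto
  have m_diff: "m n \<le> m k + c k *\<^sub>R w" for n k
    by (rule m_le) (rule near)
  have m_norm: "norm (m n - m k) \<le> (c n + c k) * norm w" for n k
  proof -
    have "pabs (m n - m k) \<le> (c n + c k) *\<^sub>R w"
    proof (rule pabs_leI)
      have "c k *\<^sub>R w \<le> (c n + c k) *\<^sub>R w" using c0 w0 by (intro scaleR_right_mono) auto
      then show "m n - m k \<le> (c n + c k) *\<^sub>R w"
        using m_diff[of n k] by (metis diff_le_eq add.commute order_trans)
      have "c n *\<^sub>R w \<le> (c n + c k) *\<^sub>R w" using c0 w0 by (intro scaleR_right_mono) auto
      then have "m k - m n \<le> (c n + c k) *\<^sub>R w"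
        using m_diff[of k n] by (metis diff_le_eq add.commute order_trans)
      then show "- (m n - m k) \<le> (c n + c k) *\<^sub>R w" by simp
    qed
    then have "norm (m n - m k) \<le> norm ((c n + c k) *\<^sub>R w)" by (rule norm_le_of_pabs_le)
    then show ?thesis using c0[of n] c0[of k] by simp
  qed
  have "Cauchy m"
  proof (rule metric_CauchyI)
    fix d :: real assume d: "0 < d"
    have "(\<lambda>n. 2 * (c n * norm w)) \<longlonglongrightarrow> 2 * (0 * norm w)" by (intro tendsto_intros c_lim)
    then have "\<forall>\<^sub>F n in sequentially. 2 * (c n * norm w) < d"
      using d by (intro order_tendstoD(2)) auto
    then obtain N where N: "\<And>n. n \<ge> N \<Longrightarrow> 2 * (c n * norm w) < d"
      by (auto simp: eventually_sequentially)
    have "dist (m n) (m k) < d" if "n \<ge> N" "k \<ge> N" for n k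
      using m_norm[of n k] N[OF that(1)] N[OF that(2)] by (simp add: dist_norm algebra_simps)
    then show "\<exists>M. \<forall>i\<ge>M. \<forall>j\<ge>M. dist (m i) (m j) < d" by blast
  qed
  then obtain l where l: "m \<longlonglongrightarrow> l" using Cauchy_convergent convergent_def by blast
  have "(\<lambda>n. m n + c n *\<^sub>R w) \<longlonglongrightarrow> l + 0 *\<^sub>R w" by (intro tendsto_intros l c_lim)
  then have 1: "e t \<le> l" for t
    using le_limit[OF tendsto_const[of "e t"]] near by simp
  have 2: "l \<le> u" if "\<And>t. e t \<le> u" for u
    using le_limit[OF l tendsto_const[of u]] m_le[OF that] by simp
  show ?thesis using 1 2 by blast
qed

section \<open>The modulus of a complex element\<close>

lemma abs_cos_diff_le: "\<bar>cos s - cos t\<bar> \<le> \<bar>s - t\<bar>" for s t :: real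
proof -
  have "\<bar>cos s - cos t\<bar> = 2 * (\<bar>sin ((s + t) / 2)\<bar> * \<bar>sin ((t - s) / 2)\<bar>)"
    unfolding cos_diff_cos abs_mult by (simp add: mult.assoc)
  also have "\<dots> \<le> 2 * (1 * \<bar>(t - s) / 2\<bar>)"
    by (intro mult_left_mono mult_mono abs_sin_le_one abs_sin_x_le_abs_x) auto
  finally show ?thesis by simp
qed

lemma abs_sin_diff_le: "\<bar>sin s - sin t\<bar> \<le> \<bar>s - t\<bar>" for s t :: real
  using abs_cos_diff_le[of "pi / 2 - s" "pi / 2 - t"]
  by (simp add: cos_diff)

text \<open>Rotating x + i y by an angle changes its real part by at most the angle times
  \<open>pabs (fst f) + pabs (snd f)\<close>, since sine and cosine are 1-Lipschitz. Periodicity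
  confines the angles to a compact interval.\<close>

lemma lat_modulus_exists:
  fixes f :: "'r::banach_lattice cplx"
  shows "\<exists>m. (\<forall>\<theta>. cos \<theta> *\<^sub>R fst f + sin \<theta> *\<^sub>R snd f \<le> m) \<and>
      (\<forall>u. (\<forall>\<theta>. cos \<theta> *\<^sub>R fst f + sin \<theta> *\<^sub>R snd f \<le> u) \<longrightarrow> m \<le> u)"
proof (rule lipschitz_family_has_lub[where p = "2 * pi" and w = "pabs (fst f) + pabs (snd f)"])
  fix s t :: real
  have "(cos s - cos t) *\<^sub>R fst f \<le> \<bar>s - t\<bar> *\<^sub>R pabs (fst f)"
    by (rule order_trans[OF pabs_ge(1) order_trans[OF pabs_scaleR_le]])
      (intro scaleR_right_mono abs_cos_diff_le pabs_nonneg)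
  moreover have "(sin s - sin t) *\<^sub>R snd f \<le> \<bar>s - t\<bar> *\<^sub>R pabs (snd f)"
    by (rule order_trans[OF pabs_ge(1) order_trans[OF pabs_scaleR_le]])
      (intro scaleR_right_mono abs_sin_diff_le pabs_nonneg)
  ultimately have "(cos s - cos t) *\<^sub>R fst f + (sin s - sin t) *\<^sub>R snd f
      \<le> \<bar>s - t\<bar> *\<^sub>R pabs (fst f) + \<bar>s - t\<bar> *\<^sub>R pabs (snd f)" by (rule add_mono)
  then have "cos t *\<^sub>R fst f + sin t *\<^sub>R snd f + ((cos s - cos t) *\<^sub>R fst f + (sin s - sin t) *\<^sub>R snd f)
    \<le> cos t *\<^sub>R fst f + sin t *\<^sub>R snd f + (\<bar>s - t\<bar> *\<^sub>R pabs (fst f) + \<bar>s - t\<bar> *\<^sub>R pabs (snd f))"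
    by (rule add_left_mono)
  moreover have "cos t *\<^sub>R fst f + sin t *\<^sub>R snd f + ((cos s - cos t) *\<^sub>R fst f + (sin s - sin t) *\<^sub>R snd f)
      = cos s *\<^sub>R fst f + sin s *\<^sub>R snd f"
    by (simp add: scaleR_diff_left)
  ultimately
  show "cos s *\<^sub>R fst f + sin s *\<^sub>R snd f
    \<le> cos t *\<^sub>R fst f + sin t *\<^sub>R snd f + \<bar>s - t\<bar> *\<^sub>R (pabs (fst f) + pabs (snd f))"
    by (simp only: scaleR_add_right)
next
  fix t :: real
  obtain s where s: "0 \<le> s" "s < 2 * pi" "sin t = sin s" "cos t = cos s"
    by (rule sincos_total_2pi[of "cos t" "sin t"]) auto
  then show "\<exists>s\<in>{0..2 * pi}. cos t *\<^sub>R fst f + sin t *\<^sub>R snd f = cos s *\<^sub>R fst f + sin s *\<^sub>R snd f"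
    by (intro bexI[of _ s]) auto
qed simp

lemma lat_modulus_lub:
  fixes f :: "'r::banach_lattice cplx"
  shows lat_modulus_upper: "cos \<theta> *\<^sub>R fst f + sin \<theta> *\<^sub>R snd f \<le> lat_modulus f"
    and lat_modulus_least: "(\<And>\<theta>. cos \<theta> *\<^sub>R fst f + sin \<theta> *\<^sub>R snd f \<le> u) \<Longrightarrow> lat_modulus f \<le> u"
proof -
  let ?P = "\<lambda>m. (\<forall>\<theta>. cos \<theta> *\<^sub>R fst f + sin \<theta> *\<^sub>R snd f \<le> m) \<and>
      (\<forall>u. (\<forall>\<theta>. cos \<theta> *\<^sub>R fst f + sin \<theta> *\<^sub>R snd f \<le> u) \<longrightarrow> m \<le> u)"
  obtain m where m: "?P m" using lat_modulus_exists[of f] by blast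
  then have "lat_modulus f = m"
    unfolding lat_modulus_def by (rule the_equality) (use m in \<open>meson order.antisym\<close>)
  with m show "cos \<theta> *\<^sub>R fst f + sin \<theta> *\<^sub>R snd f \<le> lat_modulus f"
    and "(\<And>\<theta>. cos \<theta> *\<^sub>R fst f + sin \<theta> *\<^sub>R snd f \<le> u) \<Longrightarrow> lat_modulus f \<le> u" by blast+
qed

section \<open>Equivalence of the lattice norm and the product norm\<close>

lemma cnorm_nonneg [simp]: "0 \<le> cnorm f"
  by (simp add: cnorm_def)

text \<open>The angles 0, pi, pi / 2 and - pi / 2 recover x, - x, y and - y from the supremum, so
  the modulus dominates both \<open>pabs (fst f)\<close> and \<open>pabs (snd f)\<close>.\<close>

lemma norm_le_cnorm: "norm f \<le> 2 * cnorm f"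
proof -
  have up: "u \<le> lat_modulus f" if "cos t *\<^sub>R fst f + sin t *\<^sub>R snd f = u" for t u
    using lat_modulus_upper[of t f] that by simp
  have "pabs (fst f) \<le> lat_modulus f"
    by (intro pabs_leI up[of 0] up[of pi]) simp_all
  then have 1: "norm (fst f) \<le> cnorm f" unfolding cnorm_def by (rule norm_le_of_pabs_le)
  have "pabs (snd f) \<le> lat_modulus f"
    by (intro pabs_leI up[of "pi / 2"] up[of "- (pi / 2)"]) simp_all
  then have 2: "norm (snd f) \<le> cnorm f" unfolding cnorm_def by (rule norm_le_of_pabs_le)
  have "norm f \<le> norm (fst f) + norm (snd f)" by (metis norm_Pair_le prod.collapse)
  with 1 2 show ?thesis by linarith
qed

lemma cnorm_le_norm: "cnorm f \<le> 2 * norm f"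
proof -
  have 0: "0 \<le> lat_modulus f"
  proof -
    have up: "u \<le> lat_modulus f" if "cos t *\<^sub>R fst f + sin t *\<^sub>R snd f = u" for t u
      using lat_modulus_upper[of t f] that by simp
    have "fst f + - fst f \<le> lat_modulus f + lat_modulus f"
      by (intro add_mono up[of 0] up[of pi]) simp_all
    then show ?thesis by simp
  qed
  have "lat_modulus f \<le> pabs (fst f) + pabs (snd f)"
  proof (rule lat_modulus_least)
    fix \<theta> :: real
    have *: "c *\<^sub>R x \<le> pabs x" if "\<bar>c\<bar> \<le> 1" for c and x :: 'a
    proof -
      have "c *\<^sub>R x \<le> \<bar>c\<bar> *\<^sub>R pabs x" by (rule order_trans[OF pabs_ge(1) pabs_scaleR_le])
      also have "\<dots> \<le> 1 *\<^sub>R pabs x" using that by (intro scaleR_right_mono) simp_all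
      finally show ?thesis by simp
    qed
    show "cos \<theta> *\<^sub>R fst f + sin \<theta> *\<^sub>R snd f \<le> pabs (fst f) + pabs (snd f)"
      by (intro add_mono * abs_cos_le_one abs_sin_le_one)
  qed
  then have "cnorm f \<le> norm (pabs (fst f) + pabs (snd f))"
    unfolding cnorm_def by (rule norm_mono_nonneg[OF 0])
  also have "\<dots> \<le> norm (fst f) + norm (snd f)" by (metis norm_triangle_ineq norm_pabs)
  also have "\<dots> \<le> norm f + norm f"
    using norm_fst_le[of "fst f" "snd f"] norm_snd_le[of "snd f" "fst f"] by (intro add_mono) auto
  finally show ?thesis by simp
qed

text \<open>Every limit in the problem is phrased through \<open>cnorm\<close>; this turns it into
  ordinary convergence in the product space.\<close>

lemma tendsto_cnorm_iff:
  "((\<lambda>x. cnorm (u x - l)) \<longlongrightarrow> 0) F \<longleftrightarrow> (u \<longlongrightarrow> l) F"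
proof
  assume *: "((\<lambda>x. cnorm (u x - l)) \<longlongrightarrow> 0) F"
  have "((\<lambda>x. u x - l) \<longlongrightarrow> 0) F"
    by (rule Lim_null_comparison[OF always_eventually tendsto_mult_right_zero[OF *, of 2]])
      (simp add: norm_le_cnorm)
  then show "(u \<longlongrightarrow> l) F" by (rule LIM_zero_cancel)
next
  assume "(u \<longlongrightarrow> l) F"
  then have *: "((\<lambda>x. norm (u x - l)) \<longlongrightarrow> 0) F" by (intro tendsto_norm_zero LIM_zero)
  show "((\<lambda>x. cnorm (u x - l)) \<longlongrightarrow> 0) F"
    by (rule Lim_null_comparison[OF always_eventually tendsto_mult_right_zero[OF *, of 2]])
      (simp add: cnorm_le_norm)
qed

lemma bounded_linear_of_cnorm_bound:
  assumes "clinear_op T" "\<And>f. cnorm (T f) \<le> K * cnorm f"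
  shows "bounded_linear T"
proof (rule bounded_linear_intro[where K = "4 * \<bar>K\<bar>"])
  fix f g :: "'a cplx"
  show "T (f + g) = T f + T g" using assms(1) unfolding clinear_op_def by blast
  fix r :: real
  have "cscale (complex_of_real r) h = r *\<^sub>R h" for h :: "'a cplx"
    by (simp add: cscale_def prod_eq_iff)
  then show "T (r *\<^sub>R f) = r *\<^sub>R T f" using assms(1) by (metis clinear_op_def)
  have "norm (T f) \<le> 2 * (K * cnorm f)"
    using norm_le_cnorm[of "T f"] assms(2)[of f] by linarith
  also have "\<dots> \<le> 2 * (\<bar>K\<bar> * (2 * norm f))"
    using cnorm_le_norm[of f] by (intro mult_left_mono mult_mono) auto
  finally show "norm (T f) \<le> norm f * (4 * \<bar>K\<bar>)" by (simp add: algebra_simps)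
qed

lemma bounded_op_iff: "bounded_op T \<longleftrightarrow> clinear_op T \<and> bounded_linear T"
proof
  assume "bounded_op T"
  then show "clinear_op T \<and> bounded_linear T"
    using bounded_linear_of_cnorm_bound unfolding bounded_op_def by blast
next
  assume *: "clinear_op T \<and> bounded_linear T"
  then obtain K where K: "\<And>f. norm (T f) \<le> norm f * K"  "0 \<le> K" using bounded_linear.nonneg_bounded by blast
  have "cnorm (T f) \<le> (4 * K) * cnorm f" for f
  proof -
    have "cnorm (T f) \<le> 2 * (norm f * K)" using cnorm_le_norm[of "T f"] K(1)[of f] by linarith
    also have "\<dots> \<le> 2 * ((2 * cnorm f) * K)"
      using norm_le_cnorm[of f] K(2) by (intro mult_left_mono mult_right_mono) auto
    finally show ?thesis by (simp add: algebra_simps)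
  qed
  then show "bounded_op T" using * unfolding bounded_op_def by blast
qed

section \<open>Bounded semigroups\<close>

text \<open>The type of pairs carries only a real structure, so complex scalars are an operation. It
  is only required to be a bounded bilinear action extending the real one; estimates then contain a
  constant \<open>K\<close> or \<open>B\<close> instead of homogeneity.\<close>

locale complex_banach =
  fixes sc :: "complex \<Rightarrow> 'a::banach \<Rightarrow> 'a"  (infixr "\<odot>" 75)
  assumes bilinear: "bounded_bilinear sc"
    and sc_one: "1 \<odot> f = f"
    and sc_sc: "a \<odot> b \<odot> f = (a * b) \<odot> f"
    and sc_of_real: "complex_of_real r \<odot> f = r *\<^sub>R f"
begin

sublocale sc: bounded_bilinear sc by (rule bilinear)

definition clin :: "('a \<Rightarrow> 'a) \<Rightarrow> bool" where
  "clin L \<longleftrightarrow> bounded_linear L \<and> (\<forall>c f. L (c \<odot> f) = c \<odot> L f)"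

lemma clin_linear: "clin L \<Longrightarrow> bounded_linear L"
  and clin_sc: "clin L \<Longrightarrow> L (c \<odot> f) = c \<odot> L f"
  by (simp_all add: clin_def)

lemmas clin_simps =
  bounded_linear.linear[THEN linear_add, OF clin_linear]
  bounded_linear.linear[THEN linear_diff, OF clin_linear]
  bounded_linear.linear[THEN linear_0, OF clin_linear]
  bounded_linear.linear[THEN linear_neg, OF clin_linear]
  bounded_linear.linear[THEN linear_sum, OF clin_linear]
  clin_sc
  bounded_linear.linear[THEN linear_scale, OF clin_linear]

lemma sc_minus_one: "(-1) \<odot> f = - f"
  by (metis sc.minus_left sc_one)

lemma sc_cancel: "c \<noteq> 0 \<Longrightarrow> c \<odot> f = c \<odot> g \<Longrightarrow> f = g"
  by (metis sc_one sc_sc left_inverse)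

lemma sc_eq_zero_iff [simp]: "c \<odot> f = 0 \<longleftrightarrow> c = 0 \<or> f = 0"
  using sc_cancel[of c f 0] by (auto simp: sc.zero_left sc.zero_right)

lemma sc_bound: obtains K where "0 < K" "\<And>c f. norm (c \<odot> f) \<le> K * norm c * norm f"
proof -
  obtain K where "0 < K" "\<And>c f. norm (c \<odot> f) \<le> norm c * norm f * K"
    using sc.pos_bounded by blast
  then show thesis by (intro that[of K]) (simp_all add: mult_ac)
qed

end

locale bounded_semigroup = complex_banach sc for sc :: "complex \<Rightarrow> 'a::banach \<Rightarrow> 'a"  (infixr "\<odot>" 75) +
  fixes S :: "real \<Rightarrow> 'a \<Rightarrow> 'a" and M :: real
  assumes S_clin: "0 \<le> t \<Longrightarrow> clin (S t)"
    and S_bound: "0 \<le> t \<Longrightarrow> norm (S t f) \<le> M * norm f"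
    and M_ge_1: "1 \<le> M"
    and S_zero [simp]: "S 0 f = f"
    and S_add: "0 \<le> s \<Longrightarrow> 0 \<le> t \<Longrightarrow> S (s + t) f = S s (S t f)"
    and S_cont: "continuous_on {0..} (\<lambda>t. S t f)"
begin

text \<open>\<open>gr x g\<close> says that \<open>x\<close> lies in the domain of the generator, which maps it to \<open>g\<close>.\<close>

definition gr :: "'a \<Rightarrow> 'a \<Rightarrow> bool" where
  "gr x g \<longleftrightarrow> ((\<lambda>h. (1 / h) *\<^sub>R (S h x - x)) \<longlongrightarrow> g) (at_right 0)"

lemmas S_linear = clin_linear[OF S_clin]
lemmas S_simps = clin_simps[OF S_clin]

lemma gr_unique: "gr x g \<Longrightarrow> gr x h \<Longrightarrow> g = h"
  unfolding gr_def by (rule tendsto_unique[OF trivial_limit_at_right_real])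

lemma gr_add: "gr x g \<Longrightarrow> gr y h \<Longrightarrow> gr (x + y) (g + h)"
proof -
  assume "gr x g" "gr y h"
  then have "((\<lambda>k. (1 / k) *\<^sub>R (S k x - x) + (1 / k) *\<^sub>R (S k y - y)) \<longlongrightarrow> g + h) (at_right 0)"
    unfolding gr_def by (rule tendsto_add)
  moreover have "\<forall>\<^sub>F k in at_right 0. (1 / k) *\<^sub>R (S k x - x) + (1 / k) *\<^sub>R (S k y - y)
      = (1 / k) *\<^sub>R (S k (x + y) - (x + y))"
    by (rule eventually_mono[OF eventually_at_right_less]) (simp add: S_simps algebra_simps)
  ultimately show ?thesis unfolding gr_def by (rule Lim_transform_eventually)
qed

lemma gr_clin:
  assumes "gr x g" "clin L" "\<And>t. 0 \<le> t \<Longrightarrow> L (S t x) = S t (L x)"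
  shows "gr (L x) (L g)"
proof -
  have "((\<lambda>k. L ((1 / k) *\<^sub>R (S k x - x))) \<longlongrightarrow> L g) (at_right 0)"
    using assms(1) unfolding gr_def by (rule bounded_linear.tendsto[OF clin_linear[OF assms(2)]])
  moreover have "\<forall>\<^sub>F k in at_right 0. L ((1 / k) *\<^sub>R (S k x - x)) = (1 / k) *\<^sub>R (S k (L x) - L x)"
    using assms(3)
    by (intro eventually_mono[OF eventually_at_right_less])
      (simp add: clin_simps[OF assms(2)])
  ultimately show ?thesis unfolding gr_def by (rule Lim_transform_eventually)
qed

lemma clin_scale: "clin (\<lambda>f. c \<odot> f)"
  unfolding clin_def by (auto simp: sc_sc mult.commute sc.bounded_linear_right)

lemma gr_sc: "gr x g \<Longrightarrow> gr (c \<odot> x) (c \<odot> g)"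
  by (rule gr_clin[OF _ clin_scale]) (simp_all add: S_simps)

lemma gr_minus: "gr x g \<Longrightarrow> gr (- x) (- g)"
  using gr_sc[of x g "-1"] by (simp add: sc_minus_one)

lemma gr_diff: "gr x g \<Longrightarrow> gr y h \<Longrightarrow> gr (x - y) (g - h)"
  using gr_add[OF _ gr_minus] by fastforce

section \<open>Derivatives of orbits, truncated Laplace integrals, eigenvectors\<close>

text \<open>On either side of \<open>t\<close> the difference quotient is \<open>S (min u t)\<close>
  applied to the quotient at 0 with step \<bar>u - t\<bar>. To the left of \<open>t\<close> the
  factor varies with \<open>u\<close>; the bound \<open>M\<close> and continuity of the orbit of
  \<open>g\<close> absorb this.\<close>

lemma S_has_vector_derivative:
  assumes "gr x g" "0 \<le> t"
  shows "((\<lambda>t. S t x) has_vector_derivative S t g) (at t within {0..})"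
proof -
  let ?q = "\<lambda>h. (1 / h) *\<^sub>R (S h x - x)" and ?F = "at t within {0..}"
  have abs_lim: "filterlim (\<lambda>u. \<bar>u - t\<bar>) (at_right 0) ?F"
    unfolding filterlim_at
  proof
    show "\<forall>\<^sub>F u in ?F. \<bar>u - t\<bar> \<in> {0<..} \<and> \<bar>u - t\<bar> \<noteq> 0"
      by (auto simp: eventually_at_filter)
    have "((\<lambda>u. \<bar>u - t\<bar>) \<longlongrightarrow> \<bar>t - t\<bar>) ?F" by (intro tendsto_intros)
    then show "((\<lambda>u. \<bar>u - t\<bar>) \<longlongrightarrow> 0) ?F" by simp
  qed
  have 1: "((\<lambda>u. M * norm (?q \<bar>u - t\<bar> - g)) \<longlongrightarrow> M * norm (g - g)) ?F"
    using filterlim_compose[OF assms(1)[unfolded gr_def] abs_lim]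
    by (intro tendsto_intros) simp
  have "((\<lambda>u. S (min u t) g) \<longlongrightarrow> S (min t t) g) ?F"
  proof (rule continuous_on_tendsto_compose[OF S_cont])
    show "((\<lambda>u. min u t) \<longlongrightarrow> min t t) ?F" by (intro tendsto_intros)
    show "\<forall>\<^sub>F u in ?F. min u t \<in> {0..}" using assms(2) by (auto simp: eventually_at_filter)
  qed (use assms in simp)
  then have 2: "((\<lambda>u. norm (S (min u t) g - S t g)) \<longlongrightarrow> norm (S (min t t) g - S t g)) ?F"
    by (intro tendsto_intros)
  have "((\<lambda>u. norm ((S u x - S t x) - (u - t) *\<^sub>R S t g) / norm (u - t)) \<longlongrightarrow> 0) ?F"
  proof (rule Lim_null_comparison)
    show "((\<lambda>u. M * norm (?q \<bar>u - t\<bar> - g) + norm (S (min u t) g - S t g)) \<longlongrightarrow> 0) ?F"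
      using tendsto_add[OF 1 2] by simp
    have "norm ((S u x - S t x) - (u - t) *\<^sub>R S t g) / norm (u - t)
        \<le> M * norm (?q \<bar>u - t\<bar> - g) + norm (S (min u t) g - S t g)" if "u \<noteq> t" "0 \<le> u" for u
    proof -
      let ?m = "min u t" and ?d = "\<bar>u - t\<bar>"
      have m: "0 \<le> ?m" using that assms by simp
      have quot: "(1 / (u - t)) *\<^sub>R (S u x - S t x) = S ?m (?q ?d)"
      proof (cases "u < t")
        case True
        have recip: "1 / (u - t) = - (1 / (t - u))"
          by (metis minus_diff_eq minus_divide_right)
        from True have "S t x = S u (S (t - u) x)"
          using S_add[of u "t - u" x] that by simp
        then show ?thesis using True that
          by (simp add: S_simps recip) (simp add: scaleR_diff_right)
      next
        case False
        then have "S u x = S t (S (u - t) x)"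
          using S_add[of t "u - t" x] that assms by simp
        then show ?thesis using False that assms
          by (simp add: S_simps)
      qed
      have "norm ((S u x - S t x) - (u - t) *\<^sub>R S t g) / norm (u - t)
          = norm ((1 / (u - t)) *\<^sub>R ((S u x - S t x) - (u - t) *\<^sub>R S t g))"
        by simp
      also have "(1 / (u - t)) *\<^sub>R ((S u x - S t x) - (u - t) *\<^sub>R S t g) = S ?m (?q ?d) - S t g"
        unfolding scaleR_diff_right[of _ "S u x - S t x"] quot using that by simp
      also have "\<dots> = S ?m (?q ?d - g) + (S ?m g - S t g)"
        using m by (simp add: S_simps)
      also have "norm \<dots> \<le> M * norm (?q ?d - g) + norm (S ?m g - S t g)"
        by (rule order_trans[OF norm_triangle_ineq add_right_mono[OF S_bound[OF m]]])
      finally show ?thesis .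
    qed
    then show "\<forall>\<^sub>F u in ?F. norm (norm ((S u x - S t x) - (u - t) *\<^sub>R S t g) / norm (u - t))
        \<le> M * norm (?q \<bar>u - t\<bar> - g) + norm (S (min u t) g - S t g)"
      by (auto simp: eventually_at_filter)
  qed
  then show ?thesis
    unfolding has_vector_derivative_def has_derivative_iff_norm
    by (simp add: bounded_linear_scaleR_left)
qed

lemma exp_S_has_vector_derivative:
  assumes "gr x g" "0 \<le> t"
  shows "((\<lambda>t. exp (- z * complex_of_real t) \<odot> S t x) has_vector_derivative
      exp (- z * complex_of_real t) \<odot> S t (g - z \<odot> x)) (at t within {0..})"
proof -
  have "((\<lambda>t. exp (- z * complex_of_real t)) has_vector_derivative - z * exp (- z * complex_of_real t))
      (at t within {0..})"
    by (auto intro!: derivative_eq_intros has_vector_derivative_real_field simp: algebra_simps)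
  from sc.has_vector_derivative[OF this S_has_vector_derivative[OF assms]]
  show ?thesis
    by (rule has_vector_derivative_eq_rhs)
      (use assms(2) in \<open>simp add: S_simps sc.diff_right sc_sc sc.minus_left mult.commute\<close>)
qed

text \<open>A Laplace transform with explicit remainder. Truncation keeps it valid on the imaginary
  axis, where the integral over the half-line need not converge.\<close>

lemma integral_exp_S:
  assumes "gr x g" "0 \<le> t"
  shows "((\<lambda>u. exp (- z * complex_of_real u) \<odot> S u (z \<odot> x - g)) has_integral
      (x - exp (- z * complex_of_real t) \<odot> S t x)) {0..t}"
proof -
  have "((\<lambda>u. exp (- z * complex_of_real u) \<odot> S u (g - z \<odot> x)) has_integral
      (exp (- z * complex_of_real t) \<odot> S t x - exp (- z * complex_of_real 0) \<odot> S 0 x)) {0..t}"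
    using assms
    by (intro fundamental_theorem_of_calculus has_vector_derivative_within_subset[OF exp_S_has_vector_derivative]) auto
  from has_integral_neg[OF this]
  show ?thesis
    by (rule has_integral_eq_rhs[OF has_integral_eq, rotated 1]) (simp_all add: S_simps sc.diff_right sc_one)
qed

lemma S_eigenvector:
  assumes "gr x (z \<odot> x)" "0 \<le> t"
  shows "S t x = exp (z * complex_of_real t) \<odot> x"
proof -
  have "((\<lambda>u. exp (- z * complex_of_real u) \<odot> S u (z \<odot> x - z \<odot> x)) has_integral 0) {0..t}"
    by (rule has_integral_is_0) (simp add: S_simps sc.zero_right)
  from has_integral_unique[OF integral_exp_S[OF assms] this]
  have "exp (- z * complex_of_real t) \<odot> S t x = x" by simp
  then have "exp (z * complex_of_real t) \<odot> exp (- z * complex_of_real t) \<odot> S t x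
      = exp (z * complex_of_real t) \<odot> x" by simp
  then show ?thesis by (simp add: sc_sc sc_one flip: exp_add)
qed

text \<open>Such a pair would give \<open>exp (- z * t) \<odot> S t v = v + t *\<^sub>R w\<close>,
  which grows linearly unless \<open>w = 0\<close>, while the left-hand side stays bounded for
  imaginary \<open>z\<close>.\<close>

lemma no_jordan_block:
  assumes v: "gr v (z \<odot> v + w)" and w: "gr w (z \<odot> w)" and z: "Re z = 0"
  shows "w = 0"
proof (rule ccontr)
  assume "w \<noteq> 0"
  obtain K where K: "0 < K" "\<And>c f. norm (c \<odot> f) \<le> K * norm c * norm f" by (rule sc_bound) blast
  have "t * norm w \<le> (1 + K * M) * norm v" if t: "0 \<le> t" for t
  proof -
    have "((\<lambda>u. exp (- z * complex_of_real u) \<odot> S u (z \<odot> v - (z \<odot> v + w))) has_integral - (t *\<^sub>R w)) {0..t}"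
    proof -
      have "((\<lambda>u. - w) has_integral (t - 0) *\<^sub>R (- w)) {0..t}"
        using has_integral_const_real[of "- w" 0 t] t by simp
      then show ?thesis
      proof (rule has_integral_eq_rhs[OF has_integral_eq, rotated 1])
        fix u assume "u \<in> {0..t}"
        then show "- w = exp (- z * complex_of_real u) \<odot> S u (z \<odot> v - (z \<odot> v + w))"
          using S_eigenvector[OF w, of u]
          by (simp add: S_simps sc.minus_right sc_sc sc_one flip: exp_add)
      qed simp
    qed
    from has_integral_unique[OF this integral_exp_S[OF v t]]
    have "t *\<^sub>R w = exp (- z * complex_of_real t) \<odot> S t v - v" by (metis minus_diff_eq minus_minus)
    then have "t * norm w = norm (exp (- z * complex_of_real t) \<odot> S t v - v)"
      using t by (metis abs_of_nonneg norm_scaleR)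
    also have "\<dots> \<le> K * norm (exp (- z * complex_of_real t)) * norm (S t v) + norm v"
      by (rule order_trans[OF norm_triangle_ineq4 add_right_mono[OF K(2)]])
    also have "norm (exp (- z * complex_of_real t)) = 1" using z by simp
    also have "K * 1 * norm (S t v) + norm v \<le> K * 1 * (M * norm v) + norm v"
      using K S_bound[OF t] by (intro add_right_mono mult_left_mono) auto
    finally show ?thesis by (simp add: algebra_simps)
  qed
  from this[of "((1 + K * M) * norm v + 1) / norm w"] K M_ge_1 \<open>w \<noteq> 0\<close> show False
    by simp
qed

end

section \<open>Resolvents\<close>

context complex_banach
begin

text \<open>The derivative with respect to the radius \<open>q\<close> is the integral of
  \<open>cis \<theta> \<odot> \<Psi>' (q * cis \<theta>)\<close>. Up to the factor
  \<open>\<i> * q\<close> this integrand is the angular derivative of a periodic function, hence it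
  integrates to zero.\<close>

lemma circle_integral_radius:
  fixes \<Psi> :: "complex \<Rightarrow> 'a"
  assumes der: "\<And>u. u \<in> cball 0 r - {0} \<Longrightarrow> (\<Psi> has_derivative (\<lambda>h. h \<odot> \<Psi>' u)) (at u within cball 0 r - {0})"
    and cont: "continuous_on (cball 0 r - {0}) \<Psi>'" and p: "0 < p" "p \<le> r"
  shows "integral {0..2 * pi} (\<lambda>\<theta>. \<Psi> (complex_of_real p * cis \<theta>))
       = integral {0..2 * pi} (\<lambda>\<theta>. \<Psi> (complex_of_real r * cis \<theta>))"
proof -
  let ?D = "cball 0 r - {0 :: complex}"
  have inD: "complex_of_real q * cis \<theta> \<in> ?D" if "q \<in> {p..r}" for q \<theta>
    using that p by (auto simp: norm_mult)
  define I where "I q = integral (cbox 0 (2 * pi)) (\<lambda>\<theta>. \<Psi> (complex_of_real q * cis \<theta>))" for q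
  have cont\<Psi>: "continuous_on ?D \<Psi>"
    using der by (rule has_derivative_continuous_on)
  have "(I has_vector_derivative 0) (at q within {p..r})" if q: "q \<in> {p..r}" for q
  proof -
    let ?f' = "\<lambda>q \<theta>. cis \<theta> \<odot> \<Psi>' (complex_of_real q * cis \<theta>)"
    have "(I has_vector_derivative integral (cbox 0 (2 * pi)) (?f' q)) (at q within {p..r})"
      unfolding I_def
    proof (rule leibniz_rule_vector_derivative[OF _ _ _ q])
      fix x t :: real assume x: "x \<in> {p..r}"
      have "((\<lambda>x. complex_of_real x * cis t) has_vector_derivative cis t) (at x within {p..r})"
        by (auto intro!: derivative_eq_intros has_vector_derivative_real_field)
      then have 1: "((\<lambda>x. complex_of_real x * cis t) has_derivative (\<lambda>h. h *\<^sub>R cis t)) (at x within {p..r})"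
        by (simp add: has_vector_derivative_def)
      have 2: "(\<Psi> has_derivative (\<lambda>h. h \<odot> \<Psi>' (complex_of_real x * cis t)))
          (at (complex_of_real x * cis t) within (\<lambda>x. complex_of_real x * cis t) ` {p..r})"
        by (rule has_derivative_subset[OF der[OF inD[OF x]]]) (use inD in auto)
      show "((\<lambda>x. \<Psi> (complex_of_real x * cis t)) has_vector_derivative ?f' x t) (at x within {p..r})"
        using has_derivative_in_compose[OF 1 2]
        by (simp add: has_vector_derivative_def sc.scaleR_left)
    next
      fix x assume x: "x \<in> {p..r}"
      show "(\<lambda>\<theta>. \<Psi> (complex_of_real x * cis \<theta>)) integrable_on cbox 0 (2 * pi)"
        by (intro integrable_continuous continuous_on_compose2[OF cont\<Psi>] continuous_intros)
          (use inD[OF x] in auto)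
    next
      show "continuous_on ({p..r} \<times> cbox 0 (2 * pi)) (\<lambda>(x, t). ?f' x t)"
        unfolding case_prod_beta
        by (intro sc.continuous_on continuous_on_compose2[OF cont] continuous_intros)
          (use inD in auto)
    qed auto
    moreover have "(?f' q has_integral 0) (cbox 0 (2 * pi))"
    proof -
      have "((\<lambda>\<theta>. \<Psi> (complex_of_real q * cis \<theta>)) has_vector_derivative
          (\<i> * complex_of_real q) \<odot> ?f' q t) (at t within {0..2 * pi})" for t
      proof -
        have "((\<lambda>\<theta>. complex_of_real q * cis \<theta>) has_vector_derivative (\<i> * complex_of_real q * cis t)) (at t within {0..2 * pi})"
          unfolding cis_conv_exp
          by (auto intro!: derivative_eq_intros has_vector_derivative_real_field simp: algebra_simps)
        then have 1: "((\<lambda>\<theta>. complex_of_real q * cis \<theta>) has_derivative (\<lambda>h. h *\<^sub>R (\<i> * complex_of_real q * cis t))) (at t within {0..2 * pi})"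
          by (simp add: has_vector_derivative_def)
        have 2: "(\<Psi> has_derivative (\<lambda>h. h \<odot> \<Psi>' (complex_of_real q * cis t)))
            (at (complex_of_real q * cis t) within (\<lambda>\<theta>. complex_of_real q * cis \<theta>) ` {0..2 * pi})"
          by (rule has_derivative_subset[OF der[OF inD[OF q]]]) (use inD[OF q] in auto)
        show ?thesis
          using has_derivative_in_compose[OF 1 2]
          by (simp add: has_vector_derivative_def sc.scaleR_left sc_sc mult_ac)
      qed
      then have "((\<lambda>t. (\<i> * complex_of_real q) \<odot> ?f' q t) has_integral
          \<Psi> (complex_of_real q * cis (2 * pi)) - \<Psi> (complex_of_real q * cis 0)) {0..2 * pi}"
        by (intro fundamental_theorem_of_calculus) auto
      then have "((\<lambda>t. (\<i> * complex_of_real q) \<odot> ?f' q t) has_integral 0) {0..2 * pi}"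
        by simp
      from has_integral_linear[OF this sc.bounded_linear_right, of "1 / (\<i> * complex_of_real q)"]
      show ?thesis using q p by (simp add: o_def sc_sc sc_one sc.zero_right)
    qed
    ultimately show ?thesis by (simp add: integral_unique)
  qed
  then obtain c where "\<And>q. q \<in> {p..r} \<Longrightarrow> I q = c"
    using has_vector_derivative_zero_constant[of "{p..r}" I] by (metis convex_real_interval(5))
  then have "I p = I r" using p by auto
  then show ?thesis by (simp add: I_def)
qed

end

lemma integral_circle_power_eq_zero:
  "((\<lambda>\<theta>. (complex_of_real r * cis \<theta>) ^ Suc k) has_integral 0) {0..2 * pi}"
proof -
  define G where "G \<theta> = complex_of_real r ^ Suc k * (exp (\<i> * complex_of_real (Suc k) * complex_of_real \<theta>) / (\<i> * complex_of_real (Suc k)))" for \<theta> :: real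
  have nz: "\<i> * complex_of_real (Suc k) \<noteq> 0" by (simp del: of_nat_Suc)
  have "(G has_vector_derivative (complex_of_real r * cis \<theta>) ^ Suc k) (at \<theta> within {0..2 * pi})" for \<theta>
  proof -
    have "(complex_of_real r * cis \<theta>) ^ Suc k = complex_of_real r ^ Suc k * exp (\<i> * complex_of_real (Suc k) * complex_of_real \<theta>)"
    proof -
      have "cis \<theta> ^ Suc k = exp (\<i> * complex_of_real (Suc k) * complex_of_real \<theta>)"
        unfolding Complex.DeMoivre by (simp add: cis_conv_exp mult_ac del: of_nat_Suc)
      then show ?thesis by (simp only: power_mult_distrib)
    qed
    moreover have "((\<lambda>w. complex_of_real r ^ Suc k * (exp (a * w) / a)) has_field_derivative complex_of_real r ^ Suc k * exp (a * w)) (at w)"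
      if "a \<noteq> 0" for a w :: complex
      using that by (auto intro!: derivative_eq_intros)
    ultimately show ?thesis unfolding G_def
      using nz by (intro has_vector_derivative_real_field) (auto simp del: of_nat_Suc power_Suc)
  qed
  then have "((\<lambda>\<theta>. (complex_of_real r * cis \<theta>) ^ Suc k) has_integral G (2 * pi) - G 0) {0..2 * pi}"
    by (intro fundamental_theorem_of_calculus) auto
  moreover have "exp (\<i> * complex_of_real (Suc k) * complex_of_real (2 * pi)) = 1"
    using exp_integer_2pi[of "real (Suc k)"] by (simp add: mult_ac del: of_nat_Suc)
  ultimately show ?thesis by (simp only: G_def) simp
qed

section \<open>The resolvent: identity, local bounds, derivative, integrals\<close>

context bounded_semigroup
begin

text \<open>One equivalence encodes both inverse laws: \<open>gr x (z \<odot> x - f)\<close> says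
  that \<open>x\<close> is in the domain and z - A maps it to \<open>f\<close>. No inverse function
  on a partial domain has to be handled.\<close>

definition is_resolvent :: "complex \<Rightarrow> ('a \<Rightarrow> 'a) \<Rightarrow> bool" where
  "is_resolvent z L \<longleftrightarrow> clin L \<and> (\<forall>f x. L f = x \<longleftrightarrow> gr x (z \<odot> x - f))"

definition rho :: "complex set" where
  "rho = {z. \<exists>L. is_resolvent z L}"

definition res :: "complex \<Rightarrow> 'a \<Rightarrow> 'a" where
  "res z = (SOME L. is_resolvent z L)"

lemma is_resolvent_res: "z \<in> rho \<Longrightarrow> is_resolvent z (res z)"
  unfolding rho_def res_def mem_Collect_eq by (rule someI_ex[of "is_resolvent z"])

lemma res_clin: "z \<in> rho \<Longrightarrow> clin (res z)"
  using is_resolvent_res by (simp add: is_resolvent_def)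

lemmas res_simps = clin_simps[OF res_clin]

lemma res_eq_iff: "z \<in> rho \<Longrightarrow> res z f = x \<longleftrightarrow> gr x (z \<odot> x - f)"
  using is_resolvent_res by (simp add: is_resolvent_def)

lemma is_resolvent_eq: "is_resolvent z L \<Longrightarrow> res z = L"
  using is_resolvent_res[of z] unfolding is_resolvent_def rho_def by blast

lemma gr_res: "z \<in> rho \<Longrightarrow> gr (res z f) (z \<odot> res z f - f)"
  using res_eq_iff by blast

lemma res_identity:
  assumes "z \<in> rho" "w \<in> rho"
  shows "res z f - res w f = (w - z) \<odot> res z (res w f)"
proof -
  let ?x = "res w f" and ?y = "res z (res w f)"
  have "gr (?x + (w - z) \<odot> ?y) (w \<odot> ?x - f + (w - z) \<odot> (z \<odot> ?y - ?x))"
    by (intro gr_add gr_sc gr_res assms)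
  also have "w \<odot> ?x - f + (w - z) \<odot> (z \<odot> ?y - ?x) = z \<odot> (?x + (w - z) \<odot> ?y) - f"
    by (simp add: sc.diff_left sc.diff_right sc.add_right sc_sc algebra_simps)
  finally have "res z f = ?x + (w - z) \<odot> ?y" using assms by (simp add: res_eq_iff)
  then show ?thesis by simp
qed

lemma res_eigenvector:
  assumes "gr x (z \<odot> x)" "w \<in> rho" "w \<noteq> z"
  shows "res w x = (1 / (w - z)) \<odot> x"
proof -
  have "w \<odot> ((1 / (w - z)) \<odot> x) - x = (1 / (w - z)) \<odot> (z \<odot> x)"
  proof -
    have "w \<odot> ((1 / (w - z)) \<odot> x) - x = (w * (1 / (w - z)) - 1) \<odot> x"
      by (simp add: sc_sc sc.diff_left sc_one)
    also have "w * (1 / (w - z)) - 1 = 1 / (w - z) * z" using assms(3) by (simp add: field_simps)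
    finally show ?thesis by (simp add: sc_sc)
  qed
  then show ?thesis using gr_sc[OF assms(1)] assms(2) by (simp add: res_eq_iff)
qed

lemma eigenvector_in_rho_eq_zero: "gr x (z \<odot> x) \<Longrightarrow> z \<in> rho \<Longrightarrow> x = 0"
  using res_eq_iff[of z 0 x] by (simp add: res_simps)

text \<open>In the resolvent identity the radius \<open>1 / (2 * B * K)\<close> makes the error at
  most half of \<open>norm (res w f)\<close>, which is absorbed on the left. The bound is uniform in
  \<open>f\<close>.\<close>

lemma res_locally_bounded:
  assumes z: "z \<in> rho"
  obtains d K where "0 < d" "0 < K" "\<And>w f. w \<in> rho \<Longrightarrow> dist z w < d \<Longrightarrow> norm (res w f) \<le> K * norm f"
proof -
  obtain B where B: "0 < B" "\<And>c f. norm (c \<odot> f) \<le> B * norm c * norm f" by (rule sc_bound) blast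
  obtain K where K: "0 < K" "\<And>f. norm (res z f) \<le> norm f * K"
    using bounded_linear.pos_bounded[OF clin_linear[OF res_clin[OF z]]] by blast
  show thesis
  proof (rule that[of "1 / (2 * B * K)" "2 * K"])
    fix w f assume w: "w \<in> rho" "dist z w < 1 / (2 * B * K)"
    have "res w f = res z f - (w - z) \<odot> res z (res w f)"
      using res_identity[OF z w(1), of f] by (simp add: algebra_simps)
    then have "norm (res w f) \<le> norm (res z f) + norm ((w - z) \<odot> res z (res w f))"
      by (metis norm_triangle_ineq4)
    also have "norm (res z f) \<le> norm f * K" by (rule K)
    also have "norm ((w - z) \<odot> res z (res w f)) \<le> B * norm (w - z) * (norm (res w f) * K)"
      by (rule order_trans[OF B(2) mult_left_mono[OF K(2)]]) (use B in auto)
    also have "\<dots> = (B * K * norm (w - z)) * norm (res w f)" by simp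
    also have "\<dots> \<le> (1 / 2) * norm (res w f)"
    proof (rule mult_right_mono)
      show "B * K * norm (w - z) \<le> 1 / 2"
        using w(2) B K by (simp add: dist_norm norm_minus_commute field_simps)
    qed simp
    finally show "norm (res w f) \<le> 2 * K * norm f" by (simp add: mult_ac)
  qed (use B K in auto)
qed

lemma res_continuous: "continuous_on rho (\<lambda>z. res z f)"
  unfolding continuous_on_def
proof
  fix z assume z: "z \<in> rho"
  obtain B where B: "0 < B" "\<And>c f. norm (c \<odot> f) \<le> B * norm c * norm f" by (rule sc_bound) blast
  obtain d K where K: "0 < d" "0 < K" "\<And>w f. w \<in> rho \<Longrightarrow> dist z w < d \<Longrightarrow> norm (res w f) \<le> K * norm f"
    using res_locally_bounded[OF z] by metis
  have "((\<lambda>w. res w f - res z f) \<longlongrightarrow> 0) (at z within rho)"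
  proof (rule Lim_null_comparison)
    have "((\<lambda>w. B * norm (z - w) * (K * norm (res z f))) \<longlongrightarrow> B * norm (z - z) * (K * norm (res z f))) (at z within rho)"
      by (intro tendsto_intros)
    then show "((\<lambda>w. B * norm (z - w) * (K * norm (res z f))) \<longlongrightarrow> 0) (at z within rho)" by simp
    have "norm (res w f - res z f) \<le> B * norm (z - w) * (K * norm (res z f))"
      if "w \<in> rho" "dist z w < d" for w
      unfolding res_identity[OF that(1) z]
      by (rule order_trans[OF B(2) mult_left_mono[OF K(3)]]) (use that B in auto)
    then show "\<forall>\<^sub>F w in at z within rho. norm (res w f - res z f) \<le> B * norm (z - w) * (K * norm (res z f))"
      using K(1) unfolding eventually_at by (auto simp: dist_commute intro!: exI[of _ d])
  qed
  then show "((\<lambda>w. res w f) \<longlongrightarrow> res z f) (at z within rho)" by (rule LIM_zero_cancel)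
qed

lemma res_has_derivative:
  assumes z: "z \<in> rho"
  shows "((\<lambda>z. res z f) has_derivative (\<lambda>h. h \<odot> (- res z (res z f)))) (at z within rho)"
  unfolding has_derivative_iff_norm
proof
  show "bounded_linear (\<lambda>h. h \<odot> (- res z (res z f)))" by (rule sc.bounded_linear_left)
  obtain B where B: "0 < B" "\<And>c f. norm (c \<odot> f) \<le> B * norm c * norm f" by (rule sc_bound) blast
  let ?g = "res z f"
  show "((\<lambda>w. norm (res w f - res z f - (w - z) \<odot> (- res z ?g)) / norm (w - z)) \<longlongrightarrow> 0) (at z within rho)"
  proof (rule Lim_null_comparison)
    have "((\<lambda>w. B * norm (res w ?g - res z ?g)) \<longlongrightarrow> B * norm (res z ?g - res z ?g)) (at z within rho)"
      using res_continuous[of ?g] z unfolding continuous_on_def by (intro tendsto_intros) auto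
    then show "((\<lambda>w. B * norm (res w ?g - res z ?g)) \<longlongrightarrow> 0) (at z within rho)" by simp
    have "norm (res w f - res z f - (w - z) \<odot> (- res z ?g)) / norm (w - z) \<le> B * norm (res w ?g - res z ?g)"
      if "w \<in> rho" "w \<noteq> z" for w
    proof -
      have "res w f - res z f - (w - z) \<odot> (- res z ?g) = (z - w) \<odot> (res w ?g - res z ?g)"
        unfolding res_identity[OF that(1) z, of f]
        by (simp add: sc.diff_left sc.diff_right sc.minus_right)
      then have "norm (res w f - res z f - (w - z) \<odot> (- res z ?g)) \<le> B * norm (z - w) * norm (res w ?g - res z ?g)"
        using B(2) by simp
      then show ?thesis using that(2) by (simp add: field_simps norm_minus_commute)
    qed
    then show "\<forall>\<^sub>F w in at z within rho. norm (norm (res w f - res z f - (w - z) \<odot> (- res z ?g)) / norm (w - z))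
        \<le> B * norm (res w ?g - res z ?g)"
      unfolding eventually_at_filter by auto
  qed
qed

lemma integral_exp_S_res:
  assumes "z \<in> rho" "0 \<le> t"
  shows "((\<lambda>u. exp (- z * complex_of_real u) \<odot> S u f) has_integral
      (res z f - exp (- z * complex_of_real t) \<odot> S t (res z f))) {0..t}"
  using integral_exp_S[OF gr_res[OF assms(1)] assms(2), where z = z] by simp

lemma res_uniformly_bounded:
  assumes "compact C" "C \<subseteq> rho"
  obtains K where "0 \<le> K" "\<And>w f. w \<in> C \<Longrightarrow> norm (res w f) \<le> K * norm f"
proof -
  have "\<exists>d>0. \<exists>K>0. \<forall>w\<in>rho. \<forall>f. dist z w < d \<longrightarrow> norm (res w f) \<le> K * norm f" if "z \<in> C" for z
    using res_locally_bounded[of z] assms(2) that by (metis subsetD)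
  then obtain d where d: "\<And>z. z \<in> C \<Longrightarrow> 0 < d z"
      "\<And>z. z \<in> C \<Longrightarrow> \<exists>K>0. \<forall>w\<in>rho. \<forall>f. dist z w < d z \<longrightarrow> norm (res w f) \<le> K * norm f"
    by metis
  then obtain K where K: "\<And>z. z \<in> C \<Longrightarrow> 0 < K z"
      "\<And>z w f. z \<in> C \<Longrightarrow> w \<in> rho \<Longrightarrow> dist z w < d z \<Longrightarrow> norm (res w f) \<le> K z * norm f"
    by metis
  have "C \<subseteq> (\<Union>z\<in>C. ball z (d z))" using d(1) by auto
  then obtain C' where C': "C' \<subseteq> C" "finite C'" "C \<subseteq> (\<Union>z\<in>C'. ball z (d z))"
    using compactE_image[OF assms(1), of C "\<lambda>z. ball z (d z)"] by auto
  show thesis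
  proof (rule that[of "sum K C'"])
    show "0 \<le> sum K C'" using C' K(1) by (intro sum_nonneg) (auto intro: less_imp_le)
    fix w f assume w: "w \<in> C"
    then obtain z where z: "z \<in> C'" "dist z w < d z" using C'(3) by auto
    have "norm (res w f) \<le> K z * norm f" using z C' w assms(2) by (intro K(2)) auto
    also have "\<dots> \<le> sum K C' * norm f"
      using z C' K(1) by (intro mult_right_mono member_le_sum) (auto intro: less_imp_le)
    finally show "norm (res w f) \<le> sum K C' * norm f" .
  qed
qed

lemma integral_res_continuous:
  assumes "continuous_on {a..b} c" "continuous_on {a..b} \<gamma>" "\<gamma> ` {a..b} \<subseteq> rho"
  shows "continuous_on {a..b::real} (\<lambda>\<theta>. c \<theta> \<odot> res (\<gamma> \<theta>) f)"
  using assms by (intro sc.continuous_on continuous_on_compose2[OF res_continuous]) auto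

lemma clin_integral_res:
  assumes c: "continuous_on {a..b} c" and \<gamma>: "continuous_on {a..b} \<gamma>" "\<gamma> ` {a..b} \<subseteq> rho" and "a \<le> b"
  shows "clin (\<lambda>f. integral {a..b::real} (\<lambda>\<theta>. c \<theta> \<odot> res (\<gamma> \<theta>) f))"
proof -
  note int = integrable_continuous_real[OF integral_res_continuous[OF c \<gamma>]]
  have rho: "\<gamma> \<theta> \<in> rho" if "\<theta> \<in> {a..b}" for \<theta> using \<gamma> that by auto
  obtain B where B: "0 < B" "\<And>c f. norm (c \<odot> f) \<le> B * norm c * norm f" by (rule sc_bound) blast
  obtain K where K: "0 \<le> K" "\<And>w f. w \<in> \<gamma> ` {a..b} \<Longrightarrow> norm (res w f) \<le> K * norm f"
    using res_uniformly_bounded[OF compact_continuous_image[OF \<gamma>(1) compact_Icc] \<gamma>(2)] by blast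
  have "bounded (c ` {a..b})" by (intro compact_imp_bounded compact_continuous_image c compact_Icc)
  then obtain N where N: "0 < N" "\<And>\<theta>. \<theta> \<in> {a..b} \<Longrightarrow> norm (c \<theta>) \<le> N"
    unfolding bounded_pos by auto
  show ?thesis unfolding clin_def
  proof (intro conjI allI)
    show "bounded_linear (\<lambda>f. integral {a..b} (\<lambda>\<theta>. c \<theta> \<odot> res (\<gamma> \<theta>) f))"
    proof (rule bounded_linear_intro[where K = "B * N * K * (b - a)"])
      fix f g
      have "integral {a..b} (\<lambda>\<theta>. c \<theta> \<odot> res (\<gamma> \<theta>) (f + g))
          = integral {a..b} (\<lambda>\<theta>. c \<theta> \<odot> res (\<gamma> \<theta>) f + c \<theta> \<odot> res (\<gamma> \<theta>) g)"
        by (intro integral_cong) (simp add: res_simps[OF rho] sc.add_right)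
      then show "integral {a..b} (\<lambda>\<theta>. c \<theta> \<odot> res (\<gamma> \<theta>) (f + g))
          = integral {a..b} (\<lambda>\<theta>. c \<theta> \<odot> res (\<gamma> \<theta>) f) + integral {a..b} (\<lambda>\<theta>. c \<theta> \<odot> res (\<gamma> \<theta>) g)"
        by (simp add: integral_add int)
    next
      fix r f
      have "integral {a..b} (\<lambda>\<theta>. c \<theta> \<odot> res (\<gamma> \<theta>) (r *\<^sub>R f)) = integral {a..b} (\<lambda>\<theta>. r *\<^sub>R (c \<theta> \<odot> res (\<gamma> \<theta>) f))"
        by (intro integral_cong) (simp add: res_simps[OF rho] sc.scaleR_right)
      then show "integral {a..b} (\<lambda>\<theta>. c \<theta> \<odot> res (\<gamma> \<theta>) (r *\<^sub>R f)) = r *\<^sub>R integral {a..b} (\<lambda>\<theta>. c \<theta> \<odot> res (\<gamma> \<theta>) f)"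
        by simp
    next
      fix f
      have "norm (integral {a..b} (\<lambda>\<theta>. c \<theta> \<odot> res (\<gamma> \<theta>) f)) \<le> (B * N * (K * norm f)) * (b - a)"
      proof (rule integral_bound[OF \<open>a \<le> b\<close> integral_res_continuous[OF c \<gamma>]])
        fix t assume t: "t \<in> {a..b}"
        show "norm (c t \<odot> res (\<gamma> t) f) \<le> B * N * (K * norm f)"
          using B N K t by (intro order_trans[OF B(2)] mult_mono) auto
      qed
      then show "norm (integral {a..b} (\<lambda>\<theta>. c \<theta> \<odot> res (\<gamma> \<theta>) f)) \<le> norm f * (B * N * K * (b - a))"
        by (simp add: mult_ac)
    qed
    fix d f
    have "integral {a..b} (\<lambda>\<theta>. c \<theta> \<odot> res (\<gamma> \<theta>) (d \<odot> f)) = integral {a..b} ((\<lambda>x. d \<odot> x) \<circ> (\<lambda>\<theta>. c \<theta> \<odot> res (\<gamma> \<theta>) f))"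
      by (intro integral_cong) (simp add: res_simps[OF rho] sc_sc mult.commute)
    also have "\<dots> = d \<odot> integral {a..b} (\<lambda>\<theta>. c \<theta> \<odot> res (\<gamma> \<theta>) f)"
      by (rule integral_linear[OF int sc.bounded_linear_right])
    finally show "integral {a..b} (\<lambda>\<theta>. c \<theta> \<odot> res (\<gamma> \<theta>) (d \<odot> f)) = d \<odot> integral {a..b} (\<lambda>\<theta>. c \<theta> \<odot> res (\<gamma> \<theta>) f)" .
  qed
qed

end

section \<open>Riesz projections at simple poles\<close>

text \<open>The scalar Cauchy formula for \<open>1 / (w - u)\<close> with w on the circle. The
  vector-valued decomposition is reduced to it by the resolvent identity.\<close>

lemma circle_Cauchy_kernel:
  fixes u :: complex
  assumes "norm u < r"
  shows "((\<lambda>\<theta>. complex_of_real r * cis \<theta> / (complex_of_real (2 * pi) * (complex_of_real r * cis \<theta> - u)))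
    has_integral 1) {0..2 * pi}"
proof -
  have "((\<lambda>w. 1 / (w - u)) has_contour_integral (2 * of_real pi * \<i> * 1)) (circlepath 0 r)"
    using assms by (intro Cauchy_integral_circlepath_simple) auto
  then have "((\<lambda>t. (1 / (complex_of_real r * cis t - u)) * complex_of_real r * \<i> * cis t)
      has_integral (2 * of_real pi * \<i>)) {0..2 * pi}"
    unfolding circlepath_def by (subst (asm) has_contour_integral_part_circlepath_iff) auto
  from has_integral_mult_right[OF this, of "1 / (2 * of_real pi * \<i>)"]
  show ?thesis by (rule has_integral_eq_rhs[OF has_integral_eq, rotated 1]) (simp_all add: mult_ac)
qed

context bounded_semigroup
begin

text \<open>\<open>laurent z0 r k\<close> is the coefficient of \<open>(z - z0) ^ (- k - 1)\<close> in the Laurent expansion of the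
  resolvent; \<open>laurent z0 r 0\<close> is the Riesz projection.\<close>

definition laurent :: "complex \<Rightarrow> real \<Rightarrow> nat \<Rightarrow> 'a \<Rightarrow> 'a" where
  "laurent z0 r k f = integral {0..2 * pi}
     (\<lambda>\<theta>. ((complex_of_real r * cis \<theta>) ^ Suc k / complex_of_real (2 * pi)) \<odot> res (z0 + complex_of_real r * cis \<theta>) f)"

text \<open>The Cauchy integral of the resolvent over the circle with kernel 1 / (w - z), in polar
  form. Inside the disc it is the holomorphic part of the Laurent expansion, and it is defined at
  \<open>z0\<close> itself.\<close>

definition regular_part :: "complex \<Rightarrow> real \<Rightarrow> complex \<Rightarrow> 'a \<Rightarrow> 'a" where
  "regular_part z0 r z f = integral {0..2 * pi}
     (\<lambda>\<theta>. (complex_of_real r * cis \<theta> / (complex_of_real (2 * pi) * (complex_of_real r * cis \<theta> - (z - z0))))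
         \<odot> res (z0 + complex_of_real r * cis \<theta>) f)"

context
  fixes z0 :: complex and r :: real
  assumes r: "0 < r" and punctured: "cball z0 r - {z0} \<subseteq> rho"
begin

abbreviation "circ \<theta> \<equiv> complex_of_real r * cis \<theta>"

lemma circ_in_rho: "z0 + circ \<theta> \<in> rho"
proof -
  have "dist z0 (z0 + circ \<theta>) = r" using r by (simp add: dist_norm norm_mult)
  then have "z0 + circ \<theta> \<in> cball z0 r - {z0}" using r by auto
  then show ?thesis using punctured by blast
qed

lemma circ_image: "(\<lambda>\<theta>. z0 + circ \<theta>) ` A \<subseteq> rho"
  using circ_in_rho by blast

lemma circ_continuous: "continuous_on A (\<lambda>\<theta>. z0 + circ \<theta>)"
  by (intro continuous_intros)

lemma laurent_integrable:
  "(\<lambda>\<theta>. (circ \<theta> ^ k / c) \<odot> res (z0 + circ \<theta>) f) integrable_on {0..2 * pi}"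
proof (cases "c = 0")
  case False
  then show ?thesis
    by (intro integrable_continuous_real integral_res_continuous circ_continuous circ_image continuous_intros) auto
qed (simp add: sc.zero_left integrable_0)

lemma laurent_clin: "clin (laurent z0 r k)"
  unfolding laurent_def
  by (intro clin_integral_res circ_continuous circ_image continuous_intros) auto

text \<open>The resolvent identity at the auxiliary point \<open>z0 + r\<close> replaces an appeal to the closedness of
  the generator.\<close>

lemma gr_laurent: "gr (laurent z0 r k f) (z0 \<odot> laurent z0 r k f + laurent z0 r (Suc k) f)"
proof -
  define m where "m = z0 + complex_of_real r"
  have m: "m \<in> rho" using circ_in_rho[of 0] by (simp add: m_def)
  define c where "c j \<theta> = circ \<theta> ^ Suc j / complex_of_real (2 * pi)" for j \<theta>
  have lau: "laurent z0 r j f = integral {0..2 * pi} (\<lambda>\<theta>. c j \<theta> \<odot> res (z0 + circ \<theta>) f)" for j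
    by (simp add: laurent_def c_def)
  have int: "((\<lambda>\<theta>. c j \<theta> \<odot> res (z0 + circ \<theta>) f) has_integral laurent z0 r j f) {0..2 * pi}" for j
    unfolding lau c_def by (intro integrable_integral laurent_integrable)
  \<comment> \<open>The exponent \<open>Suc k\<close> is positive, so the inhomogeneous term
    \<open>f\<close> of the resolvent equation disappears in the integral.\<close>
  have "((\<lambda>\<theta>. c k \<theta> \<odot> f) has_integral 0 \<odot> f) {0..2 * pi}"
  proof -
    have "((\<lambda>\<theta>. c k \<theta>) has_integral 0 / complex_of_real (2 * pi)) {0..2 * pi}"
      unfolding c_def by (intro has_integral_divide integral_circle_power_eq_zero)
    from has_integral_linear[OF this sc.bounded_linear_left[of f]] show ?thesis by (simp add: o_def)
  qed
  then have "((\<lambda>\<theta>. c k \<theta> \<odot> f + (m - z0) \<odot> c k \<theta> \<odot> res (z0 + circ \<theta>) f - c (Suc k) \<theta> \<odot> res (z0 + circ \<theta>) f)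
      has_integral (0 \<odot> f + (m - z0) \<odot> laurent z0 r k f - laurent z0 r (Suc k) f)) {0..2 * pi}"
    by (intro has_integral_diff has_integral_add int
        has_integral_linear[OF int sc.bounded_linear_right, unfolded o_def])
  from has_integral_linear[OF this clin_linear[OF res_clin[OF m]]]
  have 1: "((\<lambda>\<theta>. res m (c k \<theta> \<odot> f + (m - z0) \<odot> c k \<theta> \<odot> res (z0 + circ \<theta>) f - c (Suc k) \<theta> \<odot> res (z0 + circ \<theta>) f))
      has_integral res m ((m - z0) \<odot> laurent z0 r k f - laurent z0 r (Suc k) f)) {0..2 * pi}"
    by (simp add: o_def sc.zero_left)
  have "res m (c k \<theta> \<odot> f + (m - z0) \<odot> c k \<theta> \<odot> res (z0 + circ \<theta>) f - c (Suc k) \<theta> \<odot> res (z0 + circ \<theta>) f)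
      = c k \<theta> \<odot> res (z0 + circ \<theta>) f" for \<theta>
  proof -
    let ?w = "z0 + circ \<theta>"
    have "c k \<theta> \<odot> f + (m - z0) \<odot> c k \<theta> \<odot> res ?w f - c (Suc k) \<theta> \<odot> res ?w f
        = c k \<theta> \<odot> (f + (m - ?w) \<odot> res ?w f)"
    proof -
      have *: "a \<odot> f + (m - z0) \<odot> a \<odot> R - (a * u) \<odot> R = a \<odot> (f + (m - (z0 + u)) \<odot> R)" for a u R
        by (simp add: sc.add_right sc.diff_right sc.diff_left sc.add_left sc_sc algebra_simps)
      have "c (Suc k) \<theta> = c k \<theta> * circ \<theta>" by (simp add: c_def)
      then show ?thesis by (simp only: *)
    qed
    moreover have "res m (f + (m - ?w) \<odot> res ?w f) = res ?w f"
      using res_identity[OF m circ_in_rho, of f] m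
      by (simp add: res_simps sc.diff_left sc.add_left algebra_simps)
    ultimately show ?thesis using m by (simp add: res_simps)
  qed
  with 1 int[of k] have "laurent z0 r k f = res m ((m - z0) \<odot> laurent z0 r k f - laurent z0 r (Suc k) f)"
    by (simp add: has_integral_unique)
  then have "gr (laurent z0 r k f)
      (m \<odot> laurent z0 r k f - ((m - z0) \<odot> laurent z0 r k f - laurent z0 r (Suc k) f))"
    using m by (metis res_eq_iff)
  then show ?thesis by (simp add: sc.diff_left algebra_simps)
qed

text \<open>On an eigenvector the resolvent at distance u from \<open>z0\<close> is division by u,
  which makes the integrand constant.\<close>

lemma laurent_zero_of_eigenvector:
  assumes "gr x (z0 \<odot> x)"
  shows "laurent z0 r 0 x = x"
proof -
  have "res (z0 + circ \<theta>) x = (1 / circ \<theta>) \<odot> x" for \<theta>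
    using res_eigenvector[OF assms circ_in_rho] r by simp
  then have "laurent z0 r 0 x = integral {0..2 * pi} (\<lambda>\<theta>. (1 / (2 * pi)) *\<^sub>R x)"
    unfolding laurent_def using r
    by (intro integral_cong) (simp add: sc_sc flip: sc_of_real)
  then show ?thesis by simp
qed

text \<open>The resolvent acts on \<open>x\<close> by scalars, so the projection returns a multiple
  \<open>c \<odot> x\<close>. By \<open>eig\<close> this multiple is also an eigenvector for
  \<open>z0\<close>, and two different eigenvalues force it to vanish; \<open>c\<close> is never
  computed.\<close>

lemma laurent_zero_of_other_eigenvector:
  assumes x: "gr x (z1 \<odot> x)" and ne: "z1 \<noteq> z0" and eig: "\<And>f. laurent z0 r 1 f = 0"
  shows "laurent z0 r 0 x = 0"
proof (cases "x = 0")
  case True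
  then show ?thesis using clin_simps[OF laurent_clin] by simp
next
  case False
  then have "z1 \<notin> rho" using eigenvector_in_rho_eq_zero[OF x] by blast
  then have ne1: "z0 + circ \<theta> \<noteq> z1" for \<theta> using circ_in_rho by metis
  define c where "c = integral {0..2 * pi} (\<lambda>\<theta>. circ \<theta> / complex_of_real (2 * pi) * (1 / (z0 + circ \<theta> - z1)))"
  have "(\<lambda>\<theta>. circ \<theta> / complex_of_real (2 * pi) * (1 / (z0 + circ \<theta> - z1))) integrable_on {0..2 * pi}"
    using ne1 by (intro integrable_continuous_real continuous_intros) auto
  from integral_linear[OF this sc.bounded_linear_left[of x]]
  have "c \<odot> x = integral {0..2 * pi} (\<lambda>\<theta>. (circ \<theta> / complex_of_real (2 * pi) * (1 / (z0 + circ \<theta> - z1))) \<odot> x)"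
    unfolding c_def by (simp add: o_def)
  also have "\<dots> = laurent z0 r 0 x"
    unfolding laurent_def using res_eigenvector[OF x circ_in_rho ne1]
    by (intro integral_cong) (simp add: sc_sc)
  finally have L: "laurent z0 r 0 x = c \<odot> x" by simp
  have "gr (c \<odot> x) (z0 \<odot> c \<odot> x)" using gr_laurent[of 0 x] eig[of x] L by simp
  from gr_unique[OF this gr_sc[OF x]] have "z0 \<odot> c \<odot> x - z1 \<odot> c \<odot> x = 0"
    by (simp add: sc_sc mult.commute)
  then have "(z0 - z1) \<odot> c \<odot> x = 0" by (simp only: sc.diff_left)
  then show ?thesis using ne L by simp
qed

text \<open>Integrating the resolvent identity over the circle splits off the principal part without a
  vector-valued Cauchy formula.\<close>

lemma res_minus_laurent:
  assumes z: "z \<in> rho" "norm (z - z0) < r"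
  shows "res z f - res z (laurent z0 r 0 f) = regular_part z0 r z f"
proof -
  let ?u = "z - z0"
  define c where "c \<theta> = circ \<theta> / (complex_of_real (2 * pi) * (circ \<theta> - ?u))" for \<theta>
  have ne: "circ \<theta> \<noteq> ?u" for \<theta>
    using z(2) r by (metis norm_cis norm_mult norm_of_real abs_of_pos mult.right_neutral less_irrefl)
  have cont: "continuous_on {0..2 * pi} c"
    unfolding c_def using ne by (intro continuous_intros) auto
  have int: "((\<lambda>\<theta>. c \<theta> \<odot> res (z0 + circ \<theta>) f) has_integral regular_part z0 r z f) {0..2 * pi}"
    unfolding regular_part_def c_def[symmetric]
    by (intro integrable_integral integrable_continuous_real integral_res_continuous cont circ_continuous circ_image)
  have "((\<lambda>\<theta>. c \<theta> \<odot> res z f) has_integral 1 \<odot> res z f) {0..2 * pi}"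
    using has_integral_linear[OF circle_Cauchy_kernel[OF z(2)] sc.bounded_linear_left[of "res z f"]]
    by (simp add: o_def c_def)
  from has_integral_diff[OF this int]
  have 1: "((\<lambda>\<theta>. c \<theta> \<odot> res z f - c \<theta> \<odot> res (z0 + circ \<theta>) f) has_integral
      (res z f - regular_part z0 r z f)) {0..2 * pi}" by (simp add: sc_one)
  have "((\<lambda>\<theta>. (circ \<theta> ^ 1 / complex_of_real (2 * pi)) \<odot> res (z0 + circ \<theta>) f) has_integral laurent z0 r 0 f) {0..2 * pi}"
    unfolding laurent_def One_nat_def by (intro integrable_integral laurent_integrable)
  from has_integral_linear[OF this clin_linear[OF res_clin[OF z(1)]]]
  have 2: "((\<lambda>\<theta>. res z ((circ \<theta> / complex_of_real (2 * pi)) \<odot> res (z0 + circ \<theta>) f)) has_integral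
      res z (laurent z0 r 0 f)) {0..2 * pi}" by (simp add: o_def)
  have "res z ((circ \<theta> / complex_of_real (2 * pi)) \<odot> res (z0 + circ \<theta>) f)
      = c \<theta> \<odot> res z f - c \<theta> \<odot> res (z0 + circ \<theta>) f" for \<theta>
  proof -
    have "c \<theta> * (z0 + circ \<theta> - z) = circ \<theta> / complex_of_real (2 * pi)"
      using ne[of \<theta>] by (simp add: c_def divide_simps)
    then have "res z ((circ \<theta> / complex_of_real (2 * pi)) \<odot> res (z0 + circ \<theta>) f)
        = c \<theta> \<odot> (z0 + circ \<theta> - z) \<odot> res z (res (z0 + circ \<theta>) f)"
      using z by (simp add: res_simps sc_sc)
    also have "\<dots> = c \<theta> \<odot> (res z f - res (z0 + circ \<theta>) f)"
      by (simp only: res_identity[OF z(1) circ_in_rho, of f])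
    finally show ?thesis by (simp add: sc.diff_right)
  qed
  with 1 2 have "res z (laurent z0 r 0 f) = res z f - regular_part z0 r z f"
    by (simp only:) (rule has_integral_unique)
  then show ?thesis by (simp add: algebra_simps)
qed

lemma regular_part_continuous: "continuous_on (ball z0 r) (\<lambda>z. regular_part z0 r z f)"
proof -
  have ne: "circ \<theta> \<noteq> z - z0" if "z \<in> ball z0 r" for \<theta> z
    using that r by (metis norm_cis norm_mult norm_of_real abs_of_pos mult.right_neutral less_irrefl
        mem_ball dist_norm norm_minus_commute)
  have "continuous_on (ball z0 r \<times> cbox 0 (2 * pi))
     (\<lambda>(z, \<theta>). (circ \<theta> / (complex_of_real (2 * pi) * (circ \<theta> - (z - z0)))) \<odot> res (z0 + circ \<theta>) f)"
    unfolding case_prod_beta using ne circ_in_rho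
    by (intro sc.continuous_on continuous_on_compose2[OF res_continuous] continuous_intros) auto
  from integral_continuous_on_param[OF this] show ?thesis by (simp add: regular_part_def)
qed

lemma regular_part_clin:
  assumes "z \<in> ball z0 r"
  shows "clin (regular_part z0 r z)"
proof -
  have ne: "circ \<theta> \<noteq> z - z0" for \<theta>
    using assms r by (metis norm_cis norm_mult norm_of_real abs_of_pos mult.right_neutral less_irrefl
        mem_ball dist_norm norm_minus_commute)
  show ?thesis unfolding regular_part_def using ne
    by (intro clin_integral_res circ_continuous circ_image continuous_intros) auto
qed

text \<open>Without principal part the resolvent agrees near \<open>z0\<close> with the continuous
  \<open>regular_part\<close>, whose value at \<open>z0\<close> is then an inverse of z0 - A. This
  makes the projections at genuine poles nonzero.\<close>

lemma in_rho_if_laurent_zero: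
  assumes "\<And>f. laurent z0 r 0 f = 0"
  shows "z0 \<in> rho"
proof -
  define m where "m = z0 + complex_of_real r"
  have m: "m \<in> rho" using circ_in_rho[of 0] by (simp add: m_def)
  have near: "\<forall>\<^sub>F z in at z0. z \<in> rho \<and> norm (z - z0) < r"
    unfolding eventually_at
    using r punctured by (intro exI[of _ r]) (auto simp: dist_norm norm_minus_commute)
  have gr: "gr (regular_part z0 r z0 f) (z0 \<odot> regular_part z0 r z0 f - f)" for f
  proof -
    let ?H = "\<lambda>z. regular_part z0 r z f"
    have lim: "(?H \<longlongrightarrow> ?H z0) (at z0)"
      using regular_part_continuous[of f] r by (auto simp: continuous_on_eq_continuous_at isCont_def)
    \<comment> \<open>The equation for the resolvent at z is rewritten as a fixed-point equation
      containing only the bounded operator \<open>res m\<close>, so that it survives the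
      limit.\<close>
    have "((\<lambda>z. res m (f + (m - z) \<odot> ?H z)) \<longlongrightarrow> res m (f + (m - z0) \<odot> ?H z0)) (at z0)"
      by (intro bounded_linear.tendsto[OF clin_linear[OF res_clin[OF m]]] sc.tendsto tendsto_intros lim)
    moreover have "\<forall>\<^sub>F z in at z0. res m (f + (m - z) \<odot> ?H z) = ?H z"
      using near
    proof eventually_elim
      case (elim z)
      then have "?H z = res z f"
        using res_minus_laurent[of z f] assms elim by (simp add: res_simps)
      then show ?case using res_identity[OF m, of z f] elim m
        by (simp add: res_simps sc.diff_left algebra_simps)
    qed
    ultimately have "(?H \<longlongrightarrow> res m (f + (m - z0) \<odot> ?H z0)) (at z0)"
      by (rule Lim_transform_eventually)
    then have "res m (f + (m - z0) \<odot> ?H z0) = ?H z0"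
      using lim by (intro tendsto_unique[OF trivial_limit_at]) auto
    then have "gr (?H z0) (m \<odot> ?H z0 - (f + (m - z0) \<odot> ?H z0))" using m by (simp add: res_eq_iff)
    then show ?thesis by (simp add: sc.diff_left algebra_simps)
  qed
  have "is_resolvent z0 (regular_part z0 r z0)"
    unfolding is_resolvent_def
  proof (intro conjI allI iffI)
    show "clin (regular_part z0 r z0)" using r by (intro regular_part_clin) auto
    fix f x
    show "gr x (z0 \<odot> x - f)" if "regular_part z0 r z0 f = x" using gr[of f] that by simp
    assume "gr x (z0 \<odot> x - f)"
    from gr_diff[OF this gr[of f]]
    have "gr (x - regular_part z0 r z0 f) (z0 \<odot> (x - regular_part z0 r z0 f))" by (simp add: sc.diff_right)
    from laurent_zero_of_eigenvector[OF this] assms show "regular_part z0 r z0 f = x" by simp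
  qed
  then show ?thesis by (auto simp: rho_def)
qed

text \<open>The coefficient does not depend on the radius of the circle. On radius p the integrand
  is of order p ^ (k + 1 - m), which tends to zero with p because \<open>m \<le> k\<close>.\<close>

lemma laurent_eq_zero_of_growth:
  assumes d: "0 < d" and C: "\<And>w. w \<noteq> z0 \<Longrightarrow> dist z0 w < d \<Longrightarrow> norm (res w f) \<le> C / norm (w - z0) ^ m"
    and k: "m \<le> k"
  shows "laurent z0 r k f = 0"
proof -
  obtain B where B: "0 < B" "\<And>c f. norm (c \<odot> f) \<le> B * norm c * norm f" by (rule sc_bound) blast
  define \<Psi> where "\<Psi> u = (u ^ Suc k / complex_of_real (2 * pi)) \<odot> res (z0 + u) f" for u
  define \<Psi>' where "\<Psi>' u = (u ^ Suc k / complex_of_real (2 * pi)) \<odot> (- res (z0 + u) (res (z0 + u) f))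
      + (of_nat (Suc k) * u ^ k / complex_of_real (2 * pi)) \<odot> res (z0 + u) f" for u
  let ?D = "cball 0 r - {0 :: complex}"
  have D: "z0 + u \<in> rho" if "u \<in> ?D" for u
    using that punctured by (auto simp: dist_norm subset_iff)
  have der: "(\<Psi> has_derivative (\<lambda>h. h \<odot> \<Psi>' u)) (at u within ?D)" if u: "u \<in> ?D" for u
  proof -
    have "((\<lambda>u. z0 + u) has_derivative (\<lambda>h. h)) (at u within ?D)"
      by (auto intro!: derivative_eq_intros)
    moreover have "((\<lambda>z. res z f) has_derivative (\<lambda>h. h \<odot> (- res (z0 + u) (res (z0 + u) f))))
        (at (z0 + u) within (\<lambda>u. z0 + u) ` ?D)"
      by (rule has_derivative_subset[OF res_has_derivative[OF D[OF u]]]) (use D in blast)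
    ultimately have 1: "((\<lambda>u. res (z0 + u) f) has_derivative (\<lambda>h. h \<odot> (- res (z0 + u) (res (z0 + u) f)))) (at u within ?D)"
      by (rule has_derivative_in_compose)
    have "((\<lambda>u. u ^ Suc k / complex_of_real (2 * pi)) has_field_derivative
        (of_nat (Suc k) * u ^ k / complex_of_real (2 * pi))) (at u within ?D)"
      by (auto intro!: derivative_eq_intros simp del: power_Suc of_nat_Suc)
    then have 2: "((\<lambda>u. u ^ Suc k / complex_of_real (2 * pi)) has_derivative
        (\<lambda>h. (of_nat (Suc k) * u ^ k / complex_of_real (2 * pi)) * h)) (at u within ?D)"
      unfolding has_field_derivative_def .
    show ?thesis
      using sc.FDERIV[OF 2 1]
      unfolding \<Psi>_def \<Psi>'_def
      by (simp add: sc.add_right sc_sc mult_ac del: power_Suc of_nat_Suc)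
  qed
  have cont: "continuous_on ?D \<Psi>'"
  proof -
    have 1: "continuous_on ?D (\<lambda>u. res (z0 + u) g)" for g
      by (intro continuous_on_compose2[OF res_continuous] continuous_intros) (use D in blast)
    \<comment> \<open>Strong continuity of each factor does not give that of the product; the local
      bound, uniform in the vector, closes the gap.\<close>
    have 2: "continuous_on ?D (\<lambda>u. res (z0 + u) (res (z0 + u) f))"
      unfolding continuous_on_def
    proof
      fix u assume u: "u \<in> ?D"
      let ?g = "res (z0 + u) f"
      obtain d K where K: "0 < d" "0 < K" "\<And>w f. w \<in> rho \<Longrightarrow> dist (z0 + u) w < d \<Longrightarrow> norm (res w f) \<le> K * norm f"
        using res_locally_bounded[OF D[OF u]] by metis
      have "((\<lambda>w. res (z0 + w) (res (z0 + w) f - ?g)) \<longlongrightarrow> 0) (at u within ?D)"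
      proof (rule Lim_null_comparison)
        have "((\<lambda>w. K * norm (res (z0 + w) f - ?g)) \<longlongrightarrow> K * norm (?g - ?g)) (at u within ?D)"
          using 1[of f] u unfolding continuous_on_def by (intro tendsto_intros) auto
        then show "((\<lambda>w. K * norm (res (z0 + w) f - ?g)) \<longlongrightarrow> 0) (at u within ?D)" by simp
        show "\<forall>\<^sub>F w in at u within ?D. norm (res (z0 + w) (res (z0 + w) f - ?g)) \<le> K * norm (res (z0 + w) f - ?g)"
          unfolding eventually_at using K(1) D
          by (intro exI[of _ d]) (auto simp: dist_commute intro!: K(3))
      qed
      moreover have "((\<lambda>w. res (z0 + w) ?g) \<longlongrightarrow> res (z0 + u) ?g) (at u within ?D)"
        using 1[of ?g] u unfolding continuous_on_def by auto
      ultimately have "((\<lambda>w. res (z0 + w) (res (z0 + w) f - ?g) + res (z0 + w) ?g) \<longlongrightarrow> 0 + res (z0 + u) ?g) (at u within ?D)"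
        by (rule tendsto_add)
      moreover have "\<forall>\<^sub>F w in at u within ?D. res (z0 + w) (res (z0 + w) f - ?g) + res (z0 + w) ?g = res (z0 + w) (res (z0 + w) f)"
        unfolding eventually_at_filter using D by (auto simp: res_simps intro!: always_eventually)
      ultimately show "((\<lambda>u. res (z0 + u) (res (z0 + u) f)) \<longlongrightarrow> res (z0 + u) ?g) (at u within ?D)"
        using Lim_transform_eventually by fastforce
    qed
    show ?thesis unfolding \<Psi>'_def by (intro sc.continuous_on continuous_intros 1 2) auto
  qed
  \<comment> \<open>\<open>d / 2\<close> stays inside the region of the growth bound,
    \<open>r\<close> inside the punctured disc, and 1 gives
    \<open>p ^ (k - m) \<le> 1\<close>.\<close>
  define e where "e = min (min (d / 2) r) 1"
  have e: "0 < e" "e < d" "e \<le> r" "e \<le> 1" using d r by (auto simp: e_def min_def)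
  have bnd: "norm (laurent z0 r k f) \<le> B * C * p" if p: "0 < p" "p \<le> e" for p
  proof -
    have "laurent z0 r k f = integral {0..2 * pi} (\<lambda>\<theta>. \<Psi> (complex_of_real p * cis \<theta>))"
      using circle_integral_radius[OF der cont, of p] p e by (simp add: laurent_def \<Psi>_def)
    also have "norm \<dots> \<le> (B * C * p / (2 * pi)) * (2 * pi - 0)"
    proof (rule integral_bound)
      have inD: "complex_of_real p * cis \<theta> \<in> ?D" for \<theta> using p e by (simp add: norm_mult)
      have cont\<Psi>: "continuous_on ?D \<Psi>" using der by (rule has_derivative_continuous_on)
      show "continuous_on {0..2 * pi} (\<lambda>\<theta>. \<Psi> (complex_of_real p * cis \<theta>))"
        by (intro continuous_on_compose2[OF cont\<Psi>] continuous_intros) (use inD in auto)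
      fix t
      let ?u = "complex_of_real p * cis t"
      have u: "norm ?u = p" using p by (simp add: norm_mult)
      have "norm (res (z0 + ?u) f) \<le> C / norm (z0 + ?u - z0) ^ m"
        using p e by (intro C) (auto simp: dist_norm norm_mult)
      then have R: "norm (res (z0 + ?u) f) \<le> C / p ^ m" using u by simp
      have "norm (\<Psi> ?u) \<le> B * norm (?u ^ Suc k / complex_of_real (2 * pi)) * norm (res (z0 + ?u) f)"
        unfolding \<Psi>_def by (rule B)
      also have "norm (?u ^ Suc k / complex_of_real (2 * pi)) = p ^ Suc k / (2 * pi)"
        by (simp only: norm_divide norm_power u) simp
      also have "B * (p ^ Suc k / (2 * pi)) * norm (res (z0 + ?u) f) \<le> B * (p ^ Suc k / (2 * pi)) * (C / p ^ m)"
        using B p R by (intro mult_left_mono) auto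
      also have "\<dots> = B * C / (2 * pi) * p ^ Suc (k - m)"
      proof -
        have "p ^ Suc k = p ^ Suc (k - m) * p ^ m" using k by (simp flip: power_add)
        then show ?thesis using p by simp
      qed
      also have "\<dots> \<le> B * C / (2 * pi) * p"
      proof (rule mult_left_mono)
        have "p ^ (k - m) \<le> 1" using p e by (intro power_le_one) auto
        then show "p ^ Suc (k - m) \<le> p" using p by (simp add: mult_left_le)
        have "0 \<le> C / p ^ m" using R norm_ge_zero order_trans by blast
        moreover have "0 < p ^ m" using p by simp
        ultimately have "0 \<le> C" by (metis divide_neg_pos not_le)
        then show "0 \<le> B * C / (2 * pi)" using B by simp
      qed
      finally show "norm (\<Psi> ?u) \<le> B * C * p / (2 * pi)" by simp
    qed simp
    finally show ?thesis by simp
  qed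
  have "norm (laurent z0 r k f) \<le> 0"
  proof (rule tendsto_le[OF trivial_limit_at_right_real _ tendsto_const])
    show "((\<lambda>p. B * C * p) \<longlongrightarrow> 0) (at_right 0)"
      using tendsto_mult_right_zero[OF tendsto_ident_at] .
    show "\<forall>\<^sub>F p in at_right 0. norm (laurent z0 r k f) \<le> B * C * p"
      unfolding eventually_at using e bnd by (intro exI[of _ e]) (auto simp: dist_norm)
  qed
  then show ?thesis by simp
qed

text \<open>Descending induction: once coefficient n + 2 vanishes, coefficient n + 1 is an
  eigenvector and forms a Jordan block with coefficient n, so it vanishes too. The growth bound
  starts the descent, which ends at coefficient 1.\<close>

lemma laurent_one_eq_zero:
  assumes d: "0 < d" and C: "\<And>w f. w \<noteq> z0 \<Longrightarrow> dist z0 w < d \<Longrightarrow> norm (res w f) \<le> C f / norm (w - z0) ^ m"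
    and z0: "Re z0 = 0"
  shows "laurent z0 r 1 f = 0"
proof -
  have "laurent z0 r (Suc k) f = 0" if "laurent z0 r (Suc n) f = 0" "k \<le> n" for k n
    using that
  proof (induction n)
    case (Suc n)
    have "laurent z0 r (Suc n) f = 0"
      using no_jordan_block[OF gr_laurent[of n f] _ z0] gr_laurent[of "Suc n" f] Suc.prems by simp
    then show ?case using Suc by (cases "k = Suc n") auto
  qed simp
  from this[of m 0] laurent_eq_zero_of_growth[OF d C, of "Suc m" f] show ?thesis by simp
qed

end

end

section \<open>The Fejer kernel\<close>

text \<open>The antiderivative is an arctangent, whose total variation is at most pi for every scale
  \<open>b\<close>, centre \<open>s\<close> and interval. Such kernels serve as majorants
  below.\<close>

lemma integral_arctan_kernel_le:
  assumes "0 < b" "0 \<le> t"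
  shows "(\<lambda>u. b / (1 + (b * (s - u))\<^sup>2)) integrable_on {0..t}"
    and "integral {0..t} (\<lambda>u. b / (1 + (b * (s - u))\<^sup>2)) \<le> pi"
proof -
  have "((\<lambda>u. - arctan (b * (s - u))) has_vector_derivative b / (1 + (b * (s - u))\<^sup>2)) (at u within {0..t})" for u
    unfolding has_real_derivative_iff_has_vector_derivative[symmetric]
    by (auto intro!: derivative_eq_intros simp: field_simps)
  then have *: "((\<lambda>u. b / (1 + (b * (s - u))\<^sup>2)) has_integral - arctan (b * (s - t)) - - arctan (b * (s - 0))) {0..t}"
    using assms by (intro fundamental_theorem_of_calculus) auto
  then show "(\<lambda>u. b / (1 + (b * (s - u))\<^sup>2)) integrable_on {0..t}" by blast
  have "- arctan (b * (s - t)) - - arctan (b * (s - 0)) \<le> pi"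
    using arctan_bounded[of "b * (s - t)"] arctan_bounded[of "b * (s - 0)"] by linarith
  then show "integral {0..t} (\<lambda>u. b / (1 + (b * (s - u))\<^sup>2)) \<le> pi"
    using * by (simp add: integral_unique)
qed

text \<open>The unnormalised kernel, of total mass 2 pi over the line; \<open>N\<close> is the value
  of the removable singularity at 0.\<close>

definition fejer :: "real \<Rightarrow> real \<Rightarrow> real" where
  "fejer N x = (if x = 0 then N else 2 * (1 - cos (N * x)) / (N * x\<^sup>2))"

lemma fejer_eq_sin: "0 < N \<Longrightarrow> x \<noteq> 0 \<Longrightarrow> fejer N x = N * (sin (N * x / 2) / (N * x / 2))\<^sup>2"
proof -
  assume N: "0 < N" "x \<noteq> 0"
  have "1 - cos (N * x) = 2 * (sin (N * x / 2))\<^sup>2"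
    using cos_double_sin[of "N * x / 2"] by simp
  then show ?thesis using N by (simp add: fejer_def power_divide power_mult_distrib) (simp add: field_simps power2_eq_square)
qed

lemma fejer_nonneg: "0 < N \<Longrightarrow> 0 \<le> fejer N x"
  by (cases "x = 0") (simp_all add: fejer_eq_sin, simp add: fejer_def)

lemma fejer_le: "0 < N \<Longrightarrow> fejer N x \<le> N"
proof (cases "x = 0")
  assume N: "0 < N" and x: "x \<noteq> 0"
  have "\<bar>sin (N * x / 2) / (N * x / 2)\<bar> \<le> 1"
    using abs_sin_x_le_abs_x[of "N * x / 2"] N x by (simp add: abs_divide)
  then have "(sin (N * x / 2) / (N * x / 2))\<^sup>2 \<le> 1" by (simp add: abs_square_le_1)
  then show ?thesis using N x by (simp add: fejer_eq_sin mult_left_le)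
qed (simp add: fejer_def)

lemma fejer_le_square: "0 < N \<Longrightarrow> x \<noteq> 0 \<Longrightarrow> fejer N x \<le> 4 / (N * x\<^sup>2)"
proof -
  assume N: "0 < N" "x \<noteq> 0"
  have "2 * (1 - c) \<le> 4" if "- 1 \<le> c" for c :: real using that by simp
  from this[OF cos_ge_minus_one] have "2 * (1 - cos (N * x)) \<le> 4" .
  then show ?thesis using N by (simp add: fejer_def divide_right_mono)
qed

text \<open>The bounds \<open>N\<close> and \<open>4 / (N * x\<^sup>2)\<close> are used on the two
  sides of \<open>(N * x)\<^sup>2 = 4\<close>, where each is exactly 5 times the arctangent
  kernel.\<close>

lemma fejer_le_arctan_kernel: "0 < N \<Longrightarrow> fejer N x \<le> 5 * (N / (1 + (N * x)\<^sup>2))"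
proof -
  assume N: "0 < N"
  have pos: "0 < 1 + (N * x)\<^sup>2" by (simp add: add_pos_nonneg)
  show ?thesis
  proof (cases "(N * x)\<^sup>2 \<le> 4")
    case True
    then have "N * (1 + (N * x)\<^sup>2) \<le> 5 * N" using N by simp
    then have "N \<le> 5 * (N / (1 + (N * x)\<^sup>2))" using pos by (simp add: field_simps)
    then show ?thesis using fejer_le[OF N, of x] by linarith
  next
    case False
    then have x: "x \<noteq> 0" by auto
    then have p: "0 < (N * x)\<^sup>2" using N by simp
    have "fejer N x \<le> 4 / (N * x\<^sup>2)" by (rule fejer_le_square[OF N x])
    also have "\<dots> = 4 * N / (N * x)\<^sup>2" using N x by (simp add: field_simps power2_eq_square)
    also have "\<dots> \<le> 5 * (N / (1 + (N * x)\<^sup>2))"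
    proof -
      have "4 * (1 + (N * x)\<^sup>2) \<le> 5 * (N * x)\<^sup>2" using False by simp
      then have "N * (4 * (1 + (N * x)\<^sup>2)) \<le> N * (5 * (N * x)\<^sup>2)" using N by (intro mult_left_mono) auto
      then show ?thesis using pos p by (simp add: divide_simps) (simp add: algebra_simps)
    qed
    finally show ?thesis .
  qed
qed

text \<open>Away from 0, \<open>x\<^sup>2\<close> is at least half of
  \<open>\<eta>\<^sup>2 + x\<^sup>2\<close>. The factor \<open>8 / (N * \<eta>)\<close> carries the
  decay in \<open>N\<close>, while the remaining kernel has integral at most pi.\<close>

lemma fejer_le_arctan_kernel_far:
  assumes "0 < N" "0 < \<eta>" "\<eta> \<le> \<bar>x\<bar>"
  shows "fejer N x \<le> 8 / (N * \<eta>) * ((1 / \<eta>) / (1 + ((1 / \<eta>) * x)\<^sup>2))"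
proof -
  have x: "x \<noteq> 0" using assms by auto
  have sq: "\<eta>\<^sup>2 \<le> x\<^sup>2" using assms by (metis abs_le_square_iff abs_of_pos)
  have "fejer N x \<le> 4 / (N * x\<^sup>2)" using assms x by (intro fejer_le_square)
  also have "\<dots> \<le> 8 / (N * (\<eta>\<^sup>2 + x\<^sup>2))"
  proof -
    have "N * (\<eta>\<^sup>2 + x\<^sup>2) \<le> N * (2 * x\<^sup>2)" using sq assms by (intro mult_left_mono) auto
    moreover have "0 < N * (2 * x\<^sup>2)" "0 < N * (\<eta>\<^sup>2 + x\<^sup>2)" using assms x by (simp_all add: add_pos_nonneg)
    ultimately have "8 / (N * (2 * x\<^sup>2)) \<le> 8 / (N * (\<eta>\<^sup>2 + x\<^sup>2))" by (intro divide_left_mono) auto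
    then show ?thesis by simp
  qed
  also have "\<dots> = 8 / (N * \<eta>) * ((1 / \<eta>) / (1 + ((1 / \<eta>) * x)\<^sup>2))"
  proof -
    have "1 + ((1 / \<eta>) * x)\<^sup>2 = (\<eta>\<^sup>2 + x\<^sup>2) / \<eta>\<^sup>2"
      using assms by (simp add: field_simps)
    then show ?thesis using assms by (simp add: power2_eq_square)
  qed
  finally show ?thesis .
qed

text \<open>By the mean value theorem sin z = z cos w with w below 1 / 2, hence below pi / 3, where
  the cosine is at least 1 / 2.\<close>

lemma abs_sin_ge_half: "\<bar>z\<bar> \<le> 1 / 2 \<Longrightarrow> \<bar>z\<bar> / 2 \<le> \<bar>sin z\<bar>" for z :: real
proof -
  have pos: "z / 2 \<le> sin z" if z: "0 < z" "z \<le> 1 / 2" for z :: real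
  proof -
    have "\<exists>w>0. w < z \<and> sin z - sin 0 = (z - 0) * cos w"
      by (rule MVT2[OF z(1)]) (auto intro!: derivative_eq_intros)
    then obtain w where w: "0 < w" "w < z" "sin z = z * cos w" by auto
    have "cos (pi / 3) \<le> cos w"
      using w z pi_gt3 by (intro cos_monotone_0_pi_le) auto
    then have "z * (1 / 2) \<le> z * cos w" using z by (intro mult_left_mono) (auto simp: cos_60)
    then show ?thesis using w by simp
  qed
  assume z: "\<bar>z\<bar> \<le> 1 / 2"
  consider "z = 0" | "0 < z" | "z < 0" by linarith
  then show ?thesis
  proof cases
    case 2
    then show ?thesis using pos[of z] z by simp
  next
    case 3
    then show ?thesis using pos[of "- z"] z by simp
  qed simp
qed

text \<open>A lower bound for the mass: an interval of length \<open>1 / N\<close> next to 0 already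
  contributes 1 / 4.\<close>

lemma fejer_ge:
  assumes "0 < N" "\<bar>x\<bar> \<le> 1 / N"
  shows "N / 4 \<le> fejer N x"
proof (cases "x = 0")
  case False
  let ?z = "N * x / 2"
  have "\<bar>?z\<bar> \<le> 1 / 2" using assms by (simp add: abs_mult field_simps)
  from abs_sin_ge_half[OF this] have "1 / 2 \<le> \<bar>sin ?z / ?z\<bar>"
    using assms False by (simp add: abs_divide field_simps)
  then have "(1 / 2)\<^sup>2 \<le> \<bar>sin ?z / ?z\<bar>\<^sup>2" by (intro power_mono) auto
  then have "1 / 4 \<le> (sin ?z / ?z)\<^sup>2" by (simp add: power2_eq_square)
  then have "N * (1 / 4) \<le> N * (sin ?z / ?z)\<^sup>2" using assms by (intro mult_left_mono) auto
  then show ?thesis using assms False by (simp add: fejer_eq_sin)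
qed (use assms in \<open>simp add: fejer_def\<close>)

lemma fejer_fourier:
  assumes N: "0 < N"
  shows "((\<lambda>\<tau>. complex_of_real (1 - \<bar>\<tau>\<bar> / N) * exp (\<i> * complex_of_real \<tau> * complex_of_real x))
    has_integral complex_of_real (fejer N x)) {-N..N}"
proof (cases "x = 0")
  case True
  have "((\<lambda>\<tau>. 1 - \<bar>\<tau>\<bar> / N) has_integral (0 - 0\<^sup>2 / (2 * N) + (0 + (N - N\<^sup>2 / (2 * N))) - (-N + (-N)\<^sup>2 / (2 * N)))) {-N..N}"
  proof -
    have "((\<lambda>\<tau>. 1 - \<bar>\<tau>\<bar> / N) has_integral ((0 + 0\<^sup>2 / (2 * N)) - (-N + (-N)\<^sup>2 / (2 * N)))) {-N..0}"
      using N by (intro has_integral_eq[OF _ fundamental_theorem_of_calculus[where f' = "\<lambda>\<tau>. 1 + \<tau> / N"]])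
        (auto simp flip: has_real_derivative_iff_has_vector_derivative intro!: derivative_eq_intros)
    moreover have "((\<lambda>\<tau>. 1 - \<bar>\<tau>\<bar> / N) has_integral ((N - N\<^sup>2 / (2 * N)) - (0 - 0\<^sup>2 / (2 * N)))) {0..N}"
      using N by (intro has_integral_eq[OF _ fundamental_theorem_of_calculus[where f' = "\<lambda>\<tau>. 1 - \<tau> / N"]])
        (auto simp flip: has_real_derivative_iff_has_vector_derivative intro!: derivative_eq_intros)
    ultimately show ?thesis
      using N by (intro has_integral_eq_rhs[OF has_integral_combine[of "-N" 0 N]]) auto
  qed
  then have "((\<lambda>\<tau>. 1 - \<bar>\<tau>\<bar> / N) has_integral N) {-N..N}"
    by (rule has_integral_eq_rhs) (use N in \<open>simp add: field_simps power2_eq_square\<close>)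
  from has_integral_linear[OF this bounded_linear_of_real[where 'a = complex]]
  show ?thesis using True by (simp add: fejer_def o_def)
next
  case False
  let ?ix = "\<i> * complex_of_real x" and ?n = "complex_of_real N"
  define E where "E \<tau> = exp (\<i> * complex_of_real \<tau> * complex_of_real x)" for \<tau> :: real
  \<comment> \<open>An antiderivative of \<open>(1 + s * \<tau> / N) * E \<tau>\<close>: the
    triangle has slope sign \<open>s = 1\<close> left of 0 and \<open>s = -1\<close> right of
    0.\<close>
  define F where "F s \<tau> = (1 + s * complex_of_real \<tau> / ?n) * E \<tau> / ?ix - s * (1 / ?n) * (E \<tau> / (?ix)\<^sup>2)" for s :: complex and \<tau> :: real
  have "(F s has_vector_derivative (1 + s * complex_of_real \<tau> / ?n) * E \<tau>) (at \<tau> within A)" for s \<tau> A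
  proof -
    have "((\<lambda>w. (1 + s * w / ?n) * exp (\<i> * w * complex_of_real x) / ?ix - s * (1 / ?n) * (exp (\<i> * w * complex_of_real x) / (?ix)\<^sup>2))
        has_field_derivative (1 + s * w / ?n) * exp (\<i> * w * complex_of_real x)) (at w)" for w
      using False N
      by (auto intro!: derivative_eq_intros) (simp add: field_simps power2_eq_square)
    then show ?thesis unfolding F_def E_def by (rule has_vector_derivative_real_field)
  qed
  note F = this
  have "((\<lambda>\<tau>. complex_of_real (1 - \<bar>\<tau>\<bar> / N) * E \<tau>) has_integral F 1 0 - F 1 (-N)) {-N..0}"
    using N F[of 1] by (intro has_integral_eq[OF _ fundamental_theorem_of_calculus[where f' = "\<lambda>\<tau>. (1 + 1 * complex_of_real \<tau> / ?n) * E \<tau>"]]) auto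
  moreover have "((\<lambda>\<tau>. complex_of_real (1 - \<bar>\<tau>\<bar> / N) * E \<tau>) has_integral F (-1) N - F (-1) 0) {0..N}"
    using N F[of "-1"] by (intro has_integral_eq[OF _ fundamental_theorem_of_calculus[where f' = "\<lambda>\<tau>. (1 + (-1) * complex_of_real \<tau> / ?n) * E \<tau>"]]) auto
  ultimately have "((\<lambda>\<tau>. complex_of_real (1 - \<bar>\<tau>\<bar> / N) * E \<tau>) has_integral
      (F 1 0 - F 1 (-N) + (F (-1) N - F (-1) 0))) {-N..N}"
    using N by (intro has_integral_combine[of "-N" 0 N]) auto
  moreover have "F 1 0 - F 1 (-N) + (F (-1) N - F (-1) 0) = complex_of_real (fejer N x)"
  proof -
    have "E N + E (-N) = 2 * complex_of_real (cos (N * x))"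
      by (simp add: E_def complex_eq_iff Re_exp Im_exp)
    moreover have "F 1 0 - F 1 (-N) + (F (-1) N - F (-1) 0) = (2 - (E N + E (-N))) / (?n * (complex_of_real x)\<^sup>2)"
      using N False by (simp add: F_def E_def) (simp add: field_simps power2_eq_square)
    ultimately show ?thesis using False by (simp add: fejer_def)
  qed
  ultimately show ?thesis by (simp add: E_def)
qed

section \<open>Ingham's Tauberian theorem\<close>

context complex_banach
begin

text \<open>Shifting by half a period, \<open>s = pi / t\<close>, flips the sign of the exponential.
  Hence twice the integral is an integral of \<open>h \<tau> - h (\<tau> + s)\<close>, which uniform
  continuity makes small.\<close>

lemma riemann_lebesgue:
  fixes h :: "real \<Rightarrow> 'a"
  assumes cont: "continuous_on UNIV h" and supp: "\<And>\<tau>. N \<le> \<bar>\<tau>\<bar> \<Longrightarrow> h \<tau> = 0" and N: "0 < N" and e: "0 < e"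
  shows "\<exists>L. \<forall>t. L \<le> \<bar>t\<bar> \<longrightarrow>
     norm (integral {-N..N} (\<lambda>\<tau>. exp (\<i> * complex_of_real \<tau> * complex_of_real t) \<odot> h \<tau>)) \<le> e"
proof -
  obtain B where B: "0 < B" "\<And>c f. norm (c \<odot> f) \<le> B * norm c * norm f" by (rule sc_bound) blast
  \<comment> \<open>\<open>2 * N + 2\<close> is the length of the enlarged interval that contains
    the support before and after the shift.\<close>
  define e' where "e' = e / (B * (2 * N + 2))"
  have e': "0 < e'" using e B N by (simp add: e'_def)
  have "uniformly_continuous_on {-N-2..N+2} h"
    by (intro compact_uniformly_continuous continuous_on_subset[OF cont]) auto
  then obtain d where d: "0 < d" "\<And>x y. x \<in> {-N-2..N+2} \<Longrightarrow> y \<in> {-N-2..N+2} \<Longrightarrow> dist y x < d \<Longrightarrow> dist (h y) (h x) < e'"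
    using e' unfolding uniformly_continuous_on_def by meson
  \<comment> \<open>For \<bar>t\<bar> at least \<open>L\<close> the shift is below \<open>d\<close>
    and at most 1, so all arguments stay in the interval of uniform continuity.\<close>
  define L where "L = pi / min (d / 2) 1"
  have L: "0 < L" using d by (simp add: L_def)
  have "norm (integral {-N..N} (\<lambda>\<tau>. exp (\<i> * complex_of_real \<tau> * complex_of_real t) \<odot> h \<tau>)) \<le> e"
    if t: "L \<le> \<bar>t\<bar>" for t
  proof -
    have t0: "t \<noteq> 0" using t L by auto
    define s where "s = pi / t"
    have s: "\<bar>s\<bar> \<le> min (d / 2) 1"
    proof -
      have "pi / \<bar>t\<bar> \<le> pi / L" using t L by (intro divide_left_mono mult_pos_pos) auto
      also have "\<dots> = min (d / 2) 1" by (simp add: L_def)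
      finally show ?thesis by (simp add: s_def abs_divide)
    qed
    define E where "E \<tau> = exp (\<i> * complex_of_real \<tau> * complex_of_real t)" for \<tau> :: real
    have E_cont: "continuous_on A E" for A unfolding E_def by (intro continuous_intros)
    have E_shift: "E (\<tau> + s) = - E \<tau>" for \<tau>
    proof -
      have "\<i> * complex_of_real (\<tau> + s) * complex_of_real t = \<i> * complex_of_real \<tau> * complex_of_real t + \<i> * complex_of_real pi"
        using t0 by (simp add: s_def field_simps)
      then show ?thesis by (simp add: E_def exp_add)
    qed
    define J where "J = integral {-N..N} (\<lambda>\<tau>. E \<tau> \<odot> h \<tau>)"
    have cont_h: "continuous_on A h" for A using cont by (rule continuous_on_subset) simp
    have J: "((\<lambda>\<tau>. E \<tau> \<odot> h \<tau>) has_integral J) {-N..N}"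
      unfolding J_def by (intro integrable_integral integrable_continuous_real sc.continuous_on E_cont cont_h)
    have J': "((\<lambda>\<tau>. E \<tau> \<odot> h \<tau>) has_integral J) {a..b}" if "a \<le> -N" "N \<le> b" for a b
      by (rule has_integral_on_superset[OF J]) (use that supp N in \<open>auto simp: sc.zero_right\<close>)
    have s1: "\<bar>s\<bar> \<le> 1" using s by simp
    have "((\<lambda>\<tau>. E (\<tau> + s) \<odot> h (\<tau> + s)) has_integral J) {-N-1+s-s..N+1+s-s}"
      by (rule has_integral_shift_real_ivl[OF J']) (use s1 in linarith)+
    then have "((\<lambda>\<tau>. - (E \<tau> \<odot> h (\<tau> + s))) has_integral J) {-N-1..N+1}"
      by (simp add: E_shift sc.minus_left)
    from has_integral_add[OF J' this] have "((\<lambda>\<tau>. E \<tau> \<odot> h \<tau> + - (E \<tau> \<odot> h (\<tau> + s))) has_integral J + J) {-N-1..N+1}"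
      by simp
    then have JJ: "((\<lambda>\<tau>. E \<tau> \<odot> (h \<tau> - h (\<tau> + s))) has_integral J + J) {-N-1..N+1}"
      by (simp add: sc.diff_right)
    have "norm (J + J) \<le> (B * 1 * e') * (N + 1 - (-N - 1))"
      unfolding integral_unique[OF JJ, symmetric]
    proof (rule integral_bound)
      show "continuous_on {- N - 1..N + 1} (\<lambda>\<tau>. E \<tau> \<odot> (h \<tau> - h (\<tau> + s)))"
        by (intro sc.continuous_on E_cont continuous_intros cont_h continuous_on_compose2[OF cont]) auto
      fix u assume u: "u \<in> {-N-1..N+1}"
      have "dist (h u) (h (u + s)) < e'"
        using u s d(1) by (intro d(2)) (auto simp: dist_norm)
      moreover have "norm (E u) = 1" by (simp add: E_def)
      ultimately show "norm (E u \<odot> (h u - h (u + s))) \<le> B * 1 * e'"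
        using B by (intro order_trans[OF B(2)] mult_mono) (auto simp: dist_norm)
    qed (use N in auto)
    also have "\<dots> = e' * (B * (2 * N + 2))" by (simp add: algebra_simps)
    also have "\<dots> = e"
    proof -
      have "B * (2 * N + 2) \<noteq> 0" using B N by simp
      then show ?thesis unfolding e'_def by (rule nonzero_eq_divide_eq[THEN iffD1, OF _ refl])
    qed
    finally have "2 * norm J \<le> e" by (simp flip: scaleR_2)
    then have "norm J \<le> e" using norm_ge_zero[of J] by linarith
    then show ?thesis by (simp add: J_def E_def)
  qed
  then show ?thesis by blast
qed

end

context bounded_semigroup
begin

text \<open>Continuity at time 0 is transported to every later time by the semigroup law, at the
  cost of the factor \<open>M\<close>.\<close>

lemma orbit_uniformly_continuous:
  assumes e: "0 < e"
  obtains \<eta> where "0 < \<eta>" "\<And>u s. 0 \<le> u \<Longrightarrow> 0 \<le> s \<Longrightarrow> \<bar>u - s\<bar> < \<eta> \<Longrightarrow> norm (S u y - S s y) \<le> e"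
proof -
  have "\<exists>\<eta>>0. \<forall>t\<in>{0..}. dist t 0 < \<eta> \<longrightarrow> dist (S t y) (S 0 y) < e / M"
    using S_cont[of y] e M_ge_1 unfolding continuous_on_iff by (auto dest!: bspec[of _ _ 0])
  then obtain \<eta> where \<eta>: "0 < \<eta>" "\<And>t. 0 \<le> t \<Longrightarrow> t < \<eta> \<Longrightarrow> norm (S t y - y) < e / M"
    by (auto simp: dist_norm)
  have *: "norm (S u y - S s y) \<le> e" if "0 \<le> s" "s \<le> u" "u - s < \<eta>" for u s
  proof -
    have "S u y = S s (S (u - s) y)" using S_add[of s "u - s" y] that by simp
    then have "norm (S u y - S s y) = norm (S s (S (u - s) y - y))" using that by (simp add: S_simps)
    also have "\<dots> \<le> M * norm (S (u - s) y - y)" using that by (intro S_bound)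
    also have "\<dots> \<le> M * (e / M)" using \<eta>(2)[of "u - s"] that M_ge_1 by (intro mult_left_mono) auto
    finally show ?thesis using M_ge_1 by simp
  qed
  show thesis
  proof (rule that[OF \<eta>(1)])
    fix u s :: real assume us: "0 \<le> u" "0 \<le> s" "\<bar>u - s\<bar> < \<eta>"
    show "norm (S u y - S s y) \<le> e"
    proof (cases "s \<le> u")
      case True
      then show ?thesis using * us by simp
    next
      case False
      then show ?thesis using *[of u s] us by (simp add: norm_minus_commute)
    qed
  qed
qed

text \<open>The truncated Laplace integral at \<open>\<i> * \<tau>\<close> equals
  \<open>\<Phi> \<tau>\<close> minus a multiple of \<open>S (a + s) (\<Phi> \<tau>)\<close>.
  Weighting by the triangle and an exponential and integrating over \<tau> gives the right-hand
  side; exchanging the integrals turns the left-hand side into a convolution. The exceptional set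
  \<open>F\<close> is null.\<close>

lemma fejer_convolution:
  fixes \<Phi> :: "real \<Rightarrow> 'a" and J :: "real \<Rightarrow> 'a"
  assumes F: "finite F" and \<Phi>: "\<And>\<tau>. \<tau> \<notin> F \<Longrightarrow> \<i> * complex_of_real \<tau> \<in> rho \<and> \<Phi> \<tau> = res (\<i> * complex_of_real \<tau>) y"
    and cont: "continuous_on UNIV \<Phi>" and N: "0 < N" and t: "0 \<le> s" "0 \<le> a"
    and J: "\<And>x. J x = integral {-N..N}
       (\<lambda>\<tau>. exp (\<i> * complex_of_real \<tau> * complex_of_real x) \<odot> (max 0 (1 - \<bar>\<tau>\<bar> / N) *\<^sub>R \<Phi> \<tau>))"
  shows "((\<lambda>u. fejer N (s - u) *\<^sub>R S u y) has_integral (J s - S (a + s) (J (- a)))) {0..a + s}"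
proof -
  let ?t = "a + s"
  have t0: "0 \<le> ?t" using t by simp
  define E where "E \<tau> x = exp (\<i> * complex_of_real \<tau> * complex_of_real x)" for \<tau> x :: real
  define w where "w \<tau> = 1 - \<bar>\<tau>\<bar> / N" for \<tau>
  define g where "g \<tau> u = (complex_of_real (w \<tau>) * E \<tau> (s - u)) \<odot> S u y" for \<tau> u
  have cont\<Phi>: "continuous_on A \<Phi>" for A using cont by (rule continuous_on_subset) simp
  have wE_cont: "continuous_on A (\<lambda>\<tau>. complex_of_real (w \<tau>) * E \<tau> x)" for A x
    unfolding w_def E_def by (intro continuous_intros) (use N in auto)
  have J': "((\<lambda>\<tau>. (complex_of_real (w \<tau>) * E \<tau> x) \<odot> \<Phi> \<tau>) has_integral J x) {-N..N}" for x
  proof -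
    have "((\<lambda>\<tau>. (complex_of_real (w \<tau>) * E \<tau> x) \<odot> \<Phi> \<tau>) has_integral
        integral {-N..N} (\<lambda>\<tau>. (complex_of_real (w \<tau>) * E \<tau> x) \<odot> \<Phi> \<tau>)) {-N..N}"
      by (intro integrable_integral integrable_continuous_real sc.continuous_on wE_cont cont\<Phi>)
    also have "integral {-N..N} (\<lambda>\<tau>. (complex_of_real (w \<tau>) * E \<tau> x) \<odot> \<Phi> \<tau>) = J x"
      unfolding J
    proof (intro integral_cong)
      fix \<tau> assume "\<tau> \<in> {-N..N}"
      then have "max 0 (1 - \<bar>\<tau>\<bar> / N) = w \<tau>" using N by (simp add: w_def abs_le_iff)
      then show "(complex_of_real (w \<tau>) * E \<tau> x) \<odot> \<Phi> \<tau>
          = exp (\<i> * complex_of_real \<tau> * complex_of_real x) \<odot> (max 0 (1 - \<bar>\<tau>\<bar> / N) *\<^sub>R \<Phi> \<tau>)"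
        by (simp add: E_def sc_sc mult.commute flip: sc_of_real)
    qed
    finally show ?thesis .
  qed
  have "((\<lambda>\<tau>. integral {0..?t} (g \<tau>)) has_integral (J s - S ?t (J (- a)))) {-N..N}"
  proof (rule has_integral_spike_finite[OF F])
    have "((\<lambda>\<tau>. S ?t ((complex_of_real (w \<tau>) * E \<tau> (- a)) \<odot> \<Phi> \<tau>)) has_integral S ?t (J (- a))) {-N..N}"
      using has_integral_linear[OF J' S_linear[OF t0]] by (simp add: o_def)
    then show "((\<lambda>\<tau>. (complex_of_real (w \<tau>) * E \<tau> s) \<odot> \<Phi> \<tau> - S ?t ((complex_of_real (w \<tau>) * E \<tau> (- a)) \<odot> \<Phi> \<tau>))
        has_integral (J s - S ?t (J (- a)))) {-N..N}"
      by (rule has_integral_diff[OF J'])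
    fix \<tau> assume "\<tau> \<in> {-N..N} - F"
    then have \<tau>: "\<i> * complex_of_real \<tau> \<in> rho" "\<Phi> \<tau> = res (\<i> * complex_of_real \<tau>) y" using \<Phi> by auto
    let ?z = "\<i> * complex_of_real \<tau>" and ?c = "complex_of_real (w \<tau>) * E \<tau> s"
    have "((\<lambda>u. ?c \<odot> exp (- ?z * complex_of_real u) \<odot> S u y) has_integral
        ?c \<odot> (\<Phi> \<tau> - exp (- ?z * complex_of_real ?t) \<odot> S ?t (\<Phi> \<tau>))) {0..?t}"
      using has_integral_linear[OF integral_exp_S_res[OF \<tau>(1) t0, of y] sc.bounded_linear_right[of ?c]]
      unfolding \<tau>(2) by (simp add: o_def)
    moreover have "?c * exp (- ?z * complex_of_real u) = complex_of_real (w \<tau>) * E \<tau> (s - u)" for u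
      by (simp add: E_def mult.assoc algebra_simps flip: exp_add)
    ultimately have "(g \<tau> has_integral
        (?c \<odot> \<Phi> \<tau> - (complex_of_real (w \<tau>) * E \<tau> (s - ?t)) \<odot> S ?t (\<Phi> \<tau>))) {0..?t}"
      by (simp only: g_def[abs_def] sc_sc sc.diff_right)
    then show "integral {0..?t} (g \<tau>) = ?c \<odot> \<Phi> \<tau> - S ?t ((complex_of_real (w \<tau>) * E \<tau> (- a)) \<odot> \<Phi> \<tau>)"
      using t0 by (simp add: integral_unique S_simps)
  qed
  then have 1: "integral {-N..N} (\<lambda>\<tau>. integral {0..?t} (g \<tau>)) = J s - S ?t (J (- a))"
    by (rule integral_unique)
  have g_cont: "continuous_on (cbox (-N, 0) (N, ?t)) (\<lambda>(\<tau>, u). g \<tau> u)"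
    unfolding case_prod_beta g_def w_def E_def
    by (intro sc.continuous_on continuous_intros continuous_on_compose2[OF S_cont])
      (use N in auto)
  have 2: "integral {-N..N} (\<lambda>\<tau>. integral {0..?t} (g \<tau>)) = integral {0..?t} (\<lambda>u. integral {-N..N} (\<lambda>\<tau>. g \<tau> u))"
    using integral_swap_continuous[OF g_cont] by simp
  have 3: "integral {-N..N} (\<lambda>\<tau>. g \<tau> u) = fejer N (s - u) *\<^sub>R S u y" for u
  proof -
    have "((\<lambda>\<tau>. g \<tau> u) has_integral complex_of_real (fejer N (s - u)) \<odot> S u y) {-N..N}"
      using has_integral_linear[OF fejer_fourier[OF N, of "s - u"] sc.bounded_linear_left[of "S u y"]]
      by (simp add: g_def w_def E_def o_def)
    then show ?thesis by (simp add: integral_unique sc_of_real)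
  qed
  have "continuous_on (cbox 0 ?t) (\<lambda>u. integral (cbox (-N) N) (\<lambda>\<tau>. g \<tau> u))"
    unfolding g_def w_def E_def
    by (rule integral_continuous_on_param, unfold case_prod_beta)
      (intro sc.continuous_on continuous_intros continuous_on_compose2[OF S_cont]; use N in auto)
  then have "continuous_on {0..?t} (\<lambda>u. fejer N (s - u) *\<^sub>R S u y)" by (simp add: 3)
  then have "(\<lambda>u. fejer N (s - u) *\<^sub>R S u y) integrable_on {0..?t}" by (rule integrable_continuous_real)
  moreover have "integral {0..?t} (\<lambda>u. fejer N (s - u) *\<^sub>R S u y) = J s - S ?t (J (- a))"
    using 1 2 by (simp add: 3)
  ultimately show ?thesis using integrable_integral by metis
qed

text \<open>As an integral depending on a parameter the kernel is continuous also at 0, where its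
  definition changes branch.\<close>

lemma fejer_continuous:
  assumes "0 < N"
  shows "continuous_on A (fejer N)"
proof -
  have "continuous_on (UNIV :: real set) (\<lambda>x. integral (cbox (-N) N)
      (\<lambda>\<tau>. complex_of_real (1 - \<bar>\<tau>\<bar> / N) * exp (\<i> * complex_of_real \<tau> * complex_of_real x)))"
    by (rule integral_continuous_on_param, unfold case_prod_beta)
      (intro continuous_intros; use assms in auto)
  moreover have "integral (cbox (-N) N)
      (\<lambda>\<tau>. complex_of_real (1 - \<bar>\<tau>\<bar> / N) * exp (\<i> * complex_of_real \<tau> * complex_of_real x)) = complex_of_real (fejer N x)" for x
    using integral_unique[OF fejer_fourier[OF assms, of x]] by (simp only: cbox_interval)
  ultimately have "continuous_on UNIV (\<lambda>x. Re (complex_of_real (fejer N x)))"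
    by (intro continuous_on_Re) (simp only:)
  then show ?thesis using continuous_on_subset by auto
qed

text \<open>Ingham's Tauberian argument: the boundary function \<open>\<Phi>\<close> of the resolvent is cut off by a
  triangle, whose Fourier transform is the Fejer kernel. Using the truncated Laplace integral of
  the orbit and two translates, only integrals over compact intervals occur.\<close>

lemma orbit_tendsto_zero:
  fixes \<Phi> :: "real \<Rightarrow> 'a"
  assumes F: "finite F" and \<Phi>: "\<And>\<tau>. \<tau> \<notin> F \<Longrightarrow> \<i> * complex_of_real \<tau> \<in> rho \<and> \<Phi> \<tau> = res (\<i> * complex_of_real \<tau>) y"
    and cont: "continuous_on UNIV \<Phi>"
  shows "((\<lambda>t. S t y) \<longlongrightarrow> 0) at_top"
proof (rule tendstoI)
  fix e0 :: real assume e0: "0 < e0"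
  \<comment> \<open>The estimates below add up to 4 * (21 e + 2 e) = 92 e, the factor 4 coming from
    the lower bound 1 / 4 on the kernel mass.\<close>
  define e where "e = e0 / 100"
  have e: "0 < e" using e0 by (simp add: e_def)
  obtain \<eta> where \<eta>: "0 < \<eta>" "\<And>u s. 0 \<le> u \<Longrightarrow> 0 \<le> s \<Longrightarrow> \<bar>u - s\<bar> < \<eta> \<Longrightarrow> norm (S u y - S s y) \<le> e"
    using orbit_uniformly_continuous[OF e, of y] by metis
  define K where "K = M * norm y + 1"
  have K: "0 < K" using M_ge_1 by (simp add: K_def add_nonneg_pos)
  have S_le: "norm (S u y) \<le> K" if "0 \<le> u" for u using S_bound[OF that, of y] by (simp add: K_def)
  \<comment> \<open>Chosen so that the far part of the kernel contributes exactly
    \<open>16 * K / (N * \<eta>) * pi = e\<close>.\<close>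
  define N where "N = 16 * K * pi / (\<eta> * e)"
  have N: "0 < N" using K \<eta> e by (simp add: N_def)
  define h where "h \<tau> = max 0 (1 - \<bar>\<tau>\<bar> / N) *\<^sub>R \<Phi> \<tau>" for \<tau>
  define J where "J x = integral {-N..N} (\<lambda>\<tau>. exp (\<i> * complex_of_real \<tau> * complex_of_real x) \<odot> h \<tau>)" for x
  have h_cont: "continuous_on UNIV h"
    unfolding h_def by (intro continuous_intros cont) (use N in auto)
  have h_supp: "h \<tau> = 0" if "N \<le> \<bar>\<tau>\<bar>" for \<tau> using that N by (simp add: h_def)
  obtain L1 where L1: "\<And>t. L1 \<le> \<bar>t\<bar> \<Longrightarrow> norm (J t) \<le> e"
    using riemann_lebesgue[OF h_cont h_supp N e] unfolding J_def by blast
  have "0 < e / M" using e M_ge_1 by simp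
  then obtain L2 where L2: "\<And>t. L2 \<le> \<bar>t\<bar> \<Longrightarrow> norm (J t) \<le> e / M"
    using riemann_lebesgue[OF h_cont h_supp N] unfolding J_def by blast
  \<comment> \<open>The time \<open>a\<close> past \<open>s\<close> places the boundary term at the
    argument \<open>- a\<close>, where Riemann-Lebesgue decay down to \<open>e / M\<close>
    compensates the bound \<open>M\<close> of the semigroup.\<close>
  define a where "a = \<bar>L2\<bar>"
  have a: "0 \<le> a" "norm (J (- a)) \<le> e / M" using L2[of "- a"] by (auto simp: a_def)
  have main: "norm (S s y) < e0" if s: "\<bar>L1\<bar> \<le> s" "1 / N \<le> s" for s
  proof -
    let ?t = "a + s"
    have s0: "0 \<le> s" using s by linarith
    have t0: "0 \<le> ?t" using s0 a by simp
    define k where "k u = fejer N (s - u)" for u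
    have k_cont: "continuous_on A k" for A
      unfolding k_def by (intro continuous_on_compose2[OF fejer_continuous[OF N, of UNIV]] continuous_intros) auto
    have k_int: "k integrable_on {b..c}" for b c by (intro integrable_continuous_real k_cont)
    have conv: "((\<lambda>u. k u *\<^sub>R S u y) has_integral (J s - S ?t (J (- a)))) {0..?t}"
      unfolding k_def by (rule fejer_convolution[OF F \<Phi> cont N s0 a(1)]) (simp_all add: J_def h_def)
    define c where "c = integral {0..?t} k"
    have const: "((\<lambda>u. k u *\<^sub>R S s y) has_integral c *\<^sub>R S s y) {0..?t}"
      unfolding c_def by (intro has_integral_scaleR_left integrable_integral k_int)
    have c_ge: "1 / 4 \<le> c"
    proof -
      have "((\<lambda>u. N / 4) has_integral (s - (s - 1 / N)) *\<^sub>R (N / 4)) {s - 1 / N..s}"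
        using N has_integral_const_real[of "N / 4" "s - 1 / N" s] by simp
      then have "1 / 4 = integral {s - 1 / N..s} (\<lambda>u. N / 4)" using N by (simp add: integral_unique)
      also have "\<dots> \<le> integral {s - 1 / N..s} k"
      proof (rule integral_le[OF _ k_int])
        fix u assume "u \<in> {s - 1 / N..s}"
        then show "N / 4 \<le> k u" unfolding k_def by (intro fejer_ge[OF N]) auto
      qed (rule integrable_const_ivl)
      also have "\<dots> \<le> c" unfolding c_def
        using N s a by (intro integral_subset_le k_int) (auto simp: k_def intro!: fejer_nonneg)
      finally show ?thesis .
    qed
    \<comment> \<open>Only differences of orbit values remain: for \<open>u\<close> within
      \<open>\<eta>\<close> of \<open>s\<close> they are small, and farther away the kernel is
      small.\<close>
    have D: "((\<lambda>u. k u *\<^sub>R (S s y - S u y)) has_integral (c *\<^sub>R S s y - (J s - S ?t (J (- a))))) {0..?t}"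
      using has_integral_diff[OF const conv] by (simp add: scaleR_diff_right)
    let ?g1 = "\<lambda>u. N / (1 + (N * (s - u))\<^sup>2)" and ?g2 = "\<lambda>u. (1 / \<eta>) / (1 + (1 / \<eta> * (s - u))\<^sup>2)"
    have \<eta>': "0 < 1 / \<eta>" using \<eta> by simp
    note g1 = integral_arctan_kernel_le[OF N t0, of s] and g2 = integral_arctan_kernel_le[OF \<eta>' t0, of s]
    have "norm (c *\<^sub>R S s y - (J s - S ?t (J (- a)))) \<le> integral {0..?t} (\<lambda>u. 5 * e * ?g1 u + 16 * K / (N * \<eta>) * ?g2 u)"
      unfolding integral_unique[OF D, symmetric]
    proof (rule integral_norm_bound_integral)
      show "(\<lambda>u. k u *\<^sub>R (S s y - S u y)) integrable_on {0..?t}" using D by blast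
      show "(\<lambda>u. 5 * e * ?g1 u + 16 * K / (N * \<eta>) * ?g2 u) integrable_on {0..?t}"
        by (intro integrable_add integrable_on_mult_right g1 g2)
      fix u assume u: "u \<in> {0..?t}"
      have pos1: "0 \<le> 5 * e * ?g1 u" using e N by (intro mult_nonneg_nonneg divide_nonneg_pos) (auto simp: add_pos_nonneg)
      have pos2: "0 \<le> 16 * K / (N * \<eta>) * ?g2 u" using K N \<eta> by (intro mult_nonneg_nonneg divide_nonneg_pos) (auto simp: add_pos_nonneg)
      have k0: "0 \<le> k u" unfolding k_def by (rule fejer_nonneg[OF N])
      show "norm (k u *\<^sub>R (S s y - S u y)) \<le> 5 * e * ?g1 u + 16 * K / (N * \<eta>) * ?g2 u"
      proof (cases "\<bar>s - u\<bar> < \<eta>")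
        case True
        have "norm (k u *\<^sub>R (S s y - S u y)) = k u * norm (S s y - S u y)" using k0 by simp
        also have "\<dots> \<le> (5 * ?g1 u) * e"
          unfolding k_def using \<eta>(2)[of s u] True u s0 e N
          by (intro mult_mono fejer_le_arctan_kernel) (auto intro!: divide_nonneg_pos add_pos_nonneg)
        finally have "norm (k u *\<^sub>R (S s y - S u y)) \<le> 5 * e * ?g1 u" by (simp add: mult_ac)
        then show ?thesis using pos2 by linarith
      next
        case False
        have "norm (S s y - S u y) \<le> K + K"
          by (rule order_trans[OF norm_triangle_ineq4 add_mono]) (use S_le s0 u in auto)
        moreover have k_le: "k u \<le> 8 / (N * \<eta>) * ?g2 u"
          unfolding k_def using False by (intro fejer_le_arctan_kernel_far N \<eta>) auto
        ultimately have "k u * norm (S s y - S u y) \<le> (8 / (N * \<eta>) * ?g2 u) * (K + K)"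
          using order_trans[OF k0 k_le] by (intro mult_mono norm_ge_zero)
        then have "norm (k u *\<^sub>R (S s y - S u y)) \<le> 16 * K / (N * \<eta>) * ?g2 u"
          using k0 by (simp add: mult_ac)
        then show ?thesis using pos1 by linarith
      qed
    qed
    also have "\<dots> = 5 * e * integral {0..?t} ?g1 + 16 * K / (N * \<eta>) * integral {0..?t} ?g2"
      by (subst integral_add) (intro integrable_on_mult_right g1 g2, intro integrable_on_mult_right g1 g2, simp only: integral_mult_right)
    also have "\<dots> \<le> 5 * e * pi + 16 * K / (N * \<eta>) * pi"
      using e K N \<eta> by (intro add_mono mult_left_mono g1 g2) auto
    also have "16 * K / (N * \<eta>) * pi = e" using K \<eta> e by (simp add: N_def)
    also have "5 * e * pi + e \<le> 21 * e" using pi_less_4 e by simp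
    finally have 1: "norm (c *\<^sub>R S s y - (J s - S ?t (J (- a)))) \<le> 21 * e" .
    have "norm (S ?t (J (- a))) \<le> M * (e / M)"
      using S_bound[OF t0] a(2) M_ge_1 by (meson mult_left_mono order_trans zero_le_one)
    then have 2: "norm (S ?t (J (- a))) \<le> e" using M_ge_1 by simp
    have 3: "norm (J s) \<le> e" using s by (intro L1) linarith
    have "(1 / 4) * norm (S s y) \<le> norm (c *\<^sub>R S s y)"
      using mult_right_mono[OF c_ge norm_ge_zero[of "S s y"]] c_ge by simp
    also have "c *\<^sub>R S s y = (c *\<^sub>R S s y - (J s - S ?t (J (- a)))) + (J s - S ?t (J (- a)))" by simp
    also have "norm \<dots> \<le> 21 * e + (e + e)"
      by (rule order_trans[OF norm_triangle_ineq add_mono[OF 1 order_trans[OF norm_triangle_ineq4 add_mono[OF 3 2]]]])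
    finally have "norm (S s y) \<le> 92 * e" by simp
    then show ?thesis using e0 by (simp add: e_def)
  qed
  show "\<forall>\<^sub>F t in at_top. dist (S t y) 0 < e0"
    unfolding eventually_at_top_linorder using main
    by (intro exI[of _ "max \<bar>L1\<bar> (1 / N)"]) auto
qed

end

section \<open>Asymptotics of a bounded semigroup with finitely many imaginary poles\<close>

text \<open>A pole enters as a growth bound for each single vector; the constant \<open>C f\<close>
  may depend on the vector, since the Laurent coefficients are estimated vector by vector.\<close>

locale semigroup_with_imaginary_poles = bounded_semigroup +
  fixes \<Lambda> :: "complex set" and radius :: "complex \<Rightarrow> real"
  assumes finite_poles: "finite \<Lambda>"
    and poles_imaginary: "z \<in> \<Lambda> \<Longrightarrow> Re z = 0"
    and poles_not_in_rho: "z \<in> \<Lambda> \<Longrightarrow> z \<notin> rho"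
    and imaginary_in_rho: "\<i> * complex_of_real \<tau> \<notin> \<Lambda> \<Longrightarrow> \<i> * complex_of_real \<tau> \<in> rho"
    and radius_pos: "z \<in> \<Lambda> \<Longrightarrow> 0 < radius z"
    and punctured_disc: "z \<in> \<Lambda> \<Longrightarrow> cball z (radius z) - {z} \<subseteq> rho"
    and growth: "z \<in> \<Lambda> \<Longrightarrow> \<exists>d>0. \<exists>C m. \<forall>w f. w \<noteq> z \<longrightarrow> dist z w < d \<longrightarrow> norm (res w f) \<le> C f / norm (w - z) ^ m"
begin

definition proj :: "complex \<Rightarrow> 'a \<Rightarrow> 'a" where
  "proj z = laurent z (radius z) 0"

lemma laurent_one: "z \<in> \<Lambda> \<Longrightarrow> laurent z (radius z) 1 f = 0"
  using growth[of z] laurent_one_eq_zero[OF radius_pos punctured_disc _ _ poles_imaginary] by metis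

lemma proj_clin: "z \<in> \<Lambda> \<Longrightarrow> clin (proj z)"
  unfolding proj_def by (intro laurent_clin radius_pos punctured_disc)

lemmas proj_simps = clin_simps[OF proj_clin]

lemma gr_proj: "z \<in> \<Lambda> \<Longrightarrow> gr (proj z f) (z \<odot> proj z f)"
  using gr_laurent[OF radius_pos punctured_disc, of z 0 f] laurent_one[of z f]
  by (simp add: proj_def)

lemma proj_proj: "z \<in> \<Lambda> \<Longrightarrow> w \<in> \<Lambda> \<Longrightarrow> proj z (proj w f) = (if z = w then proj w f else 0)"
  using laurent_zero_of_eigenvector[OF radius_pos punctured_disc gr_proj, of z f]
    laurent_zero_of_other_eigenvector[OF radius_pos punctured_disc gr_proj _ laurent_one, of z w f]
  by (auto simp: proj_def)

lemma S_proj: "z \<in> \<Lambda> \<Longrightarrow> 0 \<le> t \<Longrightarrow> S t (proj z f) = exp (z * complex_of_real t) \<odot> proj z f"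
  by (intro S_eigenvector gr_proj)

lemma proj_nonzero:
  assumes "z \<in> \<Lambda>"
  obtains f where "proj z f \<noteq> 0"
  using in_rho_if_laurent_zero[OF radius_pos punctured_disc, of z] poles_not_in_rho[of z] assms
  unfolding proj_def by blast

text \<open>Subtracting all projections removes the principal part at every pole, so the resolvent
  of the remainder extends continuously along the whole imaginary axis and the Tauberian argument
  applies.\<close>

lemma S_off_poles_tendsto_zero: "((\<lambda>t. S t (f - (\<Sum>z\<in>\<Lambda>. proj z f))) \<longlongrightarrow> 0) at_top"
proof -
  let ?y = "f - (\<Sum>z\<in>\<Lambda>. proj z f)" and ?i = "\<lambda>\<tau>. \<i> * complex_of_real \<tau>"
  \<comment> \<open>The extension near the pole \<open>p\<close>: its own projection leaves
    \<open>regular_part\<close>, while the other projections are eigenvectors and contribute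
    explicit fractions that are regular at \<open>p\<close>.\<close>
  define E where "E p z = regular_part p (radius p) z f - (\<Sum>k\<in>\<Lambda> - {p}. (1 / (z - k)) \<odot> proj k f)" for p z
  define \<Phi> where "\<Phi> \<tau> = (if ?i \<tau> \<in> \<Lambda> then E (?i \<tau>) (?i \<tau>) else res (?i \<tau>) ?y)" for \<tau>
  have E_res: "res z ?y = E p z" if p: "p \<in> \<Lambda>" and z: "z \<in> rho" "dist p z < radius p" for p z
  proof -
    have "(\<Sum>k\<in>\<Lambda>. proj k f) = proj p f + (\<Sum>k\<in>\<Lambda> - {p}. proj k f)"
      using p finite_poles by (simp add: sum.remove)
    then have "res z ?y = (res z f - res z (proj p f)) - (\<Sum>k\<in>\<Lambda> - {p}. res z (proj k f))"
      using z by (simp add: res_simps)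
    also have "res z f - res z (proj p f) = regular_part p (radius p) z f"
      unfolding proj_def using p z
      by (intro res_minus_laurent radius_pos punctured_disc) (auto simp: dist_norm norm_minus_commute)
    also have "(\<Sum>k\<in>\<Lambda> - {p}. res z (proj k f)) = (\<Sum>k\<in>\<Lambda> - {p}. (1 / (z - k)) \<odot> proj k f)"
      using z poles_not_in_rho by (intro sum.cong refl res_eigenvector gr_proj) auto
    finally show ?thesis by (simp add: E_def)
  qed
  have fin: "finite {\<tau>. ?i \<tau> \<in> \<Lambda>}"
    using finite_vimageI[OF finite_poles, of ?i] by (simp add: inj_on_def vimage_def)
  have cont: "isCont \<Phi> \<tau>0" for \<tau>0
  proof (cases "?i \<tau>0 \<in> \<Lambda>")
    case True
    let ?p = "?i \<tau>0"
    have r: "0 < radius ?p" using True by (rule radius_pos)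
    have notin: "z \<notin> \<Lambda>" if "dist ?p z < radius ?p" "z \<noteq> ?p" for z
    proof -
      have "z \<in> cball ?p (radius ?p) - {?p}" using that by auto
      then show ?thesis using punctured_disc[OF True] poles_not_in_rho by blast
    qed
    have "isCont (E ?p) ?p"
    proof -
      have "isCont (\<lambda>z. regular_part ?p (radius ?p) z f) ?p"
        using regular_part_continuous[OF r punctured_disc[OF True], of f] r
        by (auto simp: continuous_on_eq_continuous_at)
      moreover have "isCont (\<lambda>z. (1 / (z - k)) \<odot> proj k f) ?p" if "k \<in> \<Lambda> - {?p}" for k
        using that by (intro sc.isCont continuous_intros) auto
      ultimately show ?thesis unfolding E_def by (intro continuous_intros)
    qed
    then have 1: "isCont (\<lambda>\<tau>. E ?p (?i \<tau>)) \<tau>0"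
      by (rule isCont_o2[where f = ?i, rotated]) (intro continuous_intros)
    have "\<forall>\<^sub>F \<tau> in nhds \<tau>0. \<Phi> \<tau> = E ?p (?i \<tau>)"
      unfolding eventually_nhds_metric
    proof (intro exI[of _ "radius ?p"] conjI r allI impI)
      fix \<tau> assume "dist \<tau> \<tau>0 < radius ?p"
      then have d: "dist ?p (?i \<tau>) < radius ?p"
        by (simp add: dist_norm norm_mult abs_minus_commute flip: right_diff_distrib of_real_diff)
      show "\<Phi> \<tau> = E ?p (?i \<tau>)"
      proof (cases "\<tau> = \<tau>0")
        case True
        then show ?thesis using \<open>?i \<tau>0 \<in> \<Lambda>\<close> by (simp add: \<Phi>_def)
      next
        case False
        then have "?i \<tau> \<notin> \<Lambda>" using notin[OF d] by simp
        then show ?thesis using E_res[OF True imaginary_in_rho d] by (simp add: \<Phi>_def)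
      qed
    qed
    from isCont_cong[OF this] 1 show ?thesis by (rule iffD2)
  next
    case False
    have open_compl: "open (- {\<tau>. ?i \<tau> \<in> \<Lambda>})" using finite_imp_closed[OF fin] by (simp add: open_Compl)
    have "continuous_on (- {\<tau>. ?i \<tau> \<in> \<Lambda>}) (\<lambda>\<tau>. res (?i \<tau>) ?y)"
      by (intro continuous_on_compose2[OF res_continuous] continuous_intros) (use imaginary_in_rho in auto)
    then have "continuous_on (- {\<tau>. ?i \<tau> \<in> \<Lambda>}) \<Phi>"
      by (rule continuous_on_eq) (simp add: \<Phi>_def)
    then show ?thesis using open_compl False by (simp add: continuous_on_eq_continuous_at)
  qed
  show ?thesis
  proof (rule orbit_tendsto_zero[OF fin])
    show "continuous_on UNIV \<Phi>" using cont by (simp add: continuous_at_imp_continuous_on)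
  qed (auto simp: \<Phi>_def imaginary_in_rho)
qed

lemma S_asymptotics:
  "((\<lambda>t. S t f - (\<Sum>z\<in>\<Lambda>. exp (z * complex_of_real t) \<odot> proj z f)) \<longlongrightarrow> 0) at_top"
proof (rule Lim_transform_eventually[OF S_off_poles_tendsto_zero])
  show "\<forall>\<^sub>F t in at_top. S t (f - (\<Sum>z\<in>\<Lambda>. proj z f)) = S t f - (\<Sum>z\<in>\<Lambda>. exp (z * complex_of_real t) \<odot> proj z f)"
    using eventually_ge_at_top[of 0]
    by eventually_elim (simp add: S_simps S_proj)
qed

text \<open>The limit orbit is almost periodic, hence recurs to each of its values at late times.\<close>

lemma poles_recurrence:
  assumes "0 < e"
  shows "\<exists>q\<ge>L. \<forall>z\<in>\<Lambda>. norm (exp (z * complex_of_real q) - 1) < e"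
proof -
  obtain zs where zs: "set zs = \<Lambda>" using finite_list[OF finite_poles] by blast
  define n where "n = length zs"
  \<comment> \<open>The return time will be \<open>q * l\<close> with an integer
    \<open>q \<ge> 1\<close>, so \<open>l \<ge> \<bar>L\<bar>\<close> guarantees that it is late
    enough.\<close>
  define l where "l = max \<bar>L\<bar> 1"
  obtain N :: nat where N: "2 * pi / e < real N" using reals_Archimedean2 by blast
  then have N0: "0 < N" using assms by (metis divide_pos_pos gr0I of_nat_0 order_less_trans pi_gt_zero zero_less_mult_iff zero_less_numeral less_asym)
  \<comment> \<open>Dirichlet's simultaneous approximation makes all phases at time
    \<open>q * l\<close> nearly integer multiples of 2 pi; the choice of \<open>N\<close> keeps the
    phase error below \<open>e\<close>.\<close>
  obtain q p where q: "0 < q" "\<And>i. i < n \<Longrightarrow> \<bar>of_int q * (Im (zs ! i) * l / (2 * pi)) - of_int (p i)\<bar> < 1 / N"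
    using Dirichlet_approx_simult[OF N0, where n = n and \<theta> = "\<lambda>i. Im (zs ! i) * l / (2 * pi)"] by metis
  have "norm (exp (z * complex_of_real (of_int q * l)) - 1) < e" if z: "z \<in> \<Lambda>" for z
  proof -
    obtain i where i: "i < n" "z = zs ! i" using z zs by (metis in_set_conv_nth n_def)
    define x where "x = 2 * pi * (of_int q * (Im z * l / (2 * pi)) - of_int (p i))"
    have "\<bar>x\<bar> \<le> 2 * pi * (1 / N)"
      unfolding x_def abs_mult using q(2)[OF i(1)] i(2) by (intro mult_mono) auto
    also have "\<dots> < e" using N N0 assms by (simp add: field_simps)
    finally have x: "\<bar>x\<bar> < e" .
    have "z * complex_of_real (of_int q * l) = \<i> * complex_of_real (Im z * of_int q * l)"
      using poles_imaginary[OF z] by (simp add: complex_eq_iff)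
    also have "Im z * of_int q * l = x + 2 * of_int (p i) * pi"
      by (simp add: x_def field_simps)
    finally have "exp (z * complex_of_real (of_int q * l)) = exp (\<i> * complex_of_real x)"
      using exp_integer_2pi[of "of_int (p i)"] by (simp add: algebra_simps exp_add)
    then have "norm (exp (z * complex_of_real (of_int q * l)) - 1) = 2 * \<bar>sin (x / 2)\<bar>"
      using dist_exp_i_1[of x] by simp
    also have "\<dots> \<le> \<bar>x\<bar>" using abs_sin_x_le_abs_x[of "x / 2"] by simp
    finally show ?thesis using x by simp
  qed
  moreover have "L \<le> of_int q * l"
  proof -
    have "L \<le> 1 * l" by (simp add: l_def)
    also have "\<dots> \<le> of_int q * l" using q(1) by (intro mult_right_mono) (auto simp: l_def)
    finally show ?thesis .
  qed
  ultimately show ?thesis by blast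
qed

end

section \<open>Positive families on Banach lattices\<close>

text \<open>The infimum is below both \<open>a + inf b g\<close> and \<open>g + inf b g\<close>, and
  translation invariance combines these two bounds.\<close>

lemma inf_add_le_add_inf:
  fixes a b g :: "'r::banach_lattice"
  assumes "0 \<le> a" "0 \<le> b" "0 \<le> g"
  shows "inf (a + b) g \<le> inf a g + inf b g"
proof -
  let ?c = "inf (a + b) g"
  have c: "?c \<le> a + b" "?c \<le> g" by (rule inf_le1, rule inf_le2)
  have "?c \<le> a + inf b g"
  proof -
    have "?c \<le> a + g" using c(2) assms(1) by (metis add_increasing)
    with c(1) show ?thesis unfolding add_inf_distrib_left by (rule le_infI)
  qed
  moreover have "?c \<le> g + inf b g"
    using c(2) assms by (meson add_increasing2 le_infI)
  ultimately show ?thesis unfolding add_inf_distrib_right by (rule le_infI)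
qed

lemma inf_add_nonneg_le:
  fixes a b c d :: "'r::banach_lattice"
  assumes "0 \<le> c" "0 \<le> d"
  shows "inf (a + c) (b + d) \<le> inf a b + (c + d)"
  unfolding add_inf_distrib_right
proof (rule inf_mono)
  show "a + c \<le> a + (c + d)" using assms(2) by simp
  show "b + d \<le> b + (c + d)" using assms(1) by simp
qed

lemma inf_le_add_diff:
  fixes a b c d :: "'r::banach_lattice"
  assumes "a \<le> c" "b \<le> d"
  shows "inf c d \<le> inf a b + ((c - a) + (d - b))"
  using inf_add_nonneg_le[of "c - a" "d - b" a b] assms by simp

lemma pos_part_inf_neg_part: "inf (sup x 0) (sup (- x) 0) = (0 :: 'r::banach_lattice)"
proof -
  have "sup x 0 = x + sup (- x) 0"
    unfolding add_sup_distrib_left by (simp add: sup_commute)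
  then have "inf (sup x 0) (sup (- x) 0) = inf (x + sup (- x) 0) (0 + sup (- x) 0)"
    by (simp only: add_0_left)
  also have "\<dots> = inf x 0 + sup (- x) 0" by (rule add_inf_distrib_right[symmetric])
  also have "\<dots> = inf x 0 + - inf x 0" by (simp only: neg_inf_eq_sup minus_zero)
  finally show ?thesis by (simp only: add.right_inverse)
qed

lemma pos_part_minus_neg_part: "sup x 0 - sup (- x) 0 = (x :: 'r::banach_lattice)"
proof -
  have "sup x 0 = x + sup (- x) 0"
    unfolding add_sup_distrib_left by (simp add: sup_commute)
  then show ?thesis by (metis add_diff_cancel)
qed

text \<open>Abstracts the limit group on real vectors. \<open>V 0\<close> is a projection and not
  the identity, since the group lives on the sum of the eigenspaces; \<open>D\<close> is its
  generator, with values in that range.\<close>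

locale positive_family =
  fixes V :: "real \<Rightarrow> 'r::banach_lattice \<Rightarrow> 'r" and D :: "'r \<Rightarrow> 'r"
  assumes V_linear: "bounded_linear (V t)"
    and V_pos: "0 \<le> x \<Longrightarrow> 0 \<le> V t x"
    and D_linear: "bounded_linear D"
    and deriv: "((\<lambda>t. V t x) has_vector_derivative D x) (at 0)"
    and V_D: "V 0 (D x) = D x"
    and V_V: "V 0 (V 0 x) = V 0 x"
begin

text \<open>The range of the positive projection \<open>P\<close> is a vector lattice only modulo the null ideal
  of the seminorm \<open>norm (P (pabs x))\<close>, so disjointness of \<open>f\<close> and \<open>g\<close> is expressed by
  \<open>P (inf f g) = 0\<close>.\<close>

definition P :: "'r \<Rightarrow> 'r" where
  "P = V 0"

lemma PP: "P (P x) = P x" and PD: "P (D x) = D x"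
  by (simp_all add: P_def V_V V_D)

lemma P_linear: "bounded_linear P"
  unfolding P_def by (rule V_linear)

lemmas P_simps = linear_add[OF bounded_linear.linear[OF P_linear]] linear_diff[OF bounded_linear.linear[OF P_linear]]
  linear_0[OF bounded_linear.linear[OF P_linear]] linear_scale[OF bounded_linear.linear[OF P_linear]]
lemmas D_simps = linear_add[OF bounded_linear.linear[OF D_linear]] linear_diff[OF bounded_linear.linear[OF D_linear]]

lemma P_pos: "0 \<le> x \<Longrightarrow> 0 \<le> P x"
  unfolding P_def by (rule V_pos)

lemma P_mono: "x \<le> y \<Longrightarrow> P x \<le> P y"
  using P_pos[of "y - x"] by (simp add: P_simps)

lemma P_null_mono: "0 \<le> x \<Longrightarrow> x \<le> y \<Longrightarrow> P y = 0 \<Longrightarrow> P x = 0"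
  using P_pos[of x] P_mono[of x y] by (simp add: antisym)

text \<open>Positivity of V (s t) f = f + s t D f + o(t) gives t w \<le> f + o(t) for w = - s D f.
  Meeting with \<open>g\<close> and applying \<open>P\<close> kills the part of \<open>f\<close>,
  and division by t leaves a null limit. Having both signs of \<open>s\<close> requires positivity
  at negative times.\<close>

lemma disjoint_neg_part:
  fixes s :: real
  assumes f: "0 \<le> f" "P f = f" and g: "0 \<le> g" and disj: "P (inf f g) = 0" and s: "\<bar>s\<bar> = 1"
  shows "P (inf (sup (- (s *\<^sub>R D f)) 0) g) = 0"
proof -
  define w where "w = - (s *\<^sub>R D f)"
  define u where "u = inf (sup w 0) g"
  define r where "r t = V (s * t) f - f + t *\<^sub>R w" for t
  have u0: "0 \<le> u" using g by (simp add: u_def le_supI2)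
  obtain K where K: "0 < K" "\<And>x. norm (P x) \<le> norm x * K" using bounded_linear.pos_bounded[OF P_linear] by blast
  have bound: "norm (P u) \<le> K * (norm (r t) / t)" if t: "0 < t" "t \<le> 1" for t
  proof -
    have "t *\<^sub>R w \<le> f + r t"
      using V_pos[OF f(1), of "s * t"] by (simp add: r_def)
    also have "\<dots> \<le> f + pabs (r t)" by (intro add_left_mono pabs_ge)
    finally have 1: "t *\<^sub>R w \<le> f + pabs (r t)" .
    have "t *\<^sub>R sup w 0 \<le> f + pabs (r t)"
    proof -
      have "w \<le> (1 / t) *\<^sub>R (f + pabs (r t))"
        using scaleR_left_mono[OF 1, of "1 / t"] t by simp
      moreover have "0 \<le> (1 / t) *\<^sub>R (f + pabs (r t))"
        using t f by (intro scaleR_nonneg_nonneg add_nonneg_nonneg) auto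
      ultimately have "sup w 0 \<le> (1 / t) *\<^sub>R (f + pabs (r t))" by (rule le_supI)
      from scaleR_left_mono[OF this, of t] t show ?thesis by simp
    qed
    moreover have "t *\<^sub>R u \<le> t *\<^sub>R sup w 0" "t *\<^sub>R u \<le> t *\<^sub>R g"
      using t by (intro scaleR_left_mono; simp add: u_def)+
    \<comment> \<open>The restriction to \<open>t \<le> 1\<close> keeps the multiple of
      \<open>g\<close> below \<open>g\<close>.\<close>
    moreover have "t *\<^sub>R g \<le> g"
      using scaleR_right_mono[of t 1 g] t g by simp
    ultimately have "t *\<^sub>R u \<le> f + pabs (r t)" "t *\<^sub>R u \<le> g + 0"
      by (simp_all only: add_0_right)
    then have "t *\<^sub>R u \<le> inf (f + pabs (r t)) (g + 0)" by (rule le_infI)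
    also have "\<dots> \<le> inf f g + (pabs (r t) + 0)" by (rule inf_add_nonneg_le) simp_all
    finally have "P (t *\<^sub>R u) \<le> P (inf f g + pabs (r t))" by (intro P_mono) simp
    then have "t *\<^sub>R P u \<le> P (pabs (r t))" using disj by (simp add: P_simps)
    then have "norm (t *\<^sub>R P u) \<le> norm (P (pabs (r t)))"
      using t u0 by (intro norm_mono_nonneg scaleR_nonneg_nonneg P_pos) auto
    also have "\<dots> \<le> norm (r t) * K" using K(2)[of "pabs (r t)"] by simp
    finally show ?thesis using t by (simp add: field_simps)
  qed
  have lim: "((\<lambda>t. norm (r t) / t) \<longlongrightarrow> 0) (at_right 0)"
  proof -
    have "((\<lambda>h. norm ((V h f - V 0 f) - (h - 0) *\<^sub>R D f) / norm (h - 0)) \<longlongrightarrow> 0) (at 0)"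
      using deriv[of f] unfolding has_vector_derivative_def has_derivative_iff_norm by simp
    moreover have "filterlim (\<lambda>t. s * t) (at 0) (at_right 0)"
      unfolding filterlim_at
    proof
      show "\<forall>\<^sub>F t in at_right 0. s * t \<in> UNIV \<and> s * t \<noteq> 0"
        using s by (auto intro: eventually_mono[OF eventually_at_right_less])
      show "((\<lambda>t. s * t) \<longlongrightarrow> 0) (at_right 0)"
        using tendsto_mult_right_zero[OF tendsto_ident_at] .
    qed
    ultimately have "((\<lambda>t. norm ((V (s * t) f - V 0 f) - (s * t - 0) *\<^sub>R D f) / norm (s * t - 0)) \<longlongrightarrow> 0) (at_right 0)"
      by (rule filterlim_compose)
    moreover have "\<forall>\<^sub>F t in at_right 0. norm ((V (s * t) f - V 0 f) - (s * t - 0) *\<^sub>R D f) / norm (s * t - 0) = norm (r t) / t"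
    proof (rule eventually_mono[OF eventually_at_right_less])
      fix t :: real assume "0 < t"
      then show "norm ((V (s * t) f - V 0 f) - (s * t - 0) *\<^sub>R D f) / norm (s * t - 0) = norm (r t) / t"
        using f(2) s by (simp add: P_def r_def w_def abs_mult mult.commute)
    qed
    ultimately show ?thesis by (rule Lim_transform_eventually)
  qed
  have "norm (P u) \<le> K * 0"
  proof (rule tendsto_le[OF trivial_limit_at_right_real _ tendsto_const])
    show "((\<lambda>t. K * (norm (r t) / t)) \<longlongrightarrow> K * 0) (at_right 0)" by (intro tendsto_intros lim)
    show "\<forall>\<^sub>F t in at_right 0. norm (P u) \<le> K * (norm (r t) / t)"
      unfolding eventually_at by (intro exI[of _ 1]) (auto simp: dist_norm simp del: times_divide_eq_right intro!: bound)
  qed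
  then show ?thesis by (simp add: u_def w_def)
qed

lemma disjoint_add:
  assumes "0 \<le> a" "0 \<le> b" "0 \<le> g" "P (inf a g) = 0" "P (inf b g) = 0"
  shows "P (inf (a + b) g) = 0"
proof (rule P_null_mono[OF _ inf_add_le_add_inf[OF assms(1-3)]])
  show "0 \<le> inf (a + b) g" using assms by simp
  show "P (inf a g + inf b g) = 0" using assms by (simp add: P_simps)
qed

lemma disjoint_mono:
  assumes "0 \<le> a" "a \<le> b" "0 \<le> g" "P (inf b g) = 0"
  shows "P (inf a g) = 0"
proof (rule P_null_mono[OF _ inf_mono[OF assms(2) order_refl] assms(4)])
  show "0 \<le> inf a g" using assms by simp
qed

text \<open>Replacing \<open>c\<close> by \<open>max 1 c\<close> allows both arguments of the
  infimum to be scaled by the same factor.\<close>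

lemma disjoint_scaleR:
  assumes "0 \<le> a" "0 \<le> g" "0 \<le> c" "P (inf a g) = 0"
  shows "P (inf (c *\<^sub>R a) g) = 0"
proof (rule P_null_mono)
  let ?c = "max 1 c"
  show "0 \<le> inf (c *\<^sub>R a) g" using assms by (simp add: scaleR_nonneg_nonneg)
  have "inf (c *\<^sub>R a) g \<le> inf (?c *\<^sub>R a) (?c *\<^sub>R g)"
  proof (rule inf_mono)
    show "c *\<^sub>R a \<le> ?c *\<^sub>R a" using assms by (intro scaleR_right_mono) auto
    show "g \<le> ?c *\<^sub>R g" using scaleR_right_mono[of 1 ?c g] assms by simp
  qed
  also have "\<dots> \<le> ?c *\<^sub>R inf a g"
  proof -
    let ?z = "inf (?c *\<^sub>R a) (?c *\<^sub>R g)"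
    have "(1 / ?c) *\<^sub>R ?z \<le> (1 / ?c) *\<^sub>R (?c *\<^sub>R a)" "(1 / ?c) *\<^sub>R ?z \<le> (1 / ?c) *\<^sub>R (?c *\<^sub>R g)"
      by (intro scaleR_left_mono; simp)+
    moreover have nz: "?c \<noteq> 0" by simp
    ultimately have "(1 / ?c) *\<^sub>R ?z \<le> inf a g" by (intro le_infI) simp_all
    from scaleR_left_mono[OF this, of ?c] nz show ?thesis by simp
  qed
  finally show "inf (c *\<^sub>R a) g \<le> ?c *\<^sub>R inf a g" .
  show "P (?c *\<^sub>R inf a g) = 0" using assms by (simp add: P_simps)
qed

lemma disjoint_D_nonneg:
  assumes f: "0 \<le> f" "P f = f" and g: "0 \<le> g" and disj: "P (inf f g) = 0"
  shows "P (inf (pabs (D f)) g) = 0"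
proof (rule disjoint_mono)
  show "P (inf (sup (D f) 0 + sup (- D f) 0) g) = 0"
    using disjoint_neg_part[OF assms, of 1] disjoint_neg_part[OF assms, of "-1"] g
    by (intro disjoint_add) auto
  show "pabs (D f) \<le> sup (D f) 0 + sup (- D f) 0"
  proof (rule pabs_leI)
    show "D f \<le> sup (D f) 0 + sup (- D f) 0" by (rule add_increasing2) auto
    show "- D f \<le> sup (D f) 0 + sup (- D f) 0" by (rule add_increasing) auto
  qed
qed (use g in auto)

text \<open>\<open>P (sup f 0)\<close> is the positive part of \<open>f\<close> within the range of
  \<open>P\<close>. It may exceed \<open>sup f 0\<close>, but the excess is nonnegative and
  annihilated by \<open>P\<close>.\<close>

lemma P_ge_pos_part:
  assumes "P f = f"
  shows "sup f 0 \<le> P (sup f 0)"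
proof (rule le_supI)
  show "f \<le> P (sup f 0)" using P_mono[of f "sup f 0"] assms by simp
qed (simp add: P_pos)

text \<open>Write \<open>f\<close> as the difference of its positive and negative parts taken in the
  range of \<open>P\<close>. Their excess over the lattice parts is annihilated by \<open>P\<close>,
  so they inherit disjointness from \<open>g\<close>, and the nonnegative case applies to
  each.\<close>

lemma disjoint_D:
  assumes f: "P f = f" and g: "0 \<le> g" and disj: "P (inf (pabs f) g) = 0"
  shows "P (inf (pabs (D f)) g) = 0"
proof -
  have part: "P (inf (pabs (D (P (sup h 0)))) g) = 0"
    if h: "P h = h" "sup h 0 \<le> pabs f" for h
  proof (rule disjoint_D_nonneg)
    have 1: "P (inf (sup h 0) g) = 0" by (rule disjoint_mono[OF _ h(2) g disj]) simp
    show "P (inf (P (sup h 0)) g) = 0"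
    proof (rule P_null_mono)
      show "inf (P (sup h 0)) g \<le> inf (sup h 0) g + ((P (sup h 0) - sup h 0) + (g - g))"
        by (rule inf_le_add_diff[OF P_ge_pos_part[OF h(1)] order_refl])
      show "P (inf (sup h 0) g + ((P (sup h 0) - sup h 0) + (g - g))) = 0"
        unfolding P_simps PP 1 by simp
    qed (use g in \<open>simp add: P_pos\<close>)
  qed (use g in \<open>simp_all add: PP P_pos\<close>)
  have P_minus: "P (- f) = - f" using f P_simps(2)[of 0 f] by (simp add: P_simps(3))
  let ?a = "P (sup f 0)" and ?b = "P (sup (- f) 0)"
  have "P (inf (pabs (D ?a)) g) = 0" using f by (intro part) (simp_all add: pabs_ge)
  moreover have "P (inf (pabs (D ?b)) g) = 0" using P_minus by (intro part) (simp_all add: pabs_ge)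
  ultimately have sum: "P (inf (pabs (D ?a) + pabs (D ?b)) g) = 0" using g by (intro disjoint_add) auto
  have "?a - ?b = P (sup f 0 - sup (- f) 0)" by (simp only: P_simps)
  then have "f = ?a - ?b" using f by (simp only: pos_part_minus_neg_part)
  then have "D f = D ?a + - D ?b" by (metis D_simps(2) diff_conv_add_uminus)
  then have "pabs (D f) \<le> pabs (D ?a) + pabs (D ?b)" using pabs_triangle[of "D ?a" "- D ?b"] by simp
  then show ?thesis by (intro disjoint_mono[OF _ _ g sum]) auto
qed

text \<open>On the range of \<open>P\<close> the local operator \<open>D\<close> acts like multiplication by a real function, so
  \<open>D\<^sup>2\<close> cannot be multiplication by a negative number.\<close>

lemma no_rotation:
  assumes x: "P x = x" "D (D x) = - (b\<^sup>2 *\<^sub>R x)"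
    and rot: "\<And>p. P p = p \<Longrightarrow> D (D p) = - (b\<^sup>2 *\<^sub>R p) \<Longrightarrow> V \<tau> p = - p"
  shows "x = 0"
proof -
  define p where "p = P (sup x 0)"
  define n where "n = P (sup (- x) 0)"
  have P_minus: "P (- x) = - x" using x P_simps(2)[of 0 x] by (simp add: P_simps(3))
  have pn: "0 \<le> p" "0 \<le> n" "P p = p" "P n = n" by (simp_all add: p_def n_def P_pos PP)
  have "p - n = P (sup x 0 - sup (- x) 0)" by (simp only: P_simps p_def n_def)
  then have x_eq: "x = p - n" using x by (simp only: pos_part_minus_neg_part)
  have disj: "P (inf p n) = 0"
  proof (rule P_null_mono)
    show "inf p n \<le> inf (sup x 0) (sup (- x) 0) + ((p - sup x 0) + (n - sup (- x) 0))"
      unfolding p_def n_def by (intro inf_le_add_diff P_ge_pos_part x P_minus)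
    show "P (inf (sup x 0) (sup (- x) 0) + ((p - sup x 0) + (n - sup (- x) 0))) = 0"
      unfolding pos_part_inf_neg_part P_simps pn(3,4) p_def[symmetric] n_def[symmetric] by simp
  qed (use pn in simp)
  \<comment> \<open>Since \<open>D (D x) = - (b\<^sup>2 *\<^sub>R x)\<close>, the same
    \<open>y\<close> arises from \<open>p\<close> and from \<open>n\<close>. By locality it is
    disjoint from \<open>n\<close> through \<open>p\<close>, and then disjoint from itself through
    \<open>n\<close>.\<close>
  define y where "y = D (D p) + b\<^sup>2 *\<^sub>R p"
  have y_n: "y = D (D n) + b\<^sup>2 *\<^sub>R n"
  proof -
    have "D (D p) - D (D n) = - (b\<^sup>2 *\<^sub>R p) + b\<^sup>2 *\<^sub>R n"
      using x(2) unfolding x_eq by (simp only: D_simps) (simp add: scaleR_diff_right)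
    then show ?thesis unfolding y_def by (simp add: algebra_simps)
  qed
  have part: "P (inf (pabs (D (D q) + b\<^sup>2 *\<^sub>R q)) g) = 0"
    if q: "0 \<le> q" "P q = q" and g: "0 \<le> g" and d: "P (inf q g) = 0" for q g
  proof (rule disjoint_mono)
    have "P (inf (pabs (D q)) g) = 0" by (rule disjoint_D[OF q(2) g]) (simp add: pabs_of_nonneg q d)
    then have "P (inf (pabs (D (D q))) g) = 0" by (intro disjoint_D[OF PD g])
    then show "P (inf (pabs (D (D q)) + b\<^sup>2 *\<^sub>R q) g) = 0"
      using q g d by (intro disjoint_add disjoint_scaleR) (auto intro: scaleR_nonneg_nonneg)
    show "pabs (D (D q) + b\<^sup>2 *\<^sub>R q) \<le> pabs (D (D q)) + b\<^sup>2 *\<^sub>R q"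
      using pabs_triangle[of "D (D q)" "b\<^sup>2 *\<^sub>R q"] q by (simp add: pabs_of_nonneg scaleR_nonneg_nonneg)
  qed (use g in auto)
  have "P (inf (pabs y) n) = 0" unfolding y_def by (rule part[OF pn(1,3,2) disj])
  then have "P (inf n (pabs y)) = 0" by (simp add: inf_commute)
  from part[OF pn(2,4) pabs_nonneg this] have "P (inf (pabs y) (pabs y)) = 0"
    by (simp only: y_n[symmetric])
  then have Py: "P (pabs y) = 0" by simp
  have "P y = y" unfolding y_def by (simp add: P_simps PD pn)
  have "pabs y \<le> P (pabs y)"
  proof (rule pabs_leI)
    show "y \<le> P (pabs y)" using P_mono[OF pabs_ge(1), of y] \<open>P y = y\<close> by simp
    show "- y \<le> P (pabs y)" using P_mono[OF pabs_ge(2), of y] \<open>P y = y\<close> P_simps(2)[of 0 y] by (simp add: P_simps(3))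
  qed
  then have "norm y \<le> norm (P (pabs y))" by (rule norm_le_of_pabs_le)
  then have "y = 0" using Py by simp
  \<comment> \<open>A nonnegative solution is sent by the half turn both to its negative and into
    the cone.\<close>
  have zero: "q = 0" if q: "0 \<le> q" "P q = q" "D (D q) + b\<^sup>2 *\<^sub>R q = 0" for q
  proof -
    have "V \<tau> q = - q" using q by (intro rot) (simp_all add: eq_neg_iff_add_eq_0)
    then have "q \<le> 0" using V_pos[OF q(1), of \<tau>] by simp
    then show ?thesis using q(1) by (rule antisym)
  qed
  have "p = 0" using zero[OF pn(1,3)] \<open>y = 0\<close> by (simp add: y_def)
  moreover have "n = 0" using zero[OF pn(2,4)] \<open>y = 0\<close> y_n by simp
  ultimately show ?thesis using x_eq by simp
qed

end

section \<open>The complex Banach lattice\<close>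

lemma cscale_of_real: "cscale (complex_of_real r) f = r *\<^sub>R f"
  by (simp add: cscale_def prod_eq_iff)

lemma bounded_bilinear_cscale:
  "bounded_bilinear (cscale :: complex \<Rightarrow> 'r::banach_lattice cplx \<Rightarrow> 'r cplx)"
proof (rule bounded_bilinear.intro)
  show "\<exists>K. \<forall>c (f :: 'r cplx). norm (cscale c f) \<le> norm c * norm f * K"
  proof (intro exI[of _ 4] allI)
    fix c :: complex and f :: "'r cplx"
    have re: "norm (Re c *\<^sub>R g) \<le> norm c * norm g" and im: "norm (Im c *\<^sub>R g) \<le> norm c * norm g" for g :: 'r
      using abs_Re_le_cmod[of c] abs_Im_le_cmod[of c] by (simp_all add: mult_right_mono)
    have c: "norm c * norm (fst f) \<le> norm c * norm f" "norm c * norm (snd f) \<le> norm c * norm f"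
      using norm_fst_le[of "fst f" "snd f"] norm_snd_le[of "snd f" "fst f"] by (auto intro: mult_left_mono)
    have "norm (cscale c f) \<le> norm (Re c *\<^sub>R fst f - Im c *\<^sub>R snd f) + norm (Im c *\<^sub>R fst f + Re c *\<^sub>R snd f)"
      unfolding cscale_def by (rule norm_Pair_le)
    also have "\<dots> \<le> (norm (Re c *\<^sub>R fst f) + norm (Im c *\<^sub>R snd f)) + (norm (Im c *\<^sub>R fst f) + norm (Re c *\<^sub>R snd f))"
      by (intro add_mono norm_triangle_ineq norm_triangle_ineq4)
    also have "\<dots> \<le> norm c * norm f * 4"
      using re[of "fst f"] im[of "snd f"] im[of "fst f"] re[of "snd f"] c by linarith
    finally show "norm (cscale c f) \<le> norm c * norm f * 4" .
  qed
qed (simp_all add: cscale_def prod_eq_iff algebra_simps)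

interpretation cplx: complex_banach "cscale :: complex \<Rightarrow> 'r::banach_lattice cplx \<Rightarrow> 'r cplx"
  by (rule complex_banach.intro[OF bounded_bilinear_cscale])
    (simp_all add: cscale_def prod_eq_iff algebra_simps)

lemma clin_iff_bounded_op: "cplx.clin T \<longleftrightarrow> bounded_op T"
  unfolding cplx.clin_def bounded_op_iff clinear_op_def
  using linear_add[OF bounded_linear.linear] by blast

text \<open>Each passage between \<open>norm\<close> and \<open>cnorm\<close> costs a factor 2.
  Boundedness of \<open>Q\<close> ensures that the supremum defining \<open>opnorm\<close> is over a
  bounded set.\<close>

lemma norm_le_opnorm:
  assumes "bounded_op Q"
  shows "norm (Q f) \<le> 4 * opnorm Q * norm f"
proof (cases "f = 0")
  case True
  then show ?thesis using assms by (simp add: bounded_op_iff linear_0 bounded_linear.linear)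
next
  case False
  obtain K where K: "\<And>f. cnorm (Q f) \<le> K * cnorm f" using assms unfolding bounded_op_def by blast
  define g where "g = (1 / (2 * norm f)) *\<^sub>R f"
  have "cnorm g \<le> 1" using cnorm_le_norm[of g] False by (simp add: g_def)
  moreover have "bdd_above {cnorm (Q f) | f. cnorm f \<le> 1}"
  proof (rule bdd_aboveI)
    fix x assume "x \<in> {cnorm (Q f) | f. cnorm f \<le> 1}"
    then obtain f where f: "x = cnorm (Q f)" "cnorm f \<le> 1" by blast
    have "cnorm (Q f) \<le> \<bar>K\<bar> * 1"
      by (rule order_trans[OF K mult_mono]) (use f in auto)
    then show "x \<le> \<bar>K\<bar>" using f by simp
  qed
  ultimately have "cnorm (Q g) \<le> opnorm Q" unfolding opnorm_def by (intro cSup_upper) blast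
  then have "norm (Q g) \<le> 2 * opnorm Q" using norm_le_cnorm[of "Q g"] by linarith
  moreover have "Q g = (1 / (2 * norm f)) *\<^sub>R Q f"
    unfolding g_def using assms by (simp add: bounded_op_iff linear_scale bounded_linear.linear)
  ultimately show ?thesis using False by (simp add: field_simps)
qed

text \<open>Near \<open>z\<close>, \<open>g w\<close> is \<open>g z\<close> plus (w - z) times
  \<open>Q w + D\<close>, and \<open>Q w\<close> has operator norm below 1 there.\<close>

lemma op_holomorphic_locally_bounded:
  assumes "op_holomorphic_on g S" "z \<in> S" "open S"
  shows "\<exists>d>0. \<exists>C. \<forall>w f. dist z w < d \<longrightarrow> norm (g w f) \<le> C * norm f"
proof -
  obtain D where g: "bounded_op (g w)" if "w \<in> S" for w
    using assms unfolding op_holomorphic_on_def by blast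
  obtain D where D: "bounded_op D"
    "((\<lambda>w. opnorm (\<lambda>f. cscale (1 / (w - z)) (g w f - g z f) - D f)) \<longlongrightarrow> 0) (at z within S)"
    using assms unfolding op_holomorphic_on_def by blast
  define Q where "Q w f = cscale (1 / (w - z)) (g w f - g z f) - D f" for w f
  have Q: "bounded_op (Q w)" if "w \<in> S" for w
  proof -
    have c: "clinear_op (g w)" "clinear_op (g z)" "clinear_op D"
      and b: "bounded_linear (g w)" "bounded_linear (g z)" "bounded_linear D"
      using g[OF that] g[OF assms(2)] D by (auto simp: bounded_op_iff)
    have "bounded_linear (\<lambda>f. cscale (1 / (w - z)) (g w f - g z f) - D f)"
      by (intro bounded_linear_sub b bounded_linear_compose[OF cplx.sc.bounded_linear_right])
    moreover have "Q w (cscale a f) = cscale a (Q w f)" for a f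
      using c unfolding clinear_op_def Q_def by (simp add: cplx.sc.diff_right cplx.sc_sc mult.commute del: split_paired_All)
    ultimately show ?thesis
      unfolding clin_iff_bounded_op[symmetric] cplx.clin_def Q_def[abs_def] by blast
  qed
  have "\<forall>\<^sub>F w in at z within S. opnorm (Q w) < 1"
    using order_tendstoD(2)[OF D(2), of 1] by (simp add: Q_def[abs_def])
  then obtain d where d: "0 < d" "\<And>w. w \<in> S \<Longrightarrow> w \<noteq> z \<Longrightarrow> dist w z < d \<Longrightarrow> opnorm (Q w) < 1"
    unfolding eventually_at by auto
  obtain r where r: "0 < r" "ball z r \<subseteq> S" using assms open_contains_ball by blast
  obtain K1 where K1: "0 < K1" "\<And>f. norm (g z f) \<le> norm f * K1"
    using bounded_linear.pos_bounded g[OF assms(2)] unfolding bounded_op_iff by blast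
  obtain K2 where K2: "0 < K2" "\<And>f. norm (D f) \<le> norm f * K2"
    using bounded_linear.pos_bounded D(1) unfolding bounded_op_iff by blast
  obtain B where B: "0 < B" "\<And>c (f :: 'a cplx). norm (cscale c f) \<le> B * norm c * norm f"
    by (rule cplx.sc_bound) blast
  define C where "C = K1 + B * d * (4 + K2)"
  have "norm (g w f) \<le> C * norm f" if w: "dist z w < min d r" for w f
  proof (cases "w = z")
    case True
    have "norm (g z f) \<le> K1 * norm f" using K1(2)[of f] by (simp add: mult.commute)
    also have "\<dots> \<le> C * norm f" using B d K2 by (intro mult_right_mono) (auto simp: C_def)
    finally show ?thesis using True by simp
  next
    case False
    have wS: "w \<in> S" using w r by auto
    have "g w f = g z f + cscale (w - z) (Q w f + D f)"
      using False by (simp add: Q_def cplx.sc_sc cplx.sc_one)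
    then have "norm (g w f) \<le> norm (g z f) + norm (cscale (w - z) (Q w f + D f))"
      by (metis norm_triangle_ineq)
    also have "\<dots> \<le> norm f * K1 + B * norm (w - z) * norm (Q w f + D f)"
      by (intro add_mono K1 B)
    also have "\<dots> \<le> norm f * K1 + B * d * (4 * norm f + norm f * K2)"
    proof (intro add_mono order_refl mult_mono)
      show "norm (w - z) \<le> d" using w by (simp add: dist_norm norm_minus_commute)
      have "opnorm (Q w) < 1" using d(2)[OF wS False] w by (simp add: dist_commute)
      then have "4 * opnorm (Q w) * norm f \<le> 4 * 1 * norm f"
        by (intro mult_right_mono mult_left_mono) auto
      then have "norm (Q w f) \<le> 4 * norm f" using norm_le_opnorm[OF Q[OF wS], of f] by simp
      then show "norm (Q w f + D f) \<le> 4 * norm f + norm f * K2"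
        by (rule order_trans[OF norm_triangle_ineq add_mono[OF _ K2(2)]])
    qed (use B d in auto)
    also have "\<dots> = C * norm f" by (simp add: C_def algebra_simps)
    finally show ?thesis .
  qed
  then show ?thesis using d r by (intro exI[of _ "min d r"] conjI exI[of _ C] allI impI) auto
qed

section \<open>Distance to the positive cone\<close>

lemma zero_in_pos_cone: "0 \<in> pos_cone"
  unfolding pos_cone_def by (auto simp: zero_prod_def)

lemma dist_pos_le: "g \<in> pos_cone \<Longrightarrow> dist_pos f \<le> cnorm (f - g)"
  unfolding dist_pos_def by (intro cInf_lower bdd_belowI[of _ 0]) (blast, auto)

lemma dist_pos_nonneg: "0 \<le> dist_pos f"
  unfolding dist_pos_def by (rule cInf_greatest) (use zero_in_pos_cone in blast, auto)

lemma dist_pos_less: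
  assumes "dist_pos f < e"
  obtains g where "g \<in> pos_cone" "cnorm (f - g) < e"
proof -
  have "{cnorm (f - g) | g. g \<in> pos_cone} \<noteq> {}" using zero_in_pos_cone by blast
  from cInf_lessD[OF this assms[unfolded dist_pos_def]] show thesis using that by blast
qed

lemma in_pos_cone_of_approx:
  assumes "\<And>e. 0 < e \<Longrightarrow> \<exists>g\<in>pos_cone. norm (f - g) < e"
  shows "f \<in> pos_cone"
proof -
  have "0 \<le> fst f"
  proof (rule nonneg_of_approx)
    fix e :: real assume "0 < e"
    then obtain g where g: "g \<in> pos_cone" "norm (f - g) < e" using assms by blast
    have "norm (fst g - fst f) \<le> norm (f - g)"
      using norm_fst_le[of "fst f - fst g" "snd f - snd g"] by (simp add: norm_minus_commute minus_prod_def)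
    then show "\<exists>y\<ge>0. norm (y - fst f) < e" using g by (auto simp: pos_cone_def)
  qed
  moreover have "norm (snd f) \<le> 0"
  proof (rule field_le_epsilon)
    fix e :: real assume "0 < e"
    then obtain g where g: "g \<in> pos_cone" "norm (f - g) < e" using assms by blast
    have "norm (snd f - snd g) \<le> norm (f - g)"
      using norm_snd_le[of "snd f - snd g" "fst f - fst g"] by (simp add: minus_prod_def)
    then show "norm (snd f) \<le> 0 + e" using g by (auto simp: pos_cone_def)
  qed
  ultimately show ?thesis unfolding pos_cone_def by (cases f) auto
qed

section \<open>The rescaled semigroup\<close>

locale peripheral_poles =
  fixes T :: "real \<Rightarrow> 'r::banach_lattice cplx \<Rightarrow> 'r cplx"
  assumes C0: "C0_semigroup T"
    and sb_gt: "spectral_bound T > -\<infinity>"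
    and bounded: "rescaled_bounded T"
    and per_nonempty: "per_spectrum T \<noteq> {}"
    and per_finite: "finite (per_spectrum T)"
    and per_poles: "\<forall>z\<in>per_spectrum T. pole_of_resolvent T z"
begin

abbreviation "s \<equiv> sb T"

text \<open>A definite term is required as the parameter of the semigroup locale, hence the choice
  operator.\<close>

definition bnd :: real where
  "bnd = (SOME M. 1 \<le> M \<and> (\<forall>t\<ge>0. \<forall>f. norm (rescaled T t f) \<le> M * norm f))"

lemma bnd: "1 \<le> bnd" "0 \<le> t \<Longrightarrow> norm (rescaled T t f) \<le> bnd * norm f"
proof -
  obtain M where M: "\<And>t f. 0 \<le> t \<Longrightarrow> cnorm (rescaled T t f) \<le> M * cnorm f"
    using bounded unfolding rescaled_bounded_def by blast
  have "norm (rescaled T t f) \<le> (4 * \<bar>M\<bar> + 1) * norm f" if t: "0 \<le> t" for t f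
  proof -
    have "cnorm (rescaled T t f) \<le> \<bar>M\<bar> * (2 * norm f)"
      by (rule order_trans[OF M[OF t] mult_mono]) (auto simp: cnorm_le_norm)
    then have "norm (rescaled T t f) \<le> 2 * (\<bar>M\<bar> * (2 * norm f))"
      using norm_le_cnorm[of "rescaled T t f"] by linarith
    then show ?thesis by (simp add: distrib_right mult.assoc add_increasing2)
  qed
  then have "\<exists>M. 1 \<le> M \<and> (\<forall>t\<ge>0. \<forall>f. norm (rescaled T t f) \<le> M * norm f)"
    by (intro exI[of _ "4 * \<bar>M\<bar> + 1"] conjI allI impI) auto
  from someI_ex[OF this] show "1 \<le> bnd" "0 \<le> t \<Longrightarrow> norm (rescaled T t f) \<le> bnd * norm f"
    unfolding bnd_def[symmetric] by blast+
qed

lemma T_props: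
  shows T_bounded: "0 \<le> t \<Longrightarrow> bounded_op (T t)" and T_0: "T 0 = id"
    and T_add: "0 \<le> u \<Longrightarrow> 0 \<le> t \<Longrightarrow> T (u + t) f = T u (T t f)"
  using C0 unfolding C0_semigroup_def by (blast, blast, metis comp_apply)

lemma T_continuous: "continuous_on {0..} (\<lambda>t. T t f)"
  unfolding continuous_on_def
proof
  fix t :: real assume "t \<in> {0..}"
  then have "((\<lambda>u. cnorm (T u f - T t f)) \<longlongrightarrow> 0) (at t within {0..})"
    using C0 unfolding C0_semigroup_def by (auto simp del: split_paired_All)
  then show "((\<lambda>t. T t f) \<longlongrightarrow> T t f) (at t within {0..})" by (simp only: tendsto_cnorm_iff)
qed

sublocale sg: bounded_semigroup cscale "rescaled T" bnd
proof
  fix t u :: real and f :: "'r cplx"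
  show "cplx.clin (rescaled T t)" if "0 \<le> t"
  proof -
    have c: "cplx.clin (T t)" using T_bounded[OF that] by (simp add: clin_iff_bounded_op)
    show ?thesis
      unfolding cplx.clin_def rescaled_def[abs_def]
      using cplx.clin_linear[OF c] cplx.clin_sc[OF c]
      by (auto intro: bounded_linear_const_scaleR simp: cplx.sc.scaleR_right simp del: split_paired_All)
  qed
  show "norm (rescaled T t f) \<le> bnd * norm f" if "0 \<le> t" using bnd that by blast
  show "1 \<le> bnd" by (rule bnd)
  show "rescaled T 0 f = f" by (simp add: rescaled_def T_0)
  show "rescaled T (u + t) f = rescaled T u (rescaled T t f)" if "0 \<le> u" "0 \<le> t"
    using T_add[OF that, of f] T_bounded[OF that(1)] unfolding rescaled_def
    by (simp add: linear_scale[OF bounded_linear.linear] bounded_op_iff algebra_simps flip: exp_add)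
  show "continuous_on {0..} (\<lambda>t. rescaled T t f)"
    unfolding rescaled_def by (intro continuous_intros T_continuous)
qed

text \<open>The generator of the rescaled semigroup is A - s. Multiplication by
  \<open>exp (c * h)\<close> shifts the derivative at 0 by c; \<open>c = s\<close> and
  \<open>c = - s\<close> give the two directions.\<close>

lemma gr_iff: "sg.gr x g \<longleftrightarrow> x \<in> gen_dom T \<and> gen T x = g + s *\<^sub>R x"
proof -
  let ?q = "\<lambda>h. (1 / h) *\<^sub>R (T h x - x)"
  have lim_iff: "((\<lambda>h. cnorm (cscale (complex_of_real (1 / h)) (T h x - x) - g)) \<longlongrightarrow> 0) (at_right 0)
      \<longleftrightarrow> (?q \<longlongrightarrow> g) (at_right 0)" for g
    by (simp only: cscale_of_real tendsto_cnorm_iff)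
  have dom: "x \<in> gen_dom T \<longleftrightarrow> (\<exists>g. (?q \<longlongrightarrow> g) (at_right 0))"
    unfolding gen_dom_def mem_Collect_eq lim_iff ..
  have gen: "gen T x = g" if "(?q \<longlongrightarrow> g) (at_right 0)" for g
    unfolding gen_def lim_iff using that
    by (intro the_equality) (auto intro: tendsto_unique[OF trivial_limit_at_right_real])
  have exp_lim: "((\<lambda>h. (exp (c * h) - 1) / h) \<longlongrightarrow> c) (at_right 0)" for c :: real
  proof -
    have "((\<lambda>h. exp (c * h)) has_field_derivative c) (at 0)"
      by (auto intro!: derivative_eq_intros)
    then have "((\<lambda>h. (exp (c * h) - 1) / h) \<longlongrightarrow> c) (at 0)" by (simp add: DERIV_def)
    then show ?thesis by (rule filterlim_mono) (simp_all add: at_le)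
  qed
  have exp_1: "((\<lambda>h. exp (c * h)) \<longlongrightarrow> 1) (at_right 0)" for c :: real
  proof -
    have "((\<lambda>h. exp (c * h)) \<longlongrightarrow> exp (c * 0)) (at_right 0)" by (intro tendsto_intros)
    then show ?thesis by simp
  qed
  have scaled_difference: "((\<lambda>h. (1 / h) *\<^sub>R (exp (c * h) *\<^sub>R F h - x)) \<longlongrightarrow> g + c *\<^sub>R x) (at_right 0)"
    if "((\<lambda>h. (1 / h) *\<^sub>R (F h - x)) \<longlongrightarrow> g) (at_right 0)" for F g and c :: real
  proof -
    have "((\<lambda>h. exp (c * h) *\<^sub>R ((1 / h) *\<^sub>R (F h - x)) + ((exp (c * h) - 1) / h) *\<^sub>R x) \<longlongrightarrow> 1 *\<^sub>R g + c *\<^sub>R x) (at_right 0)"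
      by (intro tendsto_intros that exp_lim exp_1)
    moreover have "exp (c * h) *\<^sub>R ((1 / h) *\<^sub>R (F h - x)) + ((exp (c * h) - 1) / h) *\<^sub>R x
        = (1 / h) *\<^sub>R (exp (c * h) *\<^sub>R F h - x)" for h
      by (simp add: scaleR_diff_right scaleR_diff_left diff_divide_distrib)
    ultimately show ?thesis by simp
  qed
  have "sg.gr x g \<longleftrightarrow> (?q \<longlongrightarrow> g + s *\<^sub>R x) (at_right 0)"
  proof
    assume "sg.gr x g"
    from scaled_difference[OF this[unfolded sg.gr_def], of s]
    show "(?q \<longlongrightarrow> g + s *\<^sub>R x) (at_right 0)" by (simp add: rescaled_def mult.commute flip: exp_add)
  next
    assume "(?q \<longlongrightarrow> g + s *\<^sub>R x) (at_right 0)"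
    from scaled_difference[OF this, of "- s"]
    show "sg.gr x g" unfolding sg.gr_def by (simp add: rescaled_def mult.commute)
  qed
  also have "\<dots> \<longleftrightarrow> x \<in> gen_dom T \<and> gen T x = g + s *\<^sub>R x"
  proof
    assume lim: "(?q \<longlongrightarrow> g + s *\<^sub>R x) (at_right 0)"
    have "\<exists>g. (?q \<longlongrightarrow> g) (at_right 0)" using lim by (rule exI)
    then show "x \<in> gen_dom T \<and> gen T x = g + s *\<^sub>R x" using gen[OF lim] by (simp only: dom)
  next
    assume *: "x \<in> gen_dom T \<and> gen T x = g + s *\<^sub>R x"
    then obtain l where l: "(?q \<longlongrightarrow> l) (at_right 0)" using dom by auto
    from gen[OF l] * have "l = g + s *\<^sub>R x" by simp
    with l show "(?q \<longlongrightarrow> g + s *\<^sub>R x) (at_right 0)" by simp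
  qed
  finally show ?thesis .
qed

lemma is_resolvent_iff:
  "sg.is_resolvent (z - complex_of_real s) L \<longleftrightarrow>
    bounded_op L \<and> (\<forall>f x. L f = x \<longleftrightarrow> x \<in> gen_dom T \<and> cscale z x - gen T x = f)"
proof -
  have "sg.gr x (cscale (z - complex_of_real s) x - f) \<longleftrightarrow> x \<in> gen_dom T \<and> cscale z x - gen T x = f" for x f
  proof -
    have "cscale (z - complex_of_real s) x - f + s *\<^sub>R x = cscale z x - f"
      by (simp add: cplx.sc.diff_left cscale_of_real)
    then show ?thesis unfolding gr_iff by (auto simp: algebra_simps)
  qed
  then show ?thesis by (simp only: sg.is_resolvent_def clin_iff_bounded_op)
qed

lemma is_resolvent_resolvent:
  assumes "z \<in> resolvent_set T"
  shows "sg.is_resolvent (z - complex_of_real s) (resolvent T z)"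
  unfolding is_resolvent_iff
proof (intro conjI allI)
  let ?\<phi> = "\<lambda>f. cscale z f - gen T f"
  have bij: "bij_betw ?\<phi> (gen_dom T) UNIV" and "bounded_op (resolvent T z)"
    using assms by (auto simp: resolvent_set_def)
  then show "bounded_op (resolvent T z)" by simp
  fix f x
  show "resolvent T z f = x \<longleftrightarrow> x \<in> gen_dom T \<and> cscale z x - gen T x = f"
    unfolding resolvent_def
    using bij_betw_inv_into_left[OF bij, of x] bij_betw_inv_into_right[OF bij, of f]
      bij_betw_inv_into[OF bij] by (auto simp: bij_betw_def)
qed

lemma rho_iff: "z - complex_of_real s \<in> sg.rho \<longleftrightarrow> z \<in> resolvent_set T"
proof
  assume "z - complex_of_real s \<in> sg.rho"
  then obtain L where "sg.is_resolvent (z - complex_of_real s) L"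
    unfolding sg.rho_def by auto
  then have L: "bounded_op L" "\<And>f x. L f = x \<longleftrightarrow> x \<in> gen_dom T \<and> cscale z x - gen T x = f"
    unfolding is_resolvent_iff by blast+
  let ?\<phi> = "\<lambda>f. cscale z f - gen T f"
  have inj: "inj_on ?\<phi> (gen_dom T)" by (rule inj_onI) (metis L(2))
  have surj: "?\<phi> ` gen_dom T = UNIV"
  proof (intro equalityI subset_UNIV subsetI)
    fix f
    have "L f \<in> gen_dom T" "?\<phi> (L f) = f" using L(2)[of f "L f"] by auto
    then show "f \<in> ?\<phi> ` gen_dom T" by (intro image_eqI[where x = "L f"]) simp_all
  qed
  have "inv_into (gen_dom T) ?\<phi> f = L f" for f
    using inv_into_f_f[OF inj, of "L f"] L(2)[of f "L f"] by simp
  then have "resolvent T z = L" unfolding resolvent_def by blast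
  then show "z \<in> resolvent_set T" using inj surj L(1) unfolding resolvent_set_def bij_betw_def by simp
next
  assume "z \<in> resolvent_set T"
  then show "z - complex_of_real s \<in> sg.rho"
    unfolding sg.rho_def using is_resolvent_resolvent by blast
qed

lemma resolvent_eq: "z \<in> resolvent_set T \<Longrightarrow> resolvent T z = sg.res (z - complex_of_real s)"
  using sg.is_resolvent_eq is_resolvent_resolvent by metis

section \<open>Peripheral spectrum, poles and Riesz projections\<close>

lemma spectral_bound_eq: "spectral_bound T = ereal s"
proof -
  obtain z where "z \<in> per_spectrum T" using per_nonempty by blast
  then have "ereal (Re z) = spectral_bound T" by (simp add: per_spectrum_def)
  then show ?thesis unfolding sb_def by (metis real_of_ereal.simps(1))
qed

lemma per_spectrum_iff: "z \<in> per_spectrum T \<longleftrightarrow> z \<notin> resolvent_set T \<and> Re z = s"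
  by (simp add: per_spectrum_def gen_spectrum_def spectral_bound_eq)

definition poles :: "complex set" where
  "poles = (\<lambda>z. z - complex_of_real s) ` per_spectrum T"

lemma poles_iff: "z \<in> poles \<longleftrightarrow> z + complex_of_real s \<in> per_spectrum T"
  unfolding poles_def by (auto simp: image_iff intro: bexI[of _ "z + complex_of_real s"])

lemma riesz_proj_circle:
  assumes "z \<in> per_spectrum T"
  shows "\<exists>r>0. cball z r \<inter> gen_spectrum T = {z} \<and>
      riesz_proj T z = (\<lambda>f. integral {0..2 * pi}
             (\<lambda>\<theta>. cscale (complex_of_real r * cis \<theta> / complex_of_real (2 * pi))
                        (resolvent T (z + complex_of_real r * cis \<theta>) f)))"
proof -
  obtain r where r: "0 < r" "ball z r - {z} \<subseteq> resolvent_set T" "z \<in> gen_spectrum T"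
    using per_poles assms unfolding pole_of_resolvent_def by blast
  \<comment> \<open>Halving the radius turns the open disc of the pole into a closed one.\<close>
  have "cball z (r / 2) \<inter> gen_spectrum T = {z}"
  proof (intro equalityI subsetI)
    fix w assume w: "w \<in> cball z (r / 2) \<inter> gen_spectrum T"
    then have "w \<in> ball z r" "w \<notin> resolvent_set T" using r(1) by (auto simp: gen_spectrum_def)
    then show "w \<in> {z}" using r(2) by blast
  qed (use r in auto)
  then have "\<exists>P. \<exists>r>0. cball z r \<inter> gen_spectrum T = {z} \<and>
      P = (\<lambda>f. integral {0..2 * pi}
             (\<lambda>\<theta>. cscale (complex_of_real r * cis \<theta> / complex_of_real (2 * pi))
                        (resolvent T (z + complex_of_real r * cis \<theta>) f)))"
    using r(1) by (intro exI conjI refl) (auto intro: half_gt_zero)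
  from someI_ex[OF this] show ?thesis unfolding riesz_proj_def .
qed

text \<open>Selects a radius whose circle integral is the operator that \<open>riesz_proj\<close>
  itself picked. The Riesz projection is then a Laurent coefficient on the nose, and no two circles
  have to be compared.\<close>

definition rad :: "complex \<Rightarrow> real" where
  "rad z = (SOME r. 0 < r \<and> cball (z + complex_of_real s) r \<inter> gen_spectrum T = {z + complex_of_real s} \<and>
      riesz_proj T (z + complex_of_real s) = (\<lambda>f. integral {0..2 * pi}
             (\<lambda>\<theta>. cscale (complex_of_real r * cis \<theta> / complex_of_real (2 * pi))
                        (resolvent T (z + complex_of_real s + complex_of_real r * cis \<theta>) f))))"

lemma rad:
  assumes "z \<in> poles"
  shows "0 < rad z" "cball (z + complex_of_real s) (rad z) \<inter> gen_spectrum T = {z + complex_of_real s}"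
    "riesz_proj T (z + complex_of_real s) f = integral {0..2 * pi}
             (\<lambda>\<theta>. cscale (complex_of_real (rad z) * cis \<theta> / complex_of_real (2 * pi))
                        (resolvent T (z + complex_of_real s + complex_of_real (rad z) * cis \<theta>) f))"
  using someI_ex[OF riesz_proj_circle[OF assms[unfolded poles_iff]]]
  unfolding rad_def[symmetric] by (blast, blast, metis)

lemma rho_iff': "z \<in> sg.rho \<longleftrightarrow> z + complex_of_real s \<in> resolvent_set T"
  using rho_iff[of "z + complex_of_real s"] by simp

lemma punctured_disc: "z \<in> poles \<Longrightarrow> cball z (rad z) - {z} \<subseteq> sg.rho"
proof
  fix w assume z: "z \<in> poles" and w: "w \<in> cball z (rad z) - {z}"
  have "w + complex_of_real s \<in> cball (z + complex_of_real s) (rad z)" using w by (auto simp: dist_norm)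
  moreover have "w + complex_of_real s \<noteq> z + complex_of_real s" using w by auto
  ultimately have "w + complex_of_real s \<notin> gen_spectrum T" using rad(2)[OF z] by blast
  then show "w \<in> sg.rho" by (simp add: rho_iff' gen_spectrum_def)
qed

lemma res_growth:
  assumes "z \<in> poles"
  shows "\<exists>d>0. \<exists>C m. \<forall>w f. w \<noteq> z \<longrightarrow> dist z w < d \<longrightarrow> norm (sg.res w f) \<le> C f / norm (w - z) ^ m"
proof -
  let ?z = "z + complex_of_real s"
  have "pole_of_resolvent T ?z" using per_poles assms poles_iff by blast
  then obtain r m g where r: "0 < r" "ball ?z r - {?z} \<subseteq> resolvent_set T" "op_holomorphic_on g (ball ?z r)"
    "\<forall>w \<in> ball ?z r - {?z}. \<forall>f. resolvent T w f = cscale (1 / (w - ?z) ^ m) (g w f)"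
    unfolding pole_of_resolvent_def by blast
  obtain d C where d: "0 < d" "\<And>w f. dist ?z w < d \<Longrightarrow> norm (g w f) \<le> C * norm f"
    using op_holomorphic_locally_bounded[OF r(3)] r(1) by (metis centre_in_ball open_ball)
  obtain B where B: "0 < B" "\<And>c (f :: 'r cplx). norm (cscale c f) \<le> B * norm c * norm f"
    by (rule cplx.sc_bound) blast
  have "norm (sg.res w f) \<le> B * (C * norm f) / norm (w - z) ^ m" if w: "w \<noteq> z" "dist z w < min d r" for w f
  proof -
    have w': "w + complex_of_real s \<in> ball ?z r - {?z}" "dist ?z (w + complex_of_real s) < d"
      using w by (auto simp: dist_norm)
    then have "w + complex_of_real s \<in> resolvent_set T" using r(2) by blast
    then have "sg.res w f = resolvent T (w + complex_of_real s) f"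
      by (simp add: resolvent_eq)
    also have "\<dots> = cscale (1 / (w + complex_of_real s - ?z) ^ m) (g (w + complex_of_real s) f)"
      using r(4) w'(1) by blast
    also have "norm \<dots> \<le> B * norm (1 / (w + complex_of_real s - ?z) ^ m) * (C * norm f)"
      by (rule order_trans[OF B(2) mult_left_mono[OF d(2)[OF w'(2)]]]) (use B in simp)
    also have "\<dots> = B * (C * norm f) / norm (w - z) ^ m"
      by (simp add: norm_divide norm_power)
    finally show ?thesis .
  qed
  then show ?thesis using d(1) r(1)
    by (intro exI[of _ "min d r"] conjI exI[of _ "\<lambda>f. B * (C * norm f)"] exI[of _ m] allI impI) auto
qed

sublocale sp: semigroup_with_imaginary_poles cscale "rescaled T" bnd poles rad
proof
  show "finite poles" unfolding poles_def using per_finite by simp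
  fix z
  show "Re z = 0" "z \<notin> sg.rho" if "z \<in> poles"
    using that by (simp_all add: poles_iff per_spectrum_iff rho_iff')
  show "0 < rad z" "cball z (rad z) - {z} \<subseteq> sg.rho" if "z \<in> poles"
    using that by (rule rad, rule punctured_disc)
  show "\<exists>d>0. \<exists>C m. \<forall>w f. w \<noteq> z \<longrightarrow> dist z w < d \<longrightarrow> norm (sg.res w f) \<le> C f / norm (w - z) ^ m"
    if "z \<in> poles" using that by (rule res_growth)
next
  fix \<tau> :: real
  assume "\<i> * complex_of_real \<tau> \<notin> poles"
  then show "\<i> * complex_of_real \<tau> \<in> sg.rho" by (simp add: poles_iff per_spectrum_iff rho_iff')
qed

lemma riesz_proj_eq_proj:
  assumes "z \<in> poles"
  shows "riesz_proj T (z + complex_of_real s) f = sp.proj z f"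
proof -
  have "resolvent T (z + complex_of_real s + complex_of_real (rad z) * cis \<theta>) f
      = sg.res (z + complex_of_real (rad z) * cis \<theta>) f" for \<theta>
  proof -
    have "z + complex_of_real (rad z) * cis \<theta> \<in> sg.rho"
      by (rule sg.circ_in_rho[OF rad(1)[OF assms] punctured_disc[OF assms]])
    then show ?thesis by (simp add: rho_iff' resolvent_eq add_ac)
  qed
  then show ?thesis unfolding rad(3)[OF assms] sp.proj_def sg.laurent_def by simp
qed

end

section \<open>Asymptotic positivity\<close>

lemma sum_single:
  assumes "finite A" "a \<in> A" "\<And>z. z \<in> A \<Longrightarrow> z \<noteq> a \<Longrightarrow> g z = 0"
  shows "sum g A = (g a :: 'b::comm_monoid_add)"
  using sum.mono_neutral_right[of A "{a}" g] assms by auto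

section \<open>The limit group on the sum of the eigenspaces\<close>

context semigroup_with_imaginary_poles
begin

definition limit_group :: "real \<Rightarrow> 'a \<Rightarrow> 'a" where
  "limit_group t f = (\<Sum>z\<in>\<Lambda>. exp (z * complex_of_real t) \<odot> proj z f)"

definition limit_group_gen :: "'a \<Rightarrow> 'a" where
  "limit_group_gen f = (\<Sum>z\<in>\<Lambda>. z \<odot> proj z f)"

lemma clin_sum_proj: "clin (\<lambda>f. \<Sum>z\<in>\<Lambda>. c z \<odot> proj z f)"
  unfolding clin_def
proof (intro conjI allI)
  show "bounded_linear (\<lambda>f. \<Sum>z\<in>\<Lambda>. c z \<odot> proj z f)"
    by (intro bounded_linear_sum bounded_linear_compose[OF sc.bounded_linear_right] clin_linear proj_clin)
  fix d f
  show "(\<Sum>z\<in>\<Lambda>. c z \<odot> proj z (d \<odot> f)) = d \<odot> (\<Sum>z\<in>\<Lambda>. c z \<odot> proj z f)"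
    unfolding sc.sum_right by (intro sum.cong refl) (simp add: proj_simps sc_sc mult.commute)
qed

lemma limit_group_clin: "clin (limit_group t)"
  unfolding limit_group_def[abs_def] by (rule clin_sum_proj)

lemma limit_group_gen_clin: "clin limit_group_gen"
  unfolding limit_group_gen_def[abs_def] by (rule clin_sum_proj)

lemma proj_sum: 
  assumes "w \<in> \<Lambda>"
  shows "proj w (\<Sum>z\<in>\<Lambda>. c z \<odot> proj z f) = c w \<odot> proj w f"
proof -
  have "proj w (\<Sum>z\<in>\<Lambda>. c z \<odot> proj z f) = (\<Sum>z\<in>\<Lambda>. c z \<odot> proj w (proj z f))"
    using assms by (simp add: proj_simps)
  also have "\<dots> = c w \<odot> proj w (proj w f)"
    using assms by (intro sum_single finite_poles) (auto simp: proj_proj sc.zero_right)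
  finally show ?thesis using assms by (simp add: proj_proj)
qed

lemma limit_group_group: "limit_group t (limit_group u f) = limit_group (t + u) f"
proof -
  have "limit_group t (limit_group u f) = (\<Sum>z\<in>\<Lambda>. exp (z * complex_of_real t) \<odot> exp (z * complex_of_real u) \<odot> proj z f)"
    unfolding limit_group_def[of t] unfolding limit_group_def by (intro sum.cong refl) (simp add: proj_sum)
  also have "\<dots> = limit_group (t + u) f"
    unfolding limit_group_def by (intro sum.cong refl) (simp add: sc_sc distrib_left flip: exp_add)
  finally show ?thesis .
qed

lemma limit_group_group_gen: "limit_group 0 (limit_group_gen f) = limit_group_gen f"
  unfolding limit_group_def limit_group_gen_def by (intro sum.cong refl) (simp add: proj_sum sc_one)

lemma limit_group_gen_group_gen: "limit_group_gen (limit_group_gen f) = (\<Sum>z\<in>\<Lambda>. z\<^sup>2 \<odot> proj z f)"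
  unfolding limit_group_gen_def by (intro sum.cong refl) (simp add: proj_sum sc_sc power2_eq_square)

lemma limit_group_has_vector_derivative: "((\<lambda>t. limit_group t f) has_vector_derivative limit_group_gen f) (at 0)"
proof -
  have "((\<lambda>t. exp (z * complex_of_real t) \<odot> proj z f) has_vector_derivative z \<odot> proj z f) (at 0)" for z
  proof -
    have "((\<lambda>t. exp (z * complex_of_real t)) has_vector_derivative z) (at 0)"
      by (auto intro!: derivative_eq_intros has_vector_derivative_real_field)
    from sc.has_vector_derivative[OF this has_vector_derivative_const, of "proj z f"]
    show ?thesis by (simp add: sc.zero_right)
  qed
  then show ?thesis unfolding limit_group_def limit_group_gen_def by (intro has_vector_derivative_sum)
qed

lemma limit_group_proj: "z \<in> \<Lambda> \<Longrightarrow> limit_group t (proj z f) = exp (z * complex_of_real t) \<odot> proj z f"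
  unfolding limit_group_def
  using sum_single[OF finite_poles, of z "\<lambda>w. exp (w * complex_of_real t) \<odot> proj w (proj z f)"]
  by (simp add: proj_proj sc.zero_right)

lemma limit_group_gen_proj: "z \<in> \<Lambda> \<Longrightarrow> limit_group_gen (proj z f) = z \<odot> proj z f"
  unfolding limit_group_gen_def
  using sum_single[OF finite_poles, of z "\<lambda>w. w \<odot> proj w (proj z f)"]
  by (simp add: proj_proj sc.zero_right)

text \<open>Each nonzero component of \<open>f\<close> belongs to some w with
  \<open>w\<^sup>2 = - b\<^sup>2\<close>, so w is \<plusminus> i b, and either sign gives exp (w pi
  / b) = -1.\<close>

lemma limit_group_half_turn:
  assumes b: "b \<noteq> 0" and f: "limit_group 0 f = f" "limit_group_gen (limit_group_gen f) = - (b\<^sup>2 *\<^sub>R f)"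
  shows "limit_group (pi / b) f = - f"
proof -
  have eig: "w\<^sup>2 \<odot> proj w f = - (b\<^sup>2 *\<^sub>R proj w f)" if w: "w \<in> \<Lambda>" for w
  proof -
    have "proj w (limit_group_gen (limit_group_gen f)) = w\<^sup>2 \<odot> proj w f"
      unfolding limit_group_gen_group_gen by (rule proj_sum[OF w])
    then show ?thesis using w by (simp add: f(2) proj_simps)
  qed
  have "exp (w * complex_of_real (pi / b)) \<odot> proj w f = - (exp (w * complex_of_real 0) \<odot> proj w f)" if w: "w \<in> \<Lambda>" for w
  proof (cases "proj w f = 0")
    case False
    have "(w\<^sup>2 + complex_of_real (b\<^sup>2)) \<odot> proj w f = 0"
      using eig[OF w] by (simp only: sc.add_left sc_of_real) simp
    then have "w\<^sup>2 + complex_of_real (b\<^sup>2) = 0" using False by simp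
    then have "(w - \<i> * complex_of_real b) * (w + \<i> * complex_of_real b) = 0"
      by (simp add: algebra_simps power2_eq_square)
    then consider "w = \<i> * complex_of_real b" | "w = - (\<i> * complex_of_real b)"
      by (metis eq_iff_diff_eq_0 eq_neg_iff_add_eq_0 mult_eq_0_iff)
    then have "exp (w * complex_of_real (pi / b)) = -1"
      using b by cases (simp_all add: exp_minus)
    then show ?thesis by (simp add: sc_minus_one sc_one)
  qed (simp add: sc.zero_right)
  then have "limit_group (pi / b) f = (\<Sum>w\<in>\<Lambda>. - (exp (w * complex_of_real 0) \<odot> proj w f))"
    unfolding limit_group_def by (intro sum.cong refl)
  also have "\<dots> = - limit_group 0 f" by (simp only: limit_group_def sum_negf)
  finally show ?thesis using f by simp
qed

end

section \<open>Positivity of the limit group and location of the poles\<close>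

context peripheral_poles
begin

lemma rescaled_asymptotics: "((\<lambda>t. rescaled T t f - sp.limit_group t f) \<longlongrightarrow> 0) at_top"
  using sp.S_asymptotics[of f] by (simp add: sp.limit_group_def)

text \<open>For imaginary \<open>z\<close> the factor \<open>exp (z * t)\<close> is unimodular, so a
  return time for the finitely many exponentials works equally well from every starting time
  \<open>t\<close>.\<close>

lemma group_recurrence:
  assumes "0 < e"
  shows "\<exists>q\<ge>L. norm (sp.limit_group (t + q) f - sp.limit_group t f) < e"
proof -
  obtain B where B: "0 < B" "\<And>c (f :: 'r cplx). norm (cscale c f) \<le> B * norm c * norm f"
    by (rule cplx.sc_bound) blast
  define K where "K = B * (\<Sum>z\<in>poles. norm (sp.proj z f)) + 1"
  have K: "0 < K" using B by (auto simp: K_def intro!: add_nonneg_pos mult_nonneg_nonneg sum_nonneg)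
  have "0 < e / K" using assms K by simp
  then obtain q where q: "L \<le> q" "\<forall>z\<in>poles. norm (exp (z * complex_of_real q) - 1) < e / K"
    using sp.poles_recurrence[of "e / K" L] by blast
  have "norm (sp.limit_group (t + q) f - sp.limit_group t f)
      \<le> (\<Sum>z\<in>poles. norm (cscale (exp (z * complex_of_real (t + q)) - exp (z * complex_of_real t)) (sp.proj z f)))"
    unfolding sp.limit_group_def sum_subtractf[symmetric] cplx.sc.diff_left[symmetric] by (rule norm_sum)
  also have "\<dots> \<le> (\<Sum>z\<in>poles. B * (e / K) * norm (sp.proj z f))"
  proof (rule sum_mono)
    fix z assume z: "z \<in> poles"
    have "exp (z * complex_of_real (t + q)) - exp (z * complex_of_real t)
        = exp (z * complex_of_real t) * (exp (z * complex_of_real q) - 1)"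
      by (simp add: algebra_simps flip: exp_add)
    also have "norm \<dots> = norm (exp (z * complex_of_real q) - 1)"
      using sp.poles_imaginary[OF z] by (simp add: norm_mult)
    also have "\<dots> \<le> e / K" using q(2) z by (simp add: less_imp_le)
    finally have "norm (exp (z * complex_of_real (t + q)) - exp (z * complex_of_real t)) \<le> e / K" .
    then show "norm (cscale (exp (z * complex_of_real (t + q)) - exp (z * complex_of_real t)) (sp.proj z f))
        \<le> B * (e / K) * norm (sp.proj z f)"
      using B by (intro order_trans[OF B(2)] mult_right_mono mult_left_mono) auto
  qed
  also have "\<dots> = (e / K) * (B * (\<Sum>z\<in>poles. norm (sp.proj z f)))" by (simp add: sum_distrib_left mult_ac)
  also have "\<dots> = (e / K) * (K - 1)" by (simp add: K_def)
  also have "\<dots> < e" using assms K by (simp add: field_simps)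
  finally show ?thesis using q(1) by blast
qed

text \<open>At the late time t + q the limit orbit is close to the true orbit, which is close to the
  cone, and recurrence carries this back to \<open>t\<close>. The time \<open>t\<close> may be
  negative.\<close>

lemma group_pos:
  assumes indiv: "indiv_asym_pos T" and f: "f \<in> pos_cone"
  shows "sp.limit_group t f \<in> pos_cone"
proof (rule in_pos_cone_of_approx)
  fix e :: real assume e: "0 < e"
  have "((\<lambda>t. dist_pos (rescaled T t f)) \<longlongrightarrow> 0) at_top"
    using indiv f unfolding indiv_asym_pos_def by blast
  \<comment> \<open>\<open>e / 6\<close> in the lattice norm becomes \<open>e / 3\<close> in the
    product norm; three errors of this size add up to \<open>e\<close>.\<close>
  then have "\<forall>\<^sub>F t in at_top. dist_pos (rescaled T t f) < e / 6"
    using e by (intro order_tendstoD(2)) auto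
  moreover have "\<forall>\<^sub>F t in at_top. dist (rescaled T t f - sp.limit_group t f) 0 < e / 3"
    using e by (intro tendstoD[OF rescaled_asymptotics]) auto
  ultimately have "\<forall>\<^sub>F t in at_top. dist_pos (rescaled T t f) < e / 6 \<and> norm (rescaled T t f - sp.limit_group t f) < e / 3"
    by eventually_elim (simp add: dist_norm)
  then obtain L where L: "\<And>t. L \<le> t \<Longrightarrow> dist_pos (rescaled T t f) < e / 6 \<and> norm (rescaled T t f - sp.limit_group t f) < e / 3"
    unfolding eventually_at_top_linorder by blast
  obtain q where q: "L - t \<le> q" "norm (sp.limit_group (t + q) f - sp.limit_group t f) < e / 3"
    using group_recurrence[of "e / 3" "L - t" t f] e by auto
  have tq: "dist_pos (rescaled T (t + q) f) < e / 6" "norm (rescaled T (t + q) f - sp.limit_group (t + q) f) < e / 3"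
    using L[of "t + q"] q(1) by auto
  obtain g where g: "g \<in> pos_cone" "cnorm (rescaled T (t + q) f - g) < e / 6"
    using dist_pos_less[OF tq(1)] by blast
  have "norm (rescaled T (t + q) f - g) < e / 3"
    using norm_le_cnorm[of "rescaled T (t + q) f - g"] g(2) by linarith
  moreover have "sp.limit_group t f - g = (rescaled T (t + q) f - g)
      - ((rescaled T (t + q) f - sp.limit_group (t + q) f) + (sp.limit_group (t + q) f - sp.limit_group t f))" by simp
  then have "norm (sp.limit_group t f - g) \<le> norm (rescaled T (t + q) f - g)
      + (norm (rescaled T (t + q) f - sp.limit_group (t + q) f) + norm (sp.limit_group (t + q) f - sp.limit_group t f))"
    by (simp only:) (rule order_trans[OF norm_triangle_ineq4 add_left_mono[OF norm_triangle_ineq]])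
  ultimately have "norm (sp.limit_group t f - g) < e" using tq(2) q(2) by linarith
  then show "\<exists>g\<in>pos_cone. norm (sp.limit_group t f - g) < e" using g(1) by blast
qed

lemma poles_subset_zero:
  assumes indiv: "indiv_asym_pos T"
  shows "poles \<subseteq> {0}"
proof
  fix z assume z: "z \<in> poles"
  define V where "V t x = fst (sp.limit_group t (x, 0))" for t and x :: 'r
  define D where "D x = fst (sp.limit_group_gen (x, 0))" for x :: 'r
  note group_simps = cplx.clin_simps[OF sp.limit_group_clin]
  note gen_simps = cplx.clin_simps[OF sp.limit_group_gen_clin]
  have pos: "sp.limit_group t (x, 0) \<in> pos_cone" if "0 \<le> x" for t x
    using that by (intro group_pos[OF indiv]) (auto simp: pos_cone_def)
  \<comment> \<open>Members of the complex cone have zero imaginary part, so splitting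
    \<open>x\<close> into positive and negative parts shows that the group preserves real
    vectors.\<close>
  have group_real: "sp.limit_group t (x, 0) = (V t x, 0)" for t x
  proof -
    have "(x, 0) = (sup x 0, 0) - (sup (- x) 0, 0 :: 'r)"
      by (simp only: minus_prod_def fst_conv snd_conv pos_part_minus_neg_part diff_zero)
    then have "sp.limit_group t (x, 0) = sp.limit_group t (sup x 0, 0) - sp.limit_group t (sup (- x) 0, 0)"
      by (metis group_simps(2))
    moreover have "snd (sp.limit_group t (sup x 0, 0)) = 0" "snd (sp.limit_group t (sup (- x) 0, 0)) = 0"
      using pos[of "sup x 0" t] pos[of "sup (- x) 0" t] by (auto simp: pos_cone_def)
    ultimately have "snd (sp.limit_group t (x, 0)) = 0" by (simp only: snd_diff) simp
    then show ?thesis by (simp add: V_def prod_eq_iff)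
  qed
  have deriv: "((\<lambda>t. fst (sp.limit_group t f)) has_vector_derivative fst (sp.limit_group_gen f)) (at 0)"
    "((\<lambda>t. snd (sp.limit_group t f)) has_vector_derivative snd (sp.limit_group_gen f)) (at 0)" for f
    using bounded_linear.has_vector_derivative[OF bounded_linear_fst sp.limit_group_has_vector_derivative]
      bounded_linear.has_vector_derivative[OF bounded_linear_snd sp.limit_group_has_vector_derivative] by auto
  \<comment> \<open>The imaginary part of the orbit vanishes for all times, hence so does its
    derivative at 0.\<close>
  have gen_real: "sp.limit_group_gen (x, 0) = (D x, 0)" for x
  proof -
    have "((\<lambda>t. snd (sp.limit_group t (x, 0))) has_vector_derivative 0) (at 0)"
      by (simp add: group_real)
    from vector_derivative_unique_at[OF this deriv(2)] show ?thesis by (simp add: D_def prod_eq_iff)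
  qed
  have embed: "bounded_linear (\<lambda>x :: 'r. (x, 0 :: 'r))"
    by (intro bounded_linear_Pair bounded_linear_ident bounded_linear_zero)
  interpret positive_family V D
  proof (rule positive_family.intro)
    fix t :: real and x :: 'r
    show "bounded_linear (V t)" unfolding V_def[abs_def]
      by (intro bounded_linear_compose[OF bounded_linear_fst] bounded_linear_compose[OF cplx.clin_linear[OF sp.limit_group_clin]] embed)
    show "bounded_linear D" unfolding D_def[abs_def]
      by (intro bounded_linear_compose[OF bounded_linear_fst] bounded_linear_compose[OF cplx.clin_linear[OF sp.limit_group_gen_clin]] embed)
    show "0 \<le> V t x" if "0 \<le> x" using pos[OF that, of t] by (auto simp: pos_cone_def V_def)
    show "((\<lambda>t. V t x) has_vector_derivative D x) (at 0)"
      unfolding V_def D_def by (rule deriv)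
    show "V 0 (D x) = D x"
      using sp.limit_group_group_gen[of "(x, 0)"] by (simp add: gen_real group_real)
    show "V 0 (V 0 x) = V 0 x"
      using sp.limit_group_group[of 0 0 "(x, 0)"] by (simp add: group_real)
  qed
  show "z \<in> {0}"
  proof (rule ccontr)
    assume "z \<notin> {0}"
    define b where "b = Im z"
    have zb: "z = \<i> * complex_of_real b" using sp.poles_imaginary[OF z] by (simp add: complex_eq_iff b_def)
    have b: "b \<noteq> 0" using \<open>z \<notin> {0}\<close> zb by auto
    obtain h where h: "sp.proj z h \<noteq> 0" using sp.proj_nonzero[OF z] by blast
    obtain x y where xy: "sp.proj z h = (x, y)" by fastforce
    have split: "(x, y) = (x, 0) + cscale \<i> (y, 0)" by (simp add: cscale_def)
    have "sp.limit_group 0 (x, y) = (V 0 x, V 0 y)"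
      unfolding split group_simps group_real by (simp add: cscale_def)
    moreover have "sp.limit_group 0 (x, y) = (x, y)"
      using sp.limit_group_proj[OF z, of 0 h] by (simp add: xy cplx.sc_one)
    ultimately have P: "P x = x" "P y = y" by (simp_all add: P_def)
    have "sp.limit_group_gen (x, y) = (D x, D y)"
      unfolding split gen_simps gen_real by (simp add: cscale_def)
    moreover have "sp.limit_group_gen (x, y) = (- (b *\<^sub>R y), b *\<^sub>R x)"
      using sp.limit_group_gen_proj[OF z, of h] unfolding xy
      by (simp add: b_def cscale_def sp.poles_imaginary[OF z])
    \<comment> \<open>Real and imaginary parts of the eigenvalue equation for
      \<open>\<i> * b\<close>: \<open>D\<close> rotates the pair, so \<open>D\<close> applied twice
      is \<open>- b\<^sup>2\<close> on each component.\<close>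
    ultimately have D1: "D x = - (b *\<^sub>R y)" "D y = b *\<^sub>R x" by simp_all
    have D2: "D (D x) = - (b\<^sup>2 *\<^sub>R x)" "D (D y) = - (b\<^sup>2 *\<^sub>R y)"
      by (simp_all add: D1 linear_scale[OF bounded_linear.linear[OF D_linear]]
          linear_neg[OF bounded_linear.linear[OF D_linear]] power2_eq_square)
    have rot: "V (pi / b) p = - p" if "P p = p" "D (D p) = - (b\<^sup>2 *\<^sub>R p)" for p
    proof -
      have "sp.limit_group (pi / b) (p, 0) = - (p, 0)"
        using that by (intro sp.limit_group_half_turn b) (simp_all add: group_real gen_real P_def)
      then show ?thesis by (simp add: group_real)
    qed
    have "x = 0" by (rule no_rotation[OF P(1) D2(1) rot])
    moreover have "y = 0" by (rule no_rotation[OF P(2) D2(2) rot])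
    ultimately show False using h xy by (simp add: zero_prod_def)
  qed
qed

section \<open>The equivalences\<close>

lemma dominant_iff: "dominant T \<longleftrightarrow> poles = {0}"
proof
  assume "dominant T"
  then show "poles = {0}" unfolding dominant_def poles_def by simp
next
  assume p: "poles = {0}"
  have "z \<in> per_spectrum T \<longleftrightarrow> z = complex_of_real s" for z
    using poles_iff[of "z - complex_of_real s"] p by simp
  then show "dominant T" unfolding dominant_def by blast
qed

lemma riesz_proj_dominant:
  assumes "dominant T"
  shows "riesz_proj T (complex_of_real s) = sp.proj 0" and "sp.limit_group t f = sp.proj 0 f"
proof -
  have p: "poles = {0}" using assms by (simp add: dominant_iff)
  show "riesz_proj T (complex_of_real s) = sp.proj 0"
    using riesz_proj_eq_proj[of 0] p by (intro ext) simp
  have "sp.limit_group t f = cscale (exp (0 * complex_of_real t)) (sp.proj 0 f)"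
    unfolding sp.limit_group_def by (rule sum_single[OF sp.finite_poles]) (use p in auto)
  then show "sp.limit_group t f = sp.proj 0 f" by (simp add: cplx.sc_one)
qed

lemma positive_of_indiv:
  assumes "indiv_asym_pos T"
  shows "dominant T \<and> positive_op (riesz_proj T (complex_of_real s))"
proof
  have "poles \<noteq> {}" using per_nonempty by (simp add: poles_def)
  then show dom: "dominant T" unfolding dominant_iff using poles_subset_zero[OF assms] by blast
  have "bounded_op (sp.proj 0)"
    using dom sp.proj_clin[of 0] by (simp add: dominant_iff clin_iff_bounded_op)
  moreover have "sp.proj 0 f \<in> pos_cone" if "f \<in> pos_cone" for f
    using group_pos[OF assms that, of 0] riesz_proj_dominant(2)[OF dom, of 0 f] by simp
  ultimately show "positive_op (riesz_proj T (complex_of_real s))"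
    unfolding positive_op_def riesz_proj_dominant(1)[OF dom] by blast
qed

lemma strong_limit_dominant:
  assumes "dominant T"
  shows "strong_limit T (riesz_proj T (complex_of_real s))"
  unfolding strong_limit_def
proof
  fix f
  have "((\<lambda>t. rescaled T t f - sp.proj 0 f) \<longlongrightarrow> 0) at_top"
    using rescaled_asymptotics[of f] by (simp add: riesz_proj_dominant(2)[OF assms])
  then have "((\<lambda>t. rescaled T t f) \<longlongrightarrow> sp.proj 0 f) at_top" by (rule LIM_zero_cancel)
  then show "((\<lambda>t. cnorm (rescaled T t f - riesz_proj T (complex_of_real s) f)) \<longlongrightarrow> 0) at_top"
    unfolding tendsto_cnorm_iff riesz_proj_dominant(1)[OF assms] .
qed

lemma indiv_of_strong_limit:
  assumes "positive_op Q" "strong_limit T Q"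
  shows "indiv_asym_pos T"
  unfolding indiv_asym_pos_def
proof
  fix f :: "'r cplx" assume f: "f \<in> pos_cone"
  then have Qf: "Q f \<in> pos_cone" using assms(1) unfolding positive_op_def by blast
  have lim: "((\<lambda>t. cnorm (rescaled T t f - Q f)) \<longlongrightarrow> 0) at_top"
    using assms(2) unfolding strong_limit_def by blast
  show "((\<lambda>t. dist_pos (rescaled T t f)) \<longlongrightarrow> 0) at_top"
    by (rule Lim_null_comparison[OF always_eventually lim])
      (simp add: dist_pos_nonneg dist_pos_le[OF Qf])
qed

lemma strong_limit_unique: "strong_limit T Q \<Longrightarrow> strong_limit T Q' \<Longrightarrow> Q = Q'"
  unfolding strong_limit_def tendsto_cnorm_iff
  by (rule ext) (metis tendsto_unique[OF trivial_limit_at_top_linorder])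

text \<open>\<open>sp.proj 0 f\<close> lies in the cone and is fixed by the rescaled semigroup. The
  distance is thus at most the norm of the orbit of \<open>f - sp.proj 0 f\<close>, which starts in
  the stable subspace and decays uniformly on the unit ball.\<close>

lemma unif_of_indiv:
  assumes stable: "stable_off_per T" and indiv: "indiv_asym_pos T"
  shows "unif_asym_pos T"
proof -
  have dom: "dominant T" and pos: "positive_op (sp.proj 0)"
    using positive_of_indiv[OF indiv] riesz_proj_dominant(1) by auto
  have mem: "0 \<in> poles" using dom by (simp add: dominant_iff)
  have proj_set: "riesz_proj_set T (per_spectrum T) f = sp.proj 0 f" for f
    using dom riesz_proj_dominant(1)[OF dom] by (simp add: riesz_proj_set_def dominant_def)
  obtain M \<epsilon> where M: "0 < \<epsilon>" "\<And>t f. 0 \<le> t \<Longrightarrow> f \<in> range (\<lambda>g. g - sp.proj 0 g) \<Longrightarrow>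
      cnorm (rescaled T t f) \<le> M * exp (- \<epsilon> * t) * cnorm f"
    using stable unfolding stable_off_per_def proj_set by blast
  have "bounded_op (\<lambda>g. g - sp.proj 0 g)"
  proof -
    have c: "cplx.clin (sp.proj 0)" by (rule sp.proj_clin[OF mem])
    show ?thesis
      unfolding clin_iff_bounded_op[symmetric] cplx.clin_def
      using cplx.clin_sc[OF c]
      by (auto intro: bounded_linear_sub bounded_linear_ident cplx.clin_linear[OF c] simp: cplx.sc.diff_right simp del: split_paired_All)
  qed
  then obtain C where C: "\<And>f. cnorm (f - sp.proj 0 f) \<le> C * cnorm f" unfolding bounded_op_def by blast
  show ?thesis unfolding unif_asym_pos_def
  proof (intro allI impI)
    fix e :: real assume e: "0 < e"
    define c where "c = \<bar>M\<bar> * \<bar>C\<bar>"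
    have "((\<lambda>t. c * exp (- \<epsilon> * t)) \<longlongrightarrow> 0) at_top"
      using M(1) by real_asymp
    then have "\<forall>\<^sub>F t in at_top. c * exp (- \<epsilon> * t) < e" using e by (intro order_tendstoD(2)) auto
    then obtain t0 where t0: "\<And>t. t0 \<le> t \<Longrightarrow> c * exp (- \<epsilon> * t) < e"
      unfolding eventually_at_top_linorder by blast
    show "\<exists>t0\<ge>0. \<forall>t\<ge>t0. \<forall>f\<in>pos_cone. dist_pos (rescaled T t f) \<le> e * cnorm f"
    proof (intro exI[of _ "max 0 t0"] conjI allI impI ballI)
      fix t :: real and f :: "'r cplx" assume t: "max 0 t0 \<le> t" and f: "f \<in> pos_cone"
      have fixed: "rescaled T t (sp.proj 0 f) = sp.proj 0 f"
        using sp.S_proj[OF mem, of t f] t by (simp add: cplx.sc_one)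
      have "sp.proj 0 f \<in> pos_cone" using pos f unfolding positive_op_def by blast
      then have "dist_pos (rescaled T t f) \<le> cnorm (rescaled T t f - sp.proj 0 f)" by (rule dist_pos_le)
      also have "rescaled T t f - sp.proj 0 f = rescaled T t (f - sp.proj 0 f)"
        using t fixed by (simp add: sg.S_simps)
      also have "cnorm \<dots> \<le> M * exp (- \<epsilon> * t) * cnorm (f - sp.proj 0 f)"
        using t by (intro M(2)) auto
      also have "\<dots> \<le> (\<bar>M\<bar> * exp (- \<epsilon> * t)) * (\<bar>C\<bar> * cnorm f)"
      proof (rule mult_mono)
        show "M * exp (- \<epsilon> * t) \<le> \<bar>M\<bar> * exp (- \<epsilon> * t)" by (intro mult_right_mono) auto
        show "cnorm (f - sp.proj 0 f) \<le> \<bar>C\<bar> * cnorm f"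
          by (rule order_trans[OF C mult_right_mono]) auto
      qed auto
      also have "\<dots> = (c * exp (- \<epsilon> * t)) * cnorm f" by (simp add: c_def)
      also have "\<dots> \<le> e * cnorm f" using t0[of t] t by (intro mult_right_mono) auto
      finally show "dist_pos (rescaled T t f) \<le> e * cnorm f" .
    qed simp
  qed
qed

lemma indiv_of_unif:
  assumes "unif_asym_pos T"
  shows "indiv_asym_pos T"
  unfolding indiv_asym_pos_def
proof
  fix f :: "'r cplx" assume f: "f \<in> pos_cone"
  show "((\<lambda>t. dist_pos (rescaled T t f)) \<longlongrightarrow> 0) at_top"
  proof (rule tendstoI)
    fix e :: real assume e: "0 < e"
    \<comment> \<open>Adding 1 covers \<open>cnorm f = 0\<close>, and the factor 2 leaves room for
      the strict inequality.\<close>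
    define d where "d = e / (2 * (cnorm f + 1))"
    have c: "0 < cnorm f + 1" using cnorm_nonneg[of f] by linarith
    then have d: "0 < d" using e by (simp add: d_def)
    then obtain t0 where t0: "\<And>t. t0 \<le> t \<Longrightarrow> dist_pos (rescaled T t f) \<le> d * cnorm f"
      using assms f unfolding unif_asym_pos_def by blast
    have "d * cnorm f \<le> d * (cnorm f + 1)" using d by simp
    also have "\<dots> = e / 2" using c by (simp add: d_def divide_simps)
    also have "\<dots> < e" using e by simp
    finally have "d * cnorm f < e" .
    then show "\<forall>\<^sub>F t in at_top. dist (dist_pos (rescaled T t f)) 0 < e"
      unfolding eventually_at_top_linorder
      using le_less_trans[OF t0 \<open>d * cnorm f < e\<close>]
      by (intro exI[of _ t0]) (simp add: dist_real_def abs_of_nonneg[OF dist_pos_nonneg])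
  qed
qed

end

theorem theorem8p3:
  fixes T :: "real \<Rightarrow> 'r::banach_lattice cplx \<Rightarrow> 'r cplx"
  assumes "C0_semigroup T"
    and "spectral_bound T > -\<infinity>"
    and "rescaled_bounded T"
    and "per_spectrum T \<noteq> {}"
    and "finite (per_spectrum T)"
    and "\<forall>z\<in>per_spectrum T. pole_of_resolvent T z"
  shows "((dominant T \<and> positive_op (riesz_proj T (complex_of_real (sb T)))) \<longleftrightarrow> indiv_asym_pos T) \<and>
         (indiv_asym_pos T \<longleftrightarrow> (\<exists>Q. positive_op Q \<and> strong_limit T Q)) \<and>
         (\<forall>Q. dominant T \<and> positive_op (riesz_proj T (complex_of_real (sb T))) \<and>
             indiv_asym_pos T \<and> positive_op Q \<and> strong_limit T Q
           \<longrightarrow> Q = riesz_proj T (complex_of_real (sb T))) \<and>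
         (stable_off_per T \<longrightarrow> (indiv_asym_pos T \<longleftrightarrow> unif_asym_pos T))"
proof -
  interpret peripheral_poles T by unfold_locales (fact assms)+
  \<comment> \<open>The cycle is (ii) to (i), (i) to (iii) with the spectral projection as the
    limit, and (iii) back to (ii).\<close>
  have 1: "(dominant T \<and> positive_op (riesz_proj T (complex_of_real (sb T)))) \<longleftrightarrow> indiv_asym_pos T"
    using positive_of_indiv strong_limit_dominant indiv_of_strong_limit by blast
  have 2: "indiv_asym_pos T \<longleftrightarrow> (\<exists>Q. positive_op Q \<and> strong_limit T Q)"
    using 1 strong_limit_dominant indiv_of_strong_limit by blast
  have 3: "\<forall>Q. dominant T \<and> positive_op (riesz_proj T (complex_of_real (sb T))) \<and>
             indiv_asym_pos T \<and> positive_op Q \<and> strong_limit T Q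
           \<longrightarrow> Q = riesz_proj T (complex_of_real (sb T))"
    using strong_limit_dominant strong_limit_unique by blast
  have 4: "stable_off_per T \<longrightarrow> (indiv_asym_pos T \<longleftrightarrow> unif_asym_pos T)"
    using unif_of_indiv indiv_of_unif by blast
  show ?thesis using 1 2 3 4 by blast
qed

end
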